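(* Let $k$ be a field and $A=\bigoplus_{n\in\mathbb Z_{\ge0}}A^n$ a graded commutative differential $k$-algebra with derivation $T$ of degree $+1$. Assume $A^0$ is of finite type as a $k$-algebra, and that $A$ is generated by $A^0$ as a differential algebra. Let $J=JA^0$ be the arc algebra of $A^0$, whose derivation is also denoted $T$. The canonical map $\pi:J\to A$ is a surjection; write $I=\ker\pi$, which is a differential ideal of $J$. Then (a) $\mathrm{HK}_1(A)=0$ if and only if $\pi$ is an isomorphism, and (b) in general there exists an injection $$\mathrm{HK}_1(A)\longrightarrow I/(J\cdot TI).$$
   Context: Here "graded commutative" means a commutative algebra equipped with a grading (no signs). For a commutative $k$-algebra $R$, the arc algebra $JR$ is the commutative differential $k$-algebra equipped with an algebra map $R\to JR$ such that every $k$-algebra map $R\to B$ to a commutative differential $k$-algebra $(B,T)$ extends uniquely to a map of differential algebras $JR\to B$; $\pi$ is the extension of the inclusion $A^0\subset A$. For a commutative differential $k$-algebra $(A,T)$ the Koszul complex is $\wedge^\bullet_A\Omega_{A/k}$, where $\Omega_{A/k}$ is the module of Kähler differentials, with $d_1:\Omega_{A/k}\to A$, $a\,dx\mapsto a\,T(x)$ and $d_2:\wedge^2\Omega_{A/k}\to\Omega_{A/k}$, $a\,dx\wedge dy\mapsto aT(x)\,dy-aT(y)\,dx$; $\mathrm{HK}_1(A)=\ker d_1/\mathrm{im}\,d_2$. $J\cdot TI$ is the ideal of $J$ generated by $\{T(x):x\in I\}$, which is contained in $I$. *)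

theory Defs
  imports "HOL-Algebra.Module" "HOL-Algebra.Subrings" "HOL-Algebra.QuotRing"
begin

section \<open>Differential algebras\<close>

text \<open>Commutative \<open>k\<close>-algebras are the locale \<^locale>\<open>algebra\<close> of HOL-Algebra; the scalar
  multiplication of the record is the action of \<open>k\<close>.\<close>

definition derivation :: "('k, 'm) ring_scheme \<Rightarrow> ('k, 'a) module \<Rightarrow> ('a \<Rightarrow> 'a) \<Rightarrow> bool" where
  "derivation k A T \<longleftrightarrow>
     T \<in> carrier A \<rightarrow> carrier A \<and>
     (\<forall>x\<in>carrier A. \<forall>y\<in>carrier A. T (x \<oplus>\<^bsub>A\<^esub> y) = T x \<oplus>\<^bsub>A\<^esub> T y) \<and>
     (\<forall>c\<in>carrier k. \<forall>x\<in>carrier A. T (c \<odot>\<^bsub>A\<^esub> x) = c \<odot>\<^bsub>A\<^esub> T x) \<and>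
     (\<forall>x\<in>carrier A. \<forall>y\<in>carrier A. T (x \<otimes>\<^bsub>A\<^esub> y) = T x \<otimes>\<^bsub>A\<^esub> y \<oplus>\<^bsub>A\<^esub> x \<otimes>\<^bsub>A\<^esub> T y)"

definition diff_algebra :: "('k, 'm) ring_scheme \<Rightarrow> ('k, 'a) module \<Rightarrow> ('a \<Rightarrow> 'a) \<Rightarrow> bool" where
  "diff_algebra k A T \<longleftrightarrow> algebra k A \<and> derivation k A T"

definition alg_hom :: "('k, 'm) ring_scheme \<Rightarrow> ('k, 'a) module \<Rightarrow> ('k, 'b) module \<Rightarrow> ('a \<Rightarrow> 'b) set" where
  "alg_hom k A B =
     {f \<in> ring_hom A B. \<forall>c\<in>carrier k. \<forall>x\<in>carrier A. f (c \<odot>\<^bsub>A\<^esub> x) = c \<odot>\<^bsub>B\<^esub> f x}"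

definition diff_hom ::
  "('k, 'm) ring_scheme \<Rightarrow> ('k, 'a) module \<Rightarrow> ('a \<Rightarrow> 'a) \<Rightarrow> ('k, 'b) module \<Rightarrow> ('b \<Rightarrow> 'b) \<Rightarrow> ('a \<Rightarrow> 'b) set"
  where "diff_hom k A T B S = {f \<in> alg_hom k A B. \<forall>x\<in>carrier A. f (T x) = S (f x)}"

definition diff_iso ::
  "('k, 'm) ring_scheme \<Rightarrow> ('k, 'a) module \<Rightarrow> ('a \<Rightarrow> 'a) \<Rightarrow> ('k, 'b) module \<Rightarrow> ('b \<Rightarrow> 'b) \<Rightarrow> ('a \<Rightarrow> 'b) set"
  where "diff_iso k A T B S = {f \<in> diff_hom k A T B S. bij_betw f (carrier A) (carrier B)}"

definition is_subalgebra :: "'a set \<Rightarrow> ('k, 'm) ring_scheme \<Rightarrow> ('k, 'a) module \<Rightarrow> bool" where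
  "is_subalgebra B k A \<longleftrightarrow> submodule B k A \<and> subring B A"

definition finite_type :: "('k, 'm) ring_scheme \<Rightarrow> ('k, 'a) module \<Rightarrow> bool" where
  "finite_type k A \<longleftrightarrow>
     (\<exists>S. finite S \<and> S \<subseteq> carrier A \<and> (\<forall>B. is_subalgebra B k A \<and> S \<subseteq> B \<longrightarrow> B = carrier A))"

definition diff_generated_by ::
  "('k, 'm) ring_scheme \<Rightarrow> ('k, 'a) module \<Rightarrow> ('a \<Rightarrow> 'a) \<Rightarrow> 'a set \<Rightarrow> bool" where
  "diff_generated_by k A T S \<longleftrightarrow>
     S \<subseteq> carrier A \<and>
     (\<forall>B. is_subalgebra B k A \<and> T ` B \<subseteq> B \<and> S \<subseteq> B \<longrightarrow> B = carrier A)"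

text \<open>``Graded commutative'' here means commutative and graded, without Koszul signs.\<close>

locale graded_diff_algebra =
  fixes k :: "('k, 'm) ring_scheme" and A :: "('k, 'a) module"
    and T :: "'a \<Rightarrow> 'a" and Agr :: "nat \<Rightarrow> 'a set"
  assumes field: "field k"
    and diff_algebra: "diff_algebra k A T"
    and homogeneous_submodule: "submodule (Agr n) k A"
    and decomposition: "x \<in> carrier A \<Longrightarrow>
      \<exists>!f. (\<forall>n. f n \<in> Agr n) \<and> finite {n. f n \<noteq> \<zero>\<^bsub>A\<^esub>} \<and> x = (\<Oplus>\<^bsub>A\<^esub>n\<in>{n. f n \<noteq> \<zero>\<^bsub>A\<^esub>}. f n)"
    and one_degree: "\<one>\<^bsub>A\<^esub> \<in> Agr 0"
    and mult_degree: "x \<in> Agr m \<Longrightarrow> y \<in> Agr n \<Longrightarrow> x \<otimes>\<^bsub>A\<^esub> y \<in> Agr (m + n)"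
    and T_degree: "x \<in> Agr n \<Longrightarrow> T x \<in> Agr (Suc n)"


section \<open>The arc algebra\<close>

text \<open>HOL cannot quantify over all differential algebras inside a definition, so \<open>JR\<close> is built as the
  differential \<open>k\<close>-algebra generated by \<open>R\<close>: differential polynomial expressions in elements of
  \<open>R\<close>, modulo the least congruence forced by the axioms of a commutative differential
  \<open>k\<close>-algebra and by \<open>R \<rightarrow> JR\<close> being an algebra map. The universal property, for test algebras
  over any type, is lemma \<open>arc_universal\<close> below. The constants \<open>0\<close>, \<open>1\<close> and the scalars
  \<open>c \<in> k\<close> are those coming from \<open>R\<close>.\<close>

datatype 'r dterm = DGen 'r | DAdd "'r dterm" "'r dterm" | DMul "'r dterm" "'r dterm" | DDer "'r dterm"

definition dterms :: "('k, 'r) module \<Rightarrow> 'r dterm set" where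
  "dterms R = {t. set_dterm t \<subseteq> carrier R}"

inductive arc_eq :: "('k, 'm) ring_scheme \<Rightarrow> ('k, 'r) module \<Rightarrow> 'r dterm \<Rightarrow> 'r dterm \<Rightarrow> bool"
  for k and R where
  arc_refl: "t \<in> dterms R \<Longrightarrow> arc_eq k R t t"
| arc_sym: "arc_eq k R s t \<Longrightarrow> arc_eq k R t s"
| arc_trans: "arc_eq k R s t \<Longrightarrow> arc_eq k R t u \<Longrightarrow> arc_eq k R s u"
| cong_add: "arc_eq k R s s' \<Longrightarrow> arc_eq k R t t' \<Longrightarrow> arc_eq k R (DAdd s t) (DAdd s' t')"
| cong_mul: "arc_eq k R s s' \<Longrightarrow> arc_eq k R t t' \<Longrightarrow> arc_eq k R (DMul s t) (DMul s' t')"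
| cong_der: "arc_eq k R s s' \<Longrightarrow> arc_eq k R (DDer s) (DDer s')"
| add_assoc: "s \<in> dterms R \<Longrightarrow> t \<in> dterms R \<Longrightarrow> u \<in> dterms R \<Longrightarrow>
    arc_eq k R (DAdd (DAdd s t) u) (DAdd s (DAdd t u))"
| add_comm: "s \<in> dterms R \<Longrightarrow> t \<in> dterms R \<Longrightarrow> arc_eq k R (DAdd s t) (DAdd t s)"
| add_zero: "s \<in> dterms R \<Longrightarrow> arc_eq k R (DAdd (DGen \<zero>\<^bsub>R\<^esub>) s) s"
| add_minus: "s \<in> dterms R \<Longrightarrow>
    arc_eq k R (DAdd (DMul (DGen (\<ominus>\<^bsub>R\<^esub> \<one>\<^bsub>R\<^esub>)) s) s) (DGen \<zero>\<^bsub>R\<^esub>)"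
| mul_assoc: "s \<in> dterms R \<Longrightarrow> t \<in> dterms R \<Longrightarrow> u \<in> dterms R \<Longrightarrow>
    arc_eq k R (DMul (DMul s t) u) (DMul s (DMul t u))"
| mul_comm: "s \<in> dterms R \<Longrightarrow> t \<in> dterms R \<Longrightarrow> arc_eq k R (DMul s t) (DMul t s)"
| mul_one: "s \<in> dterms R \<Longrightarrow> arc_eq k R (DMul (DGen \<one>\<^bsub>R\<^esub>) s) s"
| distrib: "s \<in> dterms R \<Longrightarrow> t \<in> dterms R \<Longrightarrow> u \<in> dterms R \<Longrightarrow>
    arc_eq k R (DMul (DAdd s t) u) (DAdd (DMul s u) (DMul t u))"
| der_add: "s \<in> dterms R \<Longrightarrow> t \<in> dterms R \<Longrightarrow>
    arc_eq k R (DDer (DAdd s t)) (DAdd (DDer s) (DDer t))"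
| der_mul: "s \<in> dterms R \<Longrightarrow> t \<in> dterms R \<Longrightarrow>
    arc_eq k R (DDer (DMul s t)) (DAdd (DMul (DDer s) t) (DMul s (DDer t)))"
| der_const: "c \<in> carrier k \<Longrightarrow> arc_eq k R (DDer (DGen (c \<odot>\<^bsub>R\<^esub> \<one>\<^bsub>R\<^esub>))) (DGen \<zero>\<^bsub>R\<^esub>)"
| gen_add: "x \<in> carrier R \<Longrightarrow> y \<in> carrier R \<Longrightarrow>
    arc_eq k R (DGen (x \<oplus>\<^bsub>R\<^esub> y)) (DAdd (DGen x) (DGen y))"
| gen_mul: "x \<in> carrier R \<Longrightarrow> y \<in> carrier R \<Longrightarrow>
    arc_eq k R (DGen (x \<otimes>\<^bsub>R\<^esub> y)) (DMul (DGen x) (DGen y))"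

definition arc_class :: "('k, 'm) ring_scheme \<Rightarrow> ('k, 'r) module \<Rightarrow> 'r dterm \<Rightarrow> 'r dterm set" where
  "arc_class k R t = {s. arc_eq k R t s}"

definition arc_in :: "('k, 'm) ring_scheme \<Rightarrow> ('k, 'r) module \<Rightarrow> 'r \<Rightarrow> 'r dterm set" where
  "arc_in k R x = arc_class k R (DGen x)"

definition arc_algebra :: "('k, 'm) ring_scheme \<Rightarrow> ('k, 'r) module \<Rightarrow> ('k, 'r dterm set) module" where
  "arc_algebra k R =
    \<lparr>carrier = arc_class k R ` dterms R,
     mult = (\<lambda>X Y. \<Union>s\<in>X. \<Union>t\<in>Y. arc_class k R (DMul s t)),
     one = arc_in k R \<one>\<^bsub>R\<^esub>,
     zero = arc_in k R \<zero>\<^bsub>R\<^esub>,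
     add = (\<lambda>X Y. \<Union>s\<in>X. \<Union>t\<in>Y. arc_class k R (DAdd s t)),
     smult = (\<lambda>c Y. \<Union>t\<in>Y. arc_class k R (DMul (DGen (c \<odot>\<^bsub>R\<^esub> \<one>\<^bsub>R\<^esub>)) t))\<rparr>"

definition arc_der :: "('k, 'm) ring_scheme \<Rightarrow> ('k, 'r) module \<Rightarrow> 'r dterm set \<Rightarrow> 'r dterm set" where
  "arc_der k R X = (\<Union>s\<in>X. arc_class k R (DDer s))"

definition arc_ext ::
  "('k, 'm) ring_scheme \<Rightarrow> ('k, 'r) module \<Rightarrow> ('k, 'b) module \<Rightarrow> ('b \<Rightarrow> 'b) \<Rightarrow> ('r \<Rightarrow> 'b) \<Rightarrow> 'r dterm set \<Rightarrow> 'b"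
  where "arc_ext k R B S f =
    (THE g. g \<in> diff_hom k (arc_algebra k R) (arc_der k R) B S \<inter> extensional (carrier (arc_algebra k R)) \<and>
            (\<forall>x\<in>carrier R. g (arc_in k R x) = f x))"


subsection \<open>The universal property\<close>

lemma dterms_simps [simp]:
  "DGen x \<in> dterms R \<longleftrightarrow> x \<in> carrier R"
  "DAdd s t \<in> dterms R \<longleftrightarrow> s \<in> dterms R \<and> t \<in> dterms R"
  "DMul s t \<in> dterms R \<longleftrightarrow> s \<in> dterms R \<and> t \<in> dterms R"
  "DDer s \<in> dterms R \<longleftrightarrow> s \<in> dterms R"
  by (auto simp: dterms_def)

lemma arc_eq_dterms:
  assumes "algebra k R" "arc_eq k R s t"
  shows "s \<in> dterms R \<and> t \<in> dterms R"
proof -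
  interpret algebra k R by fact
  show ?thesis using assms(2) by induction auto
qed

lemma arc_class_eq_iff:
  assumes "algebra k R" "s \<in> dterms R" "t \<in> dterms R"
  shows "arc_class k R s = arc_class k R t \<longleftrightarrow> arc_eq k R s t"
proof
  assume "arc_class k R s = arc_class k R t"
  then show "arc_eq k R s t" using arc_refl[OF assms(3)] by (auto simp: arc_class_def)
next
  assume "arc_eq k R s t"
  then show "arc_class k R s = arc_class k R t"
    unfolding arc_class_def by (blast intro: arc_sym arc_trans)
qed

lemma arc_class_eqI: "arc_eq k R s t \<Longrightarrow> arc_class k R s = arc_class k R t"
  unfolding arc_class_def by (blast intro: arc_sym arc_trans)

lemma arc_class_self: "t \<in> dterms R \<Longrightarrow> t \<in> arc_class k R t"
  by (simp add: arc_class_def arc_refl)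

lemmas arc_rules = arc_eq.arc_refl arc_eq.add_assoc arc_eq.add_comm arc_eq.add_zero arc_eq.add_minus
  arc_eq.mul_assoc arc_eq.mul_comm arc_eq.mul_one arc_eq.distrib arc_eq.der_add arc_eq.der_mul
  arc_eq.der_const arc_eq.gen_add arc_eq.gen_mul

lemma arc_UN1:
  assumes t: "t \<in> dterms R" and c: "\<And>s s'. arc_eq k R s s' \<Longrightarrow> arc_eq k R (h s) (h s')"
  shows "(\<Union>s\<in>arc_class k R t. arc_class k R (h s)) = arc_class k R (h t)"
proof -
  have "arc_class k R (h s) = arc_class k R (h t)" if "s \<in> arc_class k R t" for s
    using that by (intro arc_class_eqI c) (simp add: arc_class_def arc_sym)
  then have "(\<Union>s\<in>arc_class k R t. arc_class k R (h s)) = (\<Union>s\<in>arc_class k R t. arc_class k R (h t))"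
    by (intro SUP_cong refl)
  also have "\<dots> = arc_class k R (h t)" using arc_class_self[OF t, of k] by blast
  finally show ?thesis .
qed

lemma arc_algebra_simps:
  shows carrier_arc: "carrier (arc_algebra k R) = arc_class k R ` dterms R"
    and one_arc: "\<one>\<^bsub>arc_algebra k R\<^esub> = arc_class k R (DGen \<one>\<^bsub>R\<^esub>)"
    and zero_arc: "\<zero>\<^bsub>arc_algebra k R\<^esub> = arc_class k R (DGen \<zero>\<^bsub>R\<^esub>)"
    and mult_arc: "s \<in> dterms R \<Longrightarrow> t \<in> dterms R \<Longrightarrow>
      arc_class k R s \<otimes>\<^bsub>arc_algebra k R\<^esub> arc_class k R t = arc_class k R (DMul s t)"
    and add_arc: "s \<in> dterms R \<Longrightarrow> t \<in> dterms R \<Longrightarrow>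
      arc_class k R s \<oplus>\<^bsub>arc_algebra k R\<^esub> arc_class k R t = arc_class k R (DAdd s t)"
    and der_arc: "s \<in> dterms R \<Longrightarrow> arc_der k R (arc_class k R s) = arc_class k R (DDer s)"
proof -
  show "carrier (arc_algebra k R) = arc_class k R ` dterms R" by (simp add: arc_algebra_def)
  show "\<one>\<^bsub>arc_algebra k R\<^esub> = arc_class k R (DGen \<one>\<^bsub>R\<^esub>)" by (simp add: arc_algebra_def arc_in_def)
  show "\<zero>\<^bsub>arc_algebra k R\<^esub> = arc_class k R (DGen \<zero>\<^bsub>R\<^esub>)" by (simp add: arc_algebra_def arc_in_def)
  show "arc_der k R (arc_class k R s) = arc_class k R (DDer s)" if "s \<in> dterms R"
    unfolding arc_der_def by (rule arc_UN1[OF that]) (rule cong_der)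
  assume st: "s \<in> dterms R" "t \<in> dterms R"
  have *: "(\<Union>s\<in>arc_class k R s. \<Union>t\<in>arc_class k R t. arc_class k R (c s t)) = arc_class k R (c s t)"
    if c: "\<And>s s' t t'. arc_eq k R s s' \<Longrightarrow> arc_eq k R t t' \<Longrightarrow> arc_eq k R (c s t) (c s' t')" for c
  proof -
    have "arc_class k R (c s' t') = arc_class k R (c s t)"
      if "s' \<in> arc_class k R s" "t' \<in> arc_class k R t" for s' t'
      using that by (intro arc_class_eqI c) (simp_all add: arc_class_def arc_sym)
    then have "(\<Union>s\<in>arc_class k R s. \<Union>t\<in>arc_class k R t. arc_class k R (c s t)) =
        (\<Union>s'\<in>arc_class k R s. \<Union>t'\<in>arc_class k R t. arc_class k R (c s t))"
      by (intro SUP_cong refl)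
    also have "\<dots> = arc_class k R (c s t)"
      using arc_class_self[OF st(1), of k] arc_class_self[OF st(2), of k] by blast
    finally show ?thesis .
  qed
  show "arc_class k R s \<otimes>\<^bsub>arc_algebra k R\<^esub> arc_class k R t = arc_class k R (DMul s t)"
    by (simp add: arc_algebra_def *[of DMul] cong_mul)
  show "arc_class k R s \<oplus>\<^bsub>arc_algebra k R\<^esub> arc_class k R t = arc_class k R (DAdd s t)"
    by (simp add: arc_algebra_def *[of DAdd] cong_add)
qed

lemma arc_carrierI: "t \<in> dterms R \<Longrightarrow> arc_class k R t \<in> carrier (arc_algebra k R)"
  by (simp add: carrier_arc)

lemma arc_carrierE:
  assumes "x \<in> carrier (arc_algebra k R)"
  obtains t where "t \<in> dterms R" "x = arc_class k R t"
  using assms by (auto simp: carrier_arc)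

lemma smult_arc:
  assumes "algebra k R" "c \<in> carrier k" "t \<in> dterms R"
  shows "c \<odot>\<^bsub>arc_algebra k R\<^esub> arc_class k R t = arc_class k R (DMul (DGen (c \<odot>\<^bsub>R\<^esub> \<one>\<^bsub>R\<^esub>)) t)"
proof -
  interpret algebra k R by fact
  have "DGen (c \<odot>\<^bsub>R\<^esub> \<one>\<^bsub>R\<^esub>) \<in> dterms R" using assms by simp
  then show ?thesis
    unfolding arc_algebra_def module.simps
    by (intro arc_UN1 assms) (simp add: cong_mul arc_refl)
qed

lemma arc_diff_algebra:
  assumes alg: "algebra k R"
  shows "diff_algebra k (arc_algebra k R) (arc_der k R)"
proof -
  interpret algebra k R by fact
  let ?J = "arc_algebra k R"
  note ac = arc_carrierI one_arc zero_arc mult_arc add_arc der_arc smult_arc[OF alg]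
  have g [simp]: "c \<odot>\<^bsub>R\<^esub> \<one>\<^bsub>R\<^esub> \<in> carrier R" if "c \<in> carrier k" for c using that by simp
  have c: "cring ?J"
  proof (rule cringI)
    show "abelian_group ?J"
    proof (rule abelian_groupI)
      fix x assume "x \<in> carrier ?J"
      then obtain t where t: "t \<in> dterms R" "x = arc_class k R t" by (auto del: equalityI elim!: arc_carrierE simp: ac)
      have u: "DMul (DGen (\<ominus>\<^bsub>R\<^esub> \<one>\<^bsub>R\<^esub>)) t \<in> dterms R" using t by simp
      show "\<exists>y\<in>carrier ?J. y \<oplus>\<^bsub>?J\<^esub> x = \<zero>\<^bsub>?J\<^esub>"
        using t u by (intro bexI[of _ "arc_class k R (DMul (DGen (\<ominus>\<^bsub>R\<^esub> \<one>\<^bsub>R\<^esub>)) t)"])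
          (auto del: equalityI elim!: arc_carrierE simp: ac intro!: arc_class_eqI arc_rules)
    qed (auto del: equalityI elim!: arc_carrierE simp: ac intro!: arc_class_eqI intro: arc_rules)
    show "comm_monoid ?J"
      by (rule comm_monoidI) (auto del: equalityI elim!: arc_carrierE simp: ac intro!: arc_class_eqI intro: arc_rules)
    show "(x \<oplus>\<^bsub>?J\<^esub> y) \<otimes>\<^bsub>?J\<^esub> z = x \<otimes>\<^bsub>?J\<^esub> z \<oplus>\<^bsub>?J\<^esub> y \<otimes>\<^bsub>?J\<^esub> z"
      if "x \<in> carrier ?J" "y \<in> carrier ?J" "z \<in> carrier ?J" for x y z
      using that by (auto del: equalityI elim!: arc_carrierE simp: ac intro!: arc_class_eqI intro: arc_rules)
  qed
  interpret J: cring ?J by fact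
  define \<iota> where "\<iota> c = arc_class k R (DGen (c \<odot>\<^bsub>R\<^esub> \<one>\<^bsub>R\<^esub>))" for c
  have \<iota>: "\<iota> c \<in> carrier ?J" if "c \<in> carrier k" for c using that by (auto del: equalityI elim!: arc_carrierE simp: ac \<iota>_def)
  have sm: "c \<odot>\<^bsub>?J\<^esub> x = \<iota> c \<otimes>\<^bsub>?J\<^esub> x" if "c \<in> carrier k" "x \<in> carrier ?J" for c x
    using that by (auto del: equalityI elim!: arc_carrierE simp: ac \<iota>_def)
  have \<iota>_add: "\<iota> (a \<oplus>\<^bsub>k\<^esub> b) = \<iota> a \<oplus>\<^bsub>?J\<^esub> \<iota> b" if "a \<in> carrier k" "b \<in> carrier k" for a b
    using that by (auto del: equalityI elim!: arc_carrierE simp: ac \<iota>_def smult_l_distr intro!: arc_class_eqI intro: arc_rules)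
  have \<iota>_mul: "\<iota> (a \<otimes>\<^bsub>k\<^esub> b) = \<iota> a \<otimes>\<^bsub>?J\<^esub> \<iota> b" if "a \<in> carrier k" "b \<in> carrier k" for a b
  proof -
    have "(a \<otimes>\<^bsub>k\<^esub> b) \<odot>\<^bsub>R\<^esub> \<one>\<^bsub>R\<^esub> = (a \<odot>\<^bsub>R\<^esub> \<one>\<^bsub>R\<^esub>) \<otimes>\<^bsub>R\<^esub> (b \<odot>\<^bsub>R\<^esub> \<one>\<^bsub>R\<^esub>)"
      using that by (simp add: smult_assoc1 smult_assoc2)
    then show ?thesis using that by (auto del: equalityI elim!: arc_carrierE simp: ac \<iota>_def intro!: arc_class_eqI arc_eq.gen_mul)
  qed
  have \<iota>_one: "\<iota> \<one>\<^bsub>k\<^esub> = \<one>\<^bsub>?J\<^esub>" by (simp add: \<iota>_def ac)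
  have a: "algebra k ?J"
  proof (rule algebraI)
    show "cring k" "cring ?J" by (rule R_cring, rule c)
    show "\<one>\<^bsub>k\<^esub> \<odot>\<^bsub>?J\<^esub> x = x" if "x \<in> carrier ?J" for x
      using that by (simp add: sm \<iota>_one)
  next
    fix a b x y assume [simp]: "a \<in> carrier k" "x \<in> carrier ?J"
    show "a \<odot>\<^bsub>?J\<^esub> x \<in> carrier ?J" by (simp add: sm \<iota>)
    show "(a \<oplus>\<^bsub>k\<^esub> b) \<odot>\<^bsub>?J\<^esub> x = a \<odot>\<^bsub>?J\<^esub> x \<oplus>\<^bsub>?J\<^esub> b \<odot>\<^bsub>?J\<^esub> x" if "b \<in> carrier k"
      using that by (simp add: sm \<iota>_add \<iota> J.l_distr)
    show "(a \<otimes>\<^bsub>k\<^esub> b) \<odot>\<^bsub>?J\<^esub> x = a \<odot>\<^bsub>?J\<^esub> (b \<odot>\<^bsub>?J\<^esub> x)" if "b \<in> carrier k"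
      using that by (simp add: sm \<iota>_mul \<iota> J.m_assoc)
    show "a \<odot>\<^bsub>?J\<^esub> (x \<oplus>\<^bsub>?J\<^esub> y) = a \<odot>\<^bsub>?J\<^esub> x \<oplus>\<^bsub>?J\<^esub> a \<odot>\<^bsub>?J\<^esub> y" if "y \<in> carrier ?J"
      using that by (simp add: sm \<iota> J.r_distr)
    show "(a \<odot>\<^bsub>?J\<^esub> x) \<otimes>\<^bsub>?J\<^esub> y = a \<odot>\<^bsub>?J\<^esub> (x \<otimes>\<^bsub>?J\<^esub> y)" if "y \<in> carrier ?J"
      using that by (simp add: sm \<iota> J.m_assoc)
  qed
  let ?D = "arc_der k R"
  have Dc: "?D x \<in> carrier ?J" if "x \<in> carrier ?J" for x using that by (auto del: equalityI elim!: arc_carrierE simp: ac)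
  have Dm: "?D (x \<otimes>\<^bsub>?J\<^esub> y) = ?D x \<otimes>\<^bsub>?J\<^esub> y \<oplus>\<^bsub>?J\<^esub> x \<otimes>\<^bsub>?J\<^esub> ?D y"
    if "x \<in> carrier ?J" "y \<in> carrier ?J" for x y
    using that by (auto del: equalityI elim!: arc_carrierE simp: ac intro!: arc_class_eqI intro: arc_rules)
  have D\<iota>: "?D (\<iota> c) = \<zero>\<^bsub>?J\<^esub>" if "c \<in> carrier k" for c
    using that by (auto del: equalityI elim!: arc_carrierE simp: ac \<iota>_def intro!: arc_class_eqI intro: arc_rules)
  have "derivation k ?J ?D"
    unfolding derivation_def
  proof (intro conjI ballI)
    show "?D \<in> carrier ?J \<rightarrow> carrier ?J" using Dc by auto
    show "?D (x \<oplus>\<^bsub>?J\<^esub> y) = ?D x \<oplus>\<^bsub>?J\<^esub> ?D y" if "x \<in> carrier ?J" "y \<in> carrier ?J" for x y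
      using that by (auto del: equalityI elim!: arc_carrierE simp: ac intro!: arc_class_eqI intro: arc_rules)
    show "?D (c \<odot>\<^bsub>?J\<^esub> x) = c \<odot>\<^bsub>?J\<^esub> ?D x" if "c \<in> carrier k" "x \<in> carrier ?J" for c x
      using that by (simp add: sm Dm \<iota> D\<iota> Dc)
  qed (rule Dm)
  with a show ?thesis by (simp add: diff_algebra_def)
qed

lemma arc_in_hom:
  assumes alg: "algebra k R"
  shows "arc_in k R \<in> alg_hom k R (arc_algebra k R)"
proof -
  interpret algebra k R by fact
  note ac = arc_carrierI one_arc zero_arc mult_arc add_arc der_arc smult_arc[OF alg]
  have "arc_class k R (DGen (c \<odot>\<^bsub>R\<^esub> x)) = c \<odot>\<^bsub>arc_algebra k R\<^esub> arc_class k R (DGen x)"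
    if "c \<in> carrier k" "x \<in> carrier R" for c x
  proof -
    have "arc_class k R (DGen ((c \<odot>\<^bsub>R\<^esub> \<one>\<^bsub>R\<^esub>) \<otimes>\<^bsub>R\<^esub> x)) =
        arc_class k R (DMul (DGen (c \<odot>\<^bsub>R\<^esub> \<one>\<^bsub>R\<^esub>)) (DGen x))"
      using that by (intro arc_class_eqI gen_mul) auto
    also have "(c \<odot>\<^bsub>R\<^esub> \<one>\<^bsub>R\<^esub>) \<otimes>\<^bsub>R\<^esub> x = c \<odot>\<^bsub>R\<^esub> x" using that by (simp add: smult_assoc2)
    finally show ?thesis using that by (simp add: ac)
  qed
  moreover have "arc_in k R \<in> ring_hom R (arc_algebra k R)"
    unfolding arc_in_def ring_hom_def
    by (auto del: equalityI simp: ac intro!: arc_class_eqI intro: arc_rules)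
  ultimately show ?thesis by (simp add: alg_hom_def arc_in_def)
qed

fun dterm_eval :: "('k, 'b) module \<Rightarrow> ('b \<Rightarrow> 'b) \<Rightarrow> ('r \<Rightarrow> 'b) \<Rightarrow> 'r dterm \<Rightarrow> 'b" where
  "dterm_eval B S f (DGen x) = f x"
| "dterm_eval B S f (DAdd s t) = dterm_eval B S f s \<oplus>\<^bsub>B\<^esub> dterm_eval B S f t"
| "dterm_eval B S f (DMul s t) = dterm_eval B S f s \<otimes>\<^bsub>B\<^esub> dterm_eval B S f t"
| "dterm_eval B S f (DDer s) = S (dterm_eval B S f s)"

lemma arc_universal:
  assumes alg: "algebra k R" and B: "diff_algebra k B S" and f: "f \<in> alg_hom k R B"
  shows "\<exists>!g. g \<in> diff_hom k (arc_algebra k R) (arc_der k R) B S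
                \<inter> extensional (carrier (arc_algebra k R)) \<and>
              (\<forall>x\<in>carrier R. g (arc_in k R x) = f x)"
proof -
  interpret R: algebra k R by fact
  interpret B: algebra k B using B by (simp add: diff_algebra_def)
  have S: "S x \<in> carrier B" "y \<in> carrier B \<Longrightarrow> S (x \<oplus>\<^bsub>B\<^esub> y) = S x \<oplus>\<^bsub>B\<^esub> S y"
    "y \<in> carrier B \<Longrightarrow> S (x \<otimes>\<^bsub>B\<^esub> y) = S x \<otimes>\<^bsub>B\<^esub> y \<oplus>\<^bsub>B\<^esub> x \<otimes>\<^bsub>B\<^esub> S y"
    "c \<in> carrier k \<Longrightarrow> S (c \<odot>\<^bsub>B\<^esub> x) = c \<odot>\<^bsub>B\<^esub> S x"
    if "x \<in> carrier B" for x y c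
    using B that by (auto simp: diff_algebra_def derivation_def)
  have f': "f x \<in> carrier B" "y \<in> carrier R \<Longrightarrow> f (x \<oplus>\<^bsub>R\<^esub> y) = f x \<oplus>\<^bsub>B\<^esub> f y" "y \<in> carrier R \<Longrightarrow> f (x \<otimes>\<^bsub>R\<^esub> y) = f x \<otimes>\<^bsub>B\<^esub> f y"
    "c \<in> carrier k \<Longrightarrow> f (c \<odot>\<^bsub>R\<^esub> x) = c \<odot>\<^bsub>B\<^esub> f x"
    if "x \<in> carrier R" for x y c
    using f that by (auto simp: alg_hom_def ring_hom_def)
  have fhom: "f \<in> ring_hom R B" using f by (simp add: alg_hom_def)
  interpret f: ring_hom_cring R B f
    by unfold_locales (rule fhom)
  have S1: "S \<one>\<^bsub>B\<^esub> = \<zero>\<^bsub>B\<^esub>"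
  proof -
    have "S \<one>\<^bsub>B\<^esub> \<oplus>\<^bsub>B\<^esub> S \<one>\<^bsub>B\<^esub> = S \<one>\<^bsub>B\<^esub>" using S(3)[of "\<one>\<^bsub>B\<^esub>" "\<one>\<^bsub>B\<^esub>"] S(1) by simp
    then show ?thesis using S(1) by (simp add: B.add.l_cancel_one')
  qed
  let ?J = "arc_algebra k R" and ?D = "arc_der k R" and ?ev = "dterm_eval B S f"
  note ac = arc_carrierI one_arc zero_arc mult_arc add_arc der_arc smult_arc[OF alg]
  have ev: "?ev t \<in> carrier B" if "t \<in> dterms R" for t
    using that by (induction t) (auto simp: S)
  have ev_eq: "?ev s = ?ev t" if "arc_eq k R s t" for s t
    using that
  proof induction
    case (add_minus s)
    then show ?case using ev by (simp add: B.l_minus B.l_neg)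
  next
    case (add_comm s t)
    then show ?case using ev by (simp add: B.add.m_comm)
  next
    case (mul_comm s t)
    then show ?case using ev by (simp add: B.m_comm)
  next
    case (der_const c)
    then show ?case by (simp add: f' S S1)
  qed (use ev in \<open>simp_all add: S f' f.hom_one f.hom_zero B.add.m_assoc B.m_assoc B.l_distr\<close>)
  define g where "g = (\<lambda>U\<in>carrier ?J. ?ev (SOME t. t \<in> U))"
  have g: "g (arc_class k R t) = ?ev t" if t: "t \<in> dterms R" for t
  proof -
    have "(SOME s. s \<in> arc_class k R t) \<in> arc_class k R t"
      using arc_class_self[OF t] by (rule someI)
    then have "arc_eq k R t (SOME s. s \<in> arc_class k R t)" by (simp add: arc_class_def)
    from ev_eq[OF this] show ?thesis using t by (simp add: g_def ac)
  qed
  have "g \<in> diff_hom k ?J ?D B S"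
    unfolding diff_hom_def alg_hom_def ring_hom_def
    by (auto del: equalityI elim!: arc_carrierE simp: ac g ev f' B.smult_assoc2)
  moreover have "g \<in> extensional (carrier ?J)" by (simp add: g_def)
  moreover have "\<forall>x\<in>carrier R. g (arc_in k R x) = f x" by (simp add: arc_in_def g)
  moreover have "h = g" if h: "h \<in> diff_hom k ?J ?D B S" "h \<in> extensional (carrier ?J)"
    "\<forall>x\<in>carrier R. h (arc_in k R x) = f x" for h
  proof (rule extensionalityI[OF h(2) \<open>g \<in> extensional (carrier ?J)\<close>])
    fix U assume "U \<in> carrier ?J"
    then obtain t where t: "t \<in> dterms R" "U = arc_class k R t" by (auto del: equalityI elim!: arc_carrierE simp: ac)
    have hh: "v \<in> carrier ?J \<Longrightarrow> h (u \<oplus>\<^bsub>?J\<^esub> v) = h u \<oplus>\<^bsub>B\<^esub> h v" "v \<in> carrier ?J \<Longrightarrow> h (u \<otimes>\<^bsub>?J\<^esub> v) = h u \<otimes>\<^bsub>B\<^esub> h v" "h (?D u) = S (h u)"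
      if "u \<in> carrier ?J" for u v
      using h(1) that by (auto simp: diff_hom_def alg_hom_def ring_hom_def)
    have "h (arc_class k R t) = ?ev t" using t(1)
    proof (induction t)
      case (DGen x) then show ?case using h(3) by (simp add: arc_in_def)
    next
      case (DAdd s t)
      then show ?case using hh(1)[of "arc_class k R s" "arc_class k R t"] by (simp add: ac)
    next
      case (DMul s t)
      then show ?case using hh(2)[of "arc_class k R s" "arc_class k R t"] by (simp add: ac)
    next
      case (DDer s)
      then show ?case using hh(3)[of "arc_class k R s"] by (simp add: ac)
    qed
    then show "h U = g U" using t g by simp
  qed
  ultimately show ?thesis by (intro ex1I[of _ g]) blast+
qed

lemma
  assumes "algebra k R" "diff_algebra k B S" "f \<in> alg_hom k R B"
  shows arc_ext_hom: "arc_ext k R B S f \<in> diff_hom k (arc_algebra k R) (arc_der k R) B S"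
    and arc_ext_in: "x \<in> carrier R \<Longrightarrow> arc_ext k R B S f (arc_in k R x) = f x"
  using theI'[OF arc_universal[OF assms], folded arc_ext_def] by auto


section \<open>Modules by generators and relations\<close>

text \<open>Module records extend ring records; for modules that are not algebras the fields
  \<^const>\<open>mult\<close> and \<^const>\<open>one\<close> carry no meaning and are left undefined.\<close>

definition mod_hom ::
  "('a, 'm) ring_scheme \<Rightarrow> ('a, 'u) module \<Rightarrow> ('a, 'v) module \<Rightarrow> ('u \<Rightarrow> 'v) set" where
  "mod_hom R M N =
     {f \<in> carrier M \<rightarrow> carrier N.
        (\<forall>x\<in>carrier M. \<forall>y\<in>carrier M. f (x \<oplus>\<^bsub>M\<^esub> y) = f x \<oplus>\<^bsub>N\<^esub> f y) \<and>
        (\<forall>a\<in>carrier R. \<forall>x\<in>carrier M. f (a \<odot>\<^bsub>M\<^esub> x) = a \<odot>\<^bsub>N\<^esub> f x)}"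

definition self_module :: "('a, 'm) ring_scheme \<Rightarrow> ('a, 'a) module" where
  "self_module R =
    \<lparr>carrier = carrier R, mult = mult R, one = one R, zero = zero R, add = add R, smult = mult R\<rparr>"

definition restrict_scalars :: "('b \<Rightarrow> 'a) \<Rightarrow> ('a, 'u) module \<Rightarrow> ('b, 'u) module" where
  "restrict_scalars f M =
    \<lparr>carrier = carrier M, mult = mult M, one = one M, zero = zero M, add = add M,
     smult = (\<lambda>b x. f b \<odot>\<^bsub>M\<^esub> x)\<rparr>"

definition quot_module :: "('a, 'u) module \<Rightarrow> 'u set \<Rightarrow> ('a, 'u set) module" where
  "quot_module M N =
    \<lparr>carrier = a_rcosets\<^bsub>M\<^esub> N, mult = undefined, one = undefined, zero = N, add = set_add M,
     smult = (\<lambda>a C. \<Union>x\<in>C. N +>\<^bsub>M\<^esub> (a \<odot>\<^bsub>M\<^esub> x))\<rparr>"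

definition span_module :: "('a, 'm) ring_scheme \<Rightarrow> ('a, 'u) module \<Rightarrow> 'u set \<Rightarrow> 'u set" where
  "span_module R M S = \<Inter>{N. submodule N R M \<and> S \<subseteq> N}"

definition free_module :: "('a, 'm) ring_scheme \<Rightarrow> 'x set \<Rightarrow> ('a, 'x \<Rightarrow> 'a) module" where
  "free_module R X =
    \<lparr>carrier = {f \<in> X \<rightarrow>\<^sub>E carrier R. finite {x \<in> X. f x \<noteq> \<zero>\<^bsub>R\<^esub>}},
     mult = undefined, one = undefined,
     zero = (\<lambda>x\<in>X. \<zero>\<^bsub>R\<^esub>), add = (\<lambda>f g. \<lambda>x\<in>X. f x \<oplus>\<^bsub>R\<^esub> g x),
     smult = (\<lambda>a f. \<lambda>x\<in>X. a \<otimes>\<^bsub>R\<^esub> f x)\<rparr>"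

definition free_gen :: "('a, 'm) ring_scheme \<Rightarrow> 'x set \<Rightarrow> 'x \<Rightarrow> 'x \<Rightarrow> 'a" where
  "free_gen R X x = (\<lambda>y\<in>X. if y = x then \<one>\<^bsub>R\<^esub> else \<zero>\<^bsub>R\<^esub>)"

definition pres_module ::
  "('a, 'm) ring_scheme \<Rightarrow> 'x set \<Rightarrow> ('x \<Rightarrow> 'a) set \<Rightarrow> ('a, ('x \<Rightarrow> 'a) set) module" where
  "pres_module R X E = quot_module (free_module R X) (span_module R (free_module R X) E)"

definition pres_gen ::
  "('a, 'm) ring_scheme \<Rightarrow> 'x set \<Rightarrow> ('x \<Rightarrow> 'a) set \<Rightarrow> 'x \<Rightarrow> ('x \<Rightarrow> 'a) set" where
  "pres_gen R X E x = span_module R (free_module R X) E +>\<^bsub>free_module R X\<^esub> free_gen R X x"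


subsection \<open>Basic properties\<close>

lemma module_self:
  assumes "cring R" shows "module R (self_module R)"
proof -
  interpret cring R by fact
  show ?thesis
  proof (rule moduleI)
    show "cring R" by fact
    show "abelian_group (self_module R)"
      by (rule abelian_groupI) (auto simp: self_module_def a_assoc intro: a_comm a_inv_closed l_neg)
  qed (auto simp: self_module_def l_distr r_distr m_assoc)
qed

lemma quot_module_simps:
  assumes M: "module R M" and N: "submodule N R M"
  shows carrier_quot: "carrier (quot_module M N) = (\<lambda>x. N +>\<^bsub>M\<^esub> x) ` carrier M"
    and zero_quot: "\<zero>\<^bsub>quot_module M N\<^esub> = N +>\<^bsub>M\<^esub> \<zero>\<^bsub>M\<^esub>"
    and add_quot: "x \<in> carrier M \<Longrightarrow> y \<in> carrier M \<Longrightarrow>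
      (N +>\<^bsub>M\<^esub> x) \<oplus>\<^bsub>quot_module M N\<^esub> (N +>\<^bsub>M\<^esub> y) = N +>\<^bsub>M\<^esub> (x \<oplus>\<^bsub>M\<^esub> y)"
    and smult_quot: "a \<in> carrier R \<Longrightarrow> x \<in> carrier M \<Longrightarrow>
      a \<odot>\<^bsub>quot_module M N\<^esub> (N +>\<^bsub>M\<^esub> x) = N +>\<^bsub>M\<^esub> (a \<odot>\<^bsub>M\<^esub> x)"
    and quot_eq_iff: "x \<in> carrier M \<Longrightarrow> y \<in> carrier M \<Longrightarrow>
      N +>\<^bsub>M\<^esub> x = N +>\<^bsub>M\<^esub> y \<longleftrightarrow> x \<ominus>\<^bsub>M\<^esub> y \<in> N"
    and module_quot: "module R (quot_module M N)"
proof -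
  interpret module R M by fact
  interpret N: submodule N R M by fact
  have sg: "subgroup N (add_monoid M)" by (rule N.subgroup_axioms)
  have as: "abelian_subgroup N M"
    by (rule abelian_subgroupI3) (auto intro: additive_subgroup.intro sg M.abelian_group_axioms)
  interpret abelian_subgroup N M by fact
  have NM: "N \<subseteq> carrier M" by (rule a_subset)
  let ?Q = "quot_module M N"
  show car: "carrier ?Q = (\<lambda>x. N +>\<^bsub>M\<^esub> x) ` carrier M"
    by (auto simp: quot_module_def A_RCOSETS_def')
  show z: "\<zero>\<^bsub>?Q\<^esub> = N +>\<^bsub>M\<^esub> \<zero>\<^bsub>M\<^esub>"
    using NM by (simp add: quot_module_def)
  show add: "(N +>\<^bsub>M\<^esub> x) \<oplus>\<^bsub>?Q\<^esub> (N +>\<^bsub>M\<^esub> y) = N +>\<^bsub>M\<^esub> (x \<oplus>\<^bsub>M\<^esub> y)" if "x \<in> carrier M" "y \<in> carrier M" for x y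
    using that by (simp add: quot_module_def a_rcos_sum)
  have coset_eq: "N +>\<^bsub>M\<^esub> x = N +>\<^bsub>M\<^esub> y \<longleftrightarrow> x \<ominus>\<^bsub>M\<^esub> y \<in> N"
    if "x \<in> carrier M" "y \<in> carrier M" for x y
  proof
    assume "N +>\<^bsub>M\<^esub> x = N +>\<^bsub>M\<^esub> y"
    then have "x \<in> N +>\<^bsub>M\<^esub> y" using a_rcos_self[OF that(1)] by simp
    then show "x \<ominus>\<^bsub>M\<^esub> y \<in> N" using a_rcos_module_imp[OF that(2)] by (simp add: M.minus_eq)
  next
    assume "x \<ominus>\<^bsub>M\<^esub> y \<in> N"
    then have "x \<in> N +>\<^bsub>M\<^esub> y" using a_rcos_module_rev[OF that(2,1)] by (simp add: M.minus_eq)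
    then show "N +>\<^bsub>M\<^esub> x = N +>\<^bsub>M\<^esub> y"
      using a_repr_independence[OF _ that(2) sg] by simp
  qed
  then show "x \<in> carrier M \<Longrightarrow> y \<in> carrier M \<Longrightarrow> N +>\<^bsub>M\<^esub> x = N +>\<^bsub>M\<^esub> y \<longleftrightarrow> x \<ominus>\<^bsub>M\<^esub> y \<in> N" .
  have sm: "a \<odot>\<^bsub>?Q\<^esub> (N +>\<^bsub>M\<^esub> x) = N +>\<^bsub>M\<^esub> (a \<odot>\<^bsub>M\<^esub> x)" if a: "a \<in> carrier R" "x \<in> carrier M" for a x
  proof -
    have "N +>\<^bsub>M\<^esub> (a \<odot>\<^bsub>M\<^esub> y) = N +>\<^bsub>M\<^esub> (a \<odot>\<^bsub>M\<^esub> x)" if y: "y \<in> N +>\<^bsub>M\<^esub> x" for y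
    proof -
      have yc: "y \<in> carrier M" using y NM a by (auto simp: a_r_coset_def')
      have "y \<ominus>\<^bsub>M\<^esub> x \<in> N" using a_rcos_module_imp[OF a(2) y] by (simp add: M.minus_eq)
      then have "a \<odot>\<^bsub>M\<^esub> (y \<ominus>\<^bsub>M\<^esub> x) \<in> N" using a by simp
      also have "a \<odot>\<^bsub>M\<^esub> (y \<ominus>\<^bsub>M\<^esub> x) = a \<odot>\<^bsub>M\<^esub> y \<ominus>\<^bsub>M\<^esub> a \<odot>\<^bsub>M\<^esub> x"
        using a yc by (simp add: M.minus_eq smult_r_distr smult_r_minus)
      finally show ?thesis using a yc by (simp add: coset_eq)
    qed
    then have "(\<Union>y\<in>N +>\<^bsub>M\<^esub> x. N +>\<^bsub>M\<^esub> (a \<odot>\<^bsub>M\<^esub> y)) = (\<Union>y\<in>N +>\<^bsub>M\<^esub> x. N +>\<^bsub>M\<^esub> (a \<odot>\<^bsub>M\<^esub> x))"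
      by (intro SUP_cong refl)
    also have "\<dots> = N +>\<^bsub>M\<^esub> (a \<odot>\<^bsub>M\<^esub> x)" using a_rcos_self[OF a(2)] by blast
    finally show ?thesis by (simp add: quot_module_def)
  qed
  then show "a \<in> carrier R \<Longrightarrow> x \<in> carrier M \<Longrightarrow> a \<odot>\<^bsub>?Q\<^esub> (N +>\<^bsub>M\<^esub> x) = N +>\<^bsub>M\<^esub> (a \<odot>\<^bsub>M\<^esub> x)" .
  show "module R ?Q"
  proof (rule moduleI)
    show "cring R" by (rule R.is_cring)
    show "abelian_group ?Q"
    proof (rule abelian_groupI)
      fix C assume "C \<in> carrier ?Q"
      then obtain x where x: "x \<in> carrier M" "C = N +>\<^bsub>M\<^esub> x" by (auto simp: car)
      then show "\<exists>y\<in>carrier ?Q. y \<oplus>\<^bsub>?Q\<^esub> C = \<zero>\<^bsub>?Q\<^esub>"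
        by (intro bexI[of _ "N +>\<^bsub>M\<^esub> (\<ominus>\<^bsub>M\<^esub> x)"]) (auto simp: add z car M.l_neg)
    next
      show "x \<oplus>\<^bsub>?Q\<^esub> y = y \<oplus>\<^bsub>?Q\<^esub> x" if "x \<in> carrier ?Q" "y \<in> carrier ?Q" for x y
        using that by (auto simp: car add M.a_comm simp del: Un_iff)
    qed (auto simp: car add z M.a_assoc)
  qed (auto simp: car add sm smult_l_distr smult_r_distr smult_assoc1)
qed

lemma diff_zeroD:
  fixes G (structure)
  assumes "abelian_group G" "x \<in> carrier G" "y \<in> carrier G" "x \<ominus> y = \<zero>"
  shows "x = y"
proof -
  interpret abelian_group G by fact
  have "\<ominus> (\<ominus> y) = x" using assms by (intro minus_equality) (auto simp: minus_eq)
  then show ?thesis using assms by simp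
qed

lemma mod_homD:
  assumes "f \<in> mod_hom R M N"
  shows "x \<in> carrier M \<Longrightarrow> f x \<in> carrier N"
    and "x \<in> carrier M \<Longrightarrow> y \<in> carrier M \<Longrightarrow> f (x \<oplus>\<^bsub>M\<^esub> y) = f x \<oplus>\<^bsub>N\<^esub> f y"
    and "a \<in> carrier R \<Longrightarrow> x \<in> carrier M \<Longrightarrow> f (a \<odot>\<^bsub>M\<^esub> x) = a \<odot>\<^bsub>N\<^esub> f x"
  using assms by (auto simp: mod_hom_def)

lemma mod_hom_more:
  assumes "module R M" "module R N" "f \<in> mod_hom R M N"
  shows mod_hom_zero: "f \<zero>\<^bsub>M\<^esub> = \<zero>\<^bsub>N\<^esub>"
    and mod_hom_minus: "x \<in> carrier M \<Longrightarrow> f (\<ominus>\<^bsub>M\<^esub> x) = \<ominus>\<^bsub>N\<^esub> f x"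
    and mod_hom_diff: "x \<in> carrier M \<Longrightarrow> y \<in> carrier M \<Longrightarrow> f (x \<ominus>\<^bsub>M\<^esub> y) = f x \<ominus>\<^bsub>N\<^esub> f y"
    and mod_hom_ker: "submodule (a_kernel M N f) R M"
    and mod_hom_image: "submodule (f ` carrier M) R N"
proof -
  interpret M: module R M by fact
  interpret N: module R N by fact
  note f = mod_homD[OF assms(3)]
  show z: "f \<zero>\<^bsub>M\<^esub> = \<zero>\<^bsub>N\<^esub>"
    using f(3)[of "\<zero>\<^bsub>R\<^esub>" "\<zero>\<^bsub>M\<^esub>"] f(1) by simp
  have m: "f (\<ominus>\<^bsub>M\<^esub> x) = \<ominus>\<^bsub>N\<^esub> f x" if "x \<in> carrier M" for x
    using f(3)[of "\<ominus>\<^bsub>R\<^esub> \<one>\<^bsub>R\<^esub>" x] f(1)[OF that] that by (simp add: M.smult_l_minus N.smult_l_minus)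
  then show "x \<in> carrier M \<Longrightarrow> f (\<ominus>\<^bsub>M\<^esub> x) = \<ominus>\<^bsub>N\<^esub> f x" .
  show "x \<in> carrier M \<Longrightarrow> y \<in> carrier M \<Longrightarrow> f (x \<ominus>\<^bsub>M\<^esub> y) = f x \<ominus>\<^bsub>N\<^esub> f y"
    by (simp add: a_minus_def f m)
  show "submodule (a_kernel M N f) R M"
    by (rule M.submoduleI) (auto simp: a_kernel_def kernel_def z m f)
  show "submodule (f ` carrier M) R N"
  proof (rule N.submoduleI)
    show "\<zero>\<^bsub>N\<^esub> \<in> f ` carrier M" using z by (metis M.zero_closed imageI)
    show "\<ominus>\<^bsub>N\<^esub> a \<in> f ` carrier M" if "a \<in> f ` carrier M" for a
      using that by (auto simp flip: m)
    show "a \<oplus>\<^bsub>N\<^esub> b \<in> f ` carrier M" if "a \<in> f ` carrier M" "b \<in> f ` carrier M" for a b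
      using that by (auto simp flip: f(2))
    show "a \<odot>\<^bsub>N\<^esub> b \<in> f ` carrier M" if "a \<in> carrier R" "b \<in> f ` carrier M" for a b
      using that by (auto simp flip: f(3))
  qed (use f in auto)
qed

lemma span_module:
  assumes "module R M" "S \<subseteq> carrier M"
  shows span_submodule: "submodule (span_module R M S) R M"
    and span_superset: "S \<subseteq> span_module R M S"
    and span_least: "submodule N R M \<Longrightarrow> S \<subseteq> N \<Longrightarrow> span_module R M S \<subseteq> N"
proof -
  interpret module R M by fact
  note E = submoduleE
  have c: "submodule (carrier M) R M" by (rule carrier_is_submodule)
  have z: "\<zero>\<^bsub>M\<^esub> \<in> N" if "submodule N R M" for N
    using subgroup.one_closed[OF submodule.axioms(1)[OF that]] by simp
  show "submodule (span_module R M S) R M"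
  proof (rule submoduleI)
    show "span_module R M S \<subseteq> carrier M" using c assms(2) by (auto simp: span_module_def)
    show "\<zero>\<^bsub>M\<^esub> \<in> span_module R M S" by (auto simp: span_module_def z)
    show "\<ominus>\<^bsub>M\<^esub> a \<in> span_module R M S" if "a \<in> span_module R M S" for a
      using that E(3) by (auto simp: span_module_def)
    show "a \<oplus>\<^bsub>M\<^esub> b \<in> span_module R M S" if "a \<in> span_module R M S" "b \<in> span_module R M S" for a b
      using that E(5) by (auto simp: span_module_def)
    show "a \<odot>\<^bsub>M\<^esub> b \<in> span_module R M S" if "a \<in> carrier R" "b \<in> span_module R M S" for a b
      using that E(4) by (auto simp: span_module_def)
  qed
  show "S \<subseteq> span_module R M S" by (auto simp: span_module_def)
  show "submodule N R M \<Longrightarrow> S \<subseteq> N \<Longrightarrow> span_module R M S \<subseteq> N" by (auto simp: span_module_def)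
qed

lemma module_free:
  fixes R (structure)
  assumes "cring R" shows "module R (free_module R B)"
proof -
  interpret cring R by fact
  let ?F = "free_module R B"
  show ?thesis
  proof (rule moduleI)
    show "cring R" by fact
    show "abelian_group ?F"
    proof (rule abelian_groupI)
      fix f g assume fg: "f \<in> carrier ?F" "g \<in> carrier ?F"
      have "finite {x \<in> B. f x \<oplus> g x \<noteq> \<zero>}"
        by (rule finite_subset[of _ "{x \<in> B. f x \<noteq> \<zero>} \<union> {x \<in> B. g x \<noteq> \<zero>}"])
          (use fg in \<open>auto simp: free_module_def\<close>)
      then show "f \<oplus>\<^bsub>?F\<^esub> g \<in> carrier ?F"
        using fg by (auto simp: free_module_def cong: conj_cong)
      show "f \<oplus>\<^bsub>?F\<^esub> g = g \<oplus>\<^bsub>?F\<^esub> f"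
        using fg by (auto simp: free_module_def a_comm PiE_iff intro!: restrict_ext)
      show "f \<oplus>\<^bsub>?F\<^esub> g \<oplus>\<^bsub>?F\<^esub> h = f \<oplus>\<^bsub>?F\<^esub> (g \<oplus>\<^bsub>?F\<^esub> h)" if "h \<in> carrier ?F" for h
        using fg that by (auto simp: free_module_def a_assoc PiE_iff intro!: restrict_ext)
      show "\<zero>\<^bsub>?F\<^esub> \<oplus>\<^bsub>?F\<^esub> f = f"
        using fg by (auto simp: free_module_def PiE_iff intro!: extensionalityI[of _ B])
      have "{x \<in> B. \<ominus> f x \<noteq> \<zero>} \<subseteq> {x \<in> B. f x \<noteq> \<zero>}" by auto
      then have "(\<lambda>x\<in>B. \<ominus> f x) \<in> carrier ?F"
        using fg by (auto simp: free_module_def PiE_iff cong: conj_cong intro: finite_subset)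
      moreover have "(\<lambda>x\<in>B. \<ominus> f x) \<oplus>\<^bsub>?F\<^esub> f = \<zero>\<^bsub>?F\<^esub>"
        using fg by (auto simp: free_module_def PiE_iff l_neg intro!: restrict_ext)
      ultimately show "\<exists>y\<in>carrier ?F. y \<oplus>\<^bsub>?F\<^esub> f = \<zero>\<^bsub>?F\<^esub>" by blast
    qed (auto simp: free_module_def)
    show "\<one> \<odot>\<^bsub>?F\<^esub> f = f" if "f \<in> carrier ?F" for f
      using that by (auto simp: free_module_def PiE_iff intro!: extensionalityI[of _ B])
  next
    fix a f assume a: "a \<in> carrier R" and f: "f \<in> carrier ?F"
    have "{x \<in> B. a \<otimes> f x \<noteq> \<zero>} \<subseteq> {x \<in> B. f x \<noteq> \<zero>}" using a by auto
    then show "a \<odot>\<^bsub>?F\<^esub> f \<in> carrier ?F"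
      using a f by (auto simp: free_module_def PiE_iff cong: conj_cong intro: finite_subset)
    show "(a \<oplus> b) \<odot>\<^bsub>?F\<^esub> f = a \<odot>\<^bsub>?F\<^esub> f \<oplus>\<^bsub>?F\<^esub> b \<odot>\<^bsub>?F\<^esub> f" if "b \<in> carrier R" for b
      using a f that by (auto simp: free_module_def l_distr PiE_iff intro!: restrict_ext)
    show "(a \<otimes> b) \<odot>\<^bsub>?F\<^esub> f = a \<odot>\<^bsub>?F\<^esub> (b \<odot>\<^bsub>?F\<^esub> f)" if "b \<in> carrier R" for b
      using a f that by (auto simp: free_module_def m_assoc PiE_iff intro!: restrict_ext)
    show "a \<odot>\<^bsub>?F\<^esub> (f \<oplus>\<^bsub>?F\<^esub> g) = a \<odot>\<^bsub>?F\<^esub> f \<oplus>\<^bsub>?F\<^esub> a \<odot>\<^bsub>?F\<^esub> g" if "g \<in> carrier ?F" for g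
      using a f that by (auto simp: free_module_def r_distr PiE_iff intro!: restrict_ext)
  qed
qed

lemma free_gen_closed:
  assumes "cring R" "b \<in> B" shows "free_gen R B b \<in> carrier (free_module R B)"
proof -
  interpret cring R by fact
  have "finite {x \<in> B. (if x = b then \<one>\<^bsub>R\<^esub> else \<zero>\<^bsub>R\<^esub>) \<noteq> \<zero>\<^bsub>R\<^esub>}"
    by (rule finite_subset[of _ "{b}"]) auto
  then show ?thesis by (auto simp: free_module_def free_gen_def cong: conj_cong)
qed

lemma free_induct [consumes 2, case_names zero add]:
  fixes R (structure)
  assumes R: "cring R" and h: "h \<in> carrier (free_module R B)"
    and z: "P \<zero>\<^bsub>free_module R B\<^esub>"
    and s: "\<And>a b g. a \<in> carrier R \<Longrightarrow> b \<in> B \<Longrightarrow> g \<in> carrier (free_module R B) \<Longrightarrow> P g \<Longrightarrow>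
       P (a \<odot>\<^bsub>free_module R B\<^esub> free_gen R B b \<oplus>\<^bsub>free_module R B\<^esub> g)"
  shows "P h"
proof -
  interpret cring R by fact
  have "P h" if "finite V" "h \<in> carrier (free_module R B)" "{x \<in> B. h x \<noteq> \<zero>} \<subseteq> V" for V h
    using that
  proof (induction V arbitrary: h rule: finite_induct)
    case empty
    then have "h = \<zero>\<^bsub>free_module R B\<^esub>"
      by (auto simp: free_module_def PiE_iff intro!: extensionalityI[of _ B])
    then show ?case using z by simp
  next
    case (insert b V)
    show ?case
    proof (cases "b \<in> B")
      case False
      with insert.prems have "{x \<in> B. h x \<noteq> \<zero>} \<subseteq> V" by auto
      then show ?thesis using insert by blast
    next
      case b: True
      define g where "g = h(b := \<zero>)"
      have hb: "h b \<in> carrier R" using insert.prems b by (auto simp: free_module_def)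
      have "{x \<in> B. g x \<noteq> \<zero>} \<subseteq> {x \<in> B. h x \<noteq> \<zero>}" by (auto simp: g_def)
      moreover have "finite {x \<in> B. h x \<noteq> \<zero>}" using insert.prems(1) by (simp add: free_module_def)
      ultimately have "finite {x \<in> B. g x \<noteq> \<zero>}" by (rule finite_subset)
      moreover have "g \<in> B \<rightarrow>\<^sub>E carrier R"
        using insert.prems(1) b by (auto simp: free_module_def PiE_iff g_def extensional_def)
      ultimately have g: "g \<in> carrier (free_module R B)" by (simp add: free_module_def)
      have "{x \<in> B. g x \<noteq> \<zero>} \<subseteq> V" using insert.prems by (auto simp: g_def)
      then have "P g" using insert.IH g by blast
      moreover have "h = h b \<odot>\<^bsub>free_module R B\<^esub> free_gen R B b \<oplus>\<^bsub>free_module R B\<^esub> g"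
        using insert.prems(1) g hb b
        by (auto simp: free_module_def free_gen_def PiE_iff g_def intro!: extensionalityI[of _ B])
      ultimately show ?thesis using s[OF hb b g] by simp
    qed
  qed
  from this[of "{x \<in> B. h x \<noteq> \<zero>}" h] h show ?thesis by (auto simp: free_module_def)
qed

lemma free_universal:
  fixes R (structure) and N (structure)
  assumes "module R N" and f: "f \<in> B \<rightarrow> carrier N"
  shows "\<exists>\<phi>\<in>mod_hom R (free_module R B) N. \<forall>b\<in>B. \<phi> (free_gen R B b) = f b"
proof -
  interpret module R N by fact
  let ?F = "free_module R B"
  define \<phi> where "\<phi> h = (\<Oplus>\<^bsub>N\<^esub>b\<in>{b\<in>B. h b \<noteq> \<zero>\<^bsub>R\<^esub>}. h b \<odot>\<^bsub>N\<^esub> f b)" for h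
  have fc: "f b \<in> carrier N" if "b \<in> B" for b using f that by auto
  have hc: "h b \<in> carrier R" if "h \<in> carrier ?F" "b \<in> B" for h b
    using that by (auto simp: free_module_def)
  have ext: "\<phi> h = (\<Oplus>\<^bsub>N\<^esub>b\<in>V. h b \<odot>\<^bsub>N\<^esub> f b)"
    if "h \<in> carrier ?F" "finite V" "V \<subseteq> B" "{b\<in>B. h b \<noteq> \<zero>\<^bsub>R\<^esub>} \<subseteq> V" for h V
    unfolding \<phi>_def
    by (rule M.add.finprod_mono_neutral_cong_left) (use that fc hc in \<open>auto simp: subset_iff\<close>)
  have fin: "finite {b\<in>B. h b \<noteq> \<zero>\<^bsub>R\<^esub>}" if "h \<in> carrier ?F" for h
    using that by (auto simp: free_module_def)
  interpret F: module R ?F by (rule module_free) (rule R.is_cring)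
  have "\<phi> \<in> mod_hom R ?F N"
    unfolding mod_hom_def
  proof (intro CollectI conjI ballI)
    show "\<phi> \<in> carrier ?F \<rightarrow> carrier N" unfolding \<phi>_def using fc hc by (auto intro!: M.finsum_closed)
    fix g h assume gh: "g \<in> carrier ?F" "h \<in> carrier ?F"
    define V where "V = {b\<in>B. g b \<noteq> \<zero>\<^bsub>R\<^esub>} \<union> {b\<in>B. h b \<noteq> \<zero>\<^bsub>R\<^esub>}"
    have V: "finite V" "V \<subseteq> B" using fin gh by (auto simp: V_def)
    have "\<phi> (g \<oplus>\<^bsub>?F\<^esub> h) = (\<Oplus>\<^bsub>N\<^esub>b\<in>V. (g \<oplus>\<^bsub>?F\<^esub> h) b \<odot>\<^bsub>N\<^esub> f b)"
      using gh by (intro ext V F.add.m_closed) (auto simp: free_module_def V_def)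
    also have "\<dots> = (\<Oplus>\<^bsub>N\<^esub>b\<in>V. g b \<odot>\<^bsub>N\<^esub> f b \<oplus>\<^bsub>N\<^esub> h b \<odot>\<^bsub>N\<^esub> f b)"
    proof (rule M.finsum_cong')
      fix b assume "b \<in> V"
      then have "b \<in> B" using V by auto
      moreover have "(g \<oplus>\<^bsub>?F\<^esub> h) b = g b \<oplus>\<^bsub>R\<^esub> h b" using \<open>b \<in> B\<close> by (simp add: free_module_def)
      ultimately show "(g \<oplus>\<^bsub>?F\<^esub> h) b \<odot>\<^bsub>N\<^esub> f b = g b \<odot>\<^bsub>N\<^esub> f b \<oplus>\<^bsub>N\<^esub> h b \<odot>\<^bsub>N\<^esub> f b"
        using fc hc gh by (simp add: smult_l_distr)
    qed (use V fc hc gh in auto)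
    also have "\<dots> = \<phi> g \<oplus>\<^bsub>N\<^esub> \<phi> h"
      using V fc hc gh by (subst M.finsum_addf) (auto simp: ext[of _ V] V_def)
    finally show "\<phi> (g \<oplus>\<^bsub>?F\<^esub> h) = \<phi> g \<oplus>\<^bsub>N\<^esub> \<phi> h" .
  next
    fix a h assume ah: "a \<in> carrier R" "h \<in> carrier ?F"
    let ?V = "{b\<in>B. h b \<noteq> \<zero>\<^bsub>R\<^esub>}"
    have "\<phi> (a \<odot>\<^bsub>?F\<^esub> h) = (\<Oplus>\<^bsub>N\<^esub>b\<in>?V. (a \<odot>\<^bsub>?F\<^esub> h) b \<odot>\<^bsub>N\<^esub> f b)"
    proof (rule ext)
      show "a \<odot>\<^bsub>?F\<^esub> h \<in> carrier ?F" using ah by (rule F.smult_closed)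
      show "finite ?V" using ah by (intro fin)
      show "{b\<in>B. (a \<odot>\<^bsub>?F\<^esub> h) b \<noteq> \<zero>\<^bsub>R\<^esub>} \<subseteq> ?V"
        using ah by (auto simp: free_module_def)
    qed auto
    also have "\<dots> = (\<Oplus>\<^bsub>N\<^esub>b\<in>?V. a \<odot>\<^bsub>N\<^esub> (h b \<odot>\<^bsub>N\<^esub> f b))"
      by (rule M.finsum_cong') (use fc hc ah in \<open>auto simp: free_module_def smult_assoc1\<close>)
    also have "\<dots> = a \<odot>\<^bsub>N\<^esub> \<phi> h"
      unfolding \<phi>_def using fc hc ah by (intro finsum_smult_ldistr[symmetric] fin) auto
    finally show "\<phi> (a \<odot>\<^bsub>?F\<^esub> h) = a \<odot>\<^bsub>N\<^esub> \<phi> h" .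
  qed
  moreover have "\<phi> (free_gen R B b) = f b" if b: "b \<in> B" for b
  proof -
    have "\<phi> (free_gen R B b) = (\<Oplus>\<^bsub>N\<^esub>c\<in>{b}. free_gen R B b c \<odot>\<^bsub>N\<^esub> f c)"
      using b free_gen_closed[OF R.is_cring b] by (intro ext) (auto simp: free_gen_def)
    then show ?thesis using b fc by (simp add: free_gen_def)
  qed
  ultimately show ?thesis by blast
qed

lemma pres_universal:
  assumes N: "module R N" and f: "f \<in> B \<rightarrow> carrier N" and E: "E \<subseteq> carrier (free_module R B)"
    and rel: "\<And>\<phi> e. \<phi> \<in> mod_hom R (free_module R B) N \<Longrightarrow> \<forall>b\<in>B. \<phi> (free_gen R B b) = f b \<Longrightarrow>
      e \<in> E \<Longrightarrow> \<phi> e = \<zero>\<^bsub>N\<^esub>"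
  shows "\<exists>!\<psi>. \<psi> \<in> mod_hom R (pres_module R B E) N \<inter> extensional (carrier (pres_module R B E)) \<and>
     (\<forall>b\<in>B. \<psi> (pres_gen R B E b) = f b)"
proof -
  interpret N: module R N by fact
  let ?F = "free_module R B" and ?P = "pres_module R B E"
  have F: "module R ?F" by (rule module_free) (rule N.R.is_cring)
  interpret F: module R ?F by fact
  define S where "S = span_module R ?F E"
  have S: "submodule S R ?F" unfolding S_def by (rule span_submodule[OF F E])
  note q = quot_module_simps[OF F S]
  have P: "?P = quot_module ?F S" by (simp add: pres_module_def S_def)
  have pg: "pres_gen R B E b = S +>\<^bsub>?F\<^esub> free_gen R B b" for b by (simp add: pres_gen_def S_def)
  have fg: "free_gen R B b \<in> carrier ?F" if "b \<in> B" for b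
    using that by (rule free_gen_closed[OF N.R.is_cring])
  obtain \<phi> where \<phi>: "\<phi> \<in> mod_hom R ?F N" "\<forall>b\<in>B. \<phi> (free_gen R B b) = f b"
    using free_universal[OF N f] by blast
  note \<phi>' = mod_homD[OF \<phi>(1)]
  have "S \<subseteq> a_kernel ?F N \<phi>"
    unfolding S_def
  proof (rule span_least[OF F E])
    show "submodule (a_kernel ?F N \<phi>) R ?F" by (rule mod_hom_ker[OF F N \<phi>(1)])
    show "E \<subseteq> a_kernel ?F N \<phi>" using rel[OF \<phi>] E by (auto simp: a_kernel_def kernel_def)
  qed
  then have S0: "\<phi> h = \<zero>\<^bsub>N\<^esub>" if "h \<in> S" for h using that by (auto simp: a_kernel_def kernel_def)
  define \<psi> where "\<psi> = (\<lambda>C\<in>carrier ?P. \<phi> (SOME h. h \<in> carrier ?F \<and> C = S +>\<^bsub>?F\<^esub> h))"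
  have \<psi>: "\<psi> (S +>\<^bsub>?F\<^esub> h) = \<phi> h" if h: "h \<in> carrier ?F" for h
  proof -
    let ?h = "SOME h'. h' \<in> carrier ?F \<and> S +>\<^bsub>?F\<^esub> h = S +>\<^bsub>?F\<^esub> h'"
    have "?h \<in> carrier ?F \<and> S +>\<^bsub>?F\<^esub> h = S +>\<^bsub>?F\<^esub> ?h" by (rule someI[of _ h]) (simp add: h)
    then have *: "?h \<in> carrier ?F" "h \<ominus>\<^bsub>?F\<^esub> ?h \<in> S" using h q(5) by auto
    have "\<phi> h \<ominus>\<^bsub>N\<^esub> \<phi> ?h = \<zero>\<^bsub>N\<^esub>" using S0[OF *(2)] mod_hom_diff[OF F N \<phi>(1) h *(1)] by simp
    then have "\<phi> h = \<phi> ?h"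
      using diff_zeroD[OF N.M.abelian_group_axioms \<phi>'(1)[OF h] \<phi>'(1)[OF *(1)]] by simp
    then show ?thesis using h by (simp add: \<psi>_def P q)
  qed
  have "\<psi> \<in> mod_hom R ?P N"
    unfolding mod_hom_def by (auto simp: P q \<psi> \<phi>')
  moreover have "\<psi> \<in> extensional (carrier ?P)" by (simp add: \<psi>_def)
  moreover have "\<forall>b\<in>B. \<psi> (pres_gen R B E b) = f b" using \<phi>(2) fg by (simp add: pg \<psi>)
  moreover have "\<chi> = \<psi>" if \<chi>: "\<chi> \<in> mod_hom R ?P N" "\<chi> \<in> extensional (carrier ?P)"
    "\<forall>b\<in>B. \<chi> (pres_gen R B E b) = f b" for \<chi>
  proof (rule extensionalityI[OF \<chi>(2) \<open>\<psi> \<in> extensional (carrier ?P)\<close>])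
    fix C assume "C \<in> carrier ?P"
    then obtain h where h: "h \<in> carrier ?F" "C = S +>\<^bsub>?F\<^esub> h" by (auto simp: P q)
    note \<chi>' = mod_homD[OF \<chi>(1)]
    have PM: "module R ?P" unfolding P by (rule q)
    have "\<chi> (S +>\<^bsub>?F\<^esub> h) = \<phi> h"
      using N.R.is_cring h(1)
    proof (induction rule: free_induct)
      case zero
      show ?case
        using mod_hom_zero[OF PM N \<chi>(1)] mod_hom_zero[OF F N \<phi>(1)] by (simp add: P q)
    next
      case (add a b g)
      let ?b = "free_gen R B b"
      have b: "?b \<in> carrier ?F" using fg add by simp
      have "\<chi> (S +>\<^bsub>?F\<^esub> (a \<odot>\<^bsub>?F\<^esub> ?b \<oplus>\<^bsub>?F\<^esub> g)) =
         \<chi> (a \<odot>\<^bsub>?P\<^esub> (S +>\<^bsub>?F\<^esub> ?b) \<oplus>\<^bsub>?P\<^esub> (S +>\<^bsub>?F\<^esub> g))"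
        using add b by (simp add: P q)
      also have "\<dots> = a \<odot>\<^bsub>N\<^esub> \<chi> (S +>\<^bsub>?F\<^esub> ?b) \<oplus>\<^bsub>N\<^esub> \<chi> (S +>\<^bsub>?F\<^esub> g)"
      proof -
        have c: "S +>\<^bsub>?F\<^esub> ?b \<in> carrier ?P" "S +>\<^bsub>?F\<^esub> g \<in> carrier ?P"
          using add b by (auto simp: P q)
        show ?thesis
          using \<chi>'(2)[OF module.smult_closed[OF PM add(1) c(1)] c(2)] \<chi>'(3)[OF add(1) c(1)] by simp
      qed
      also have "\<dots> = \<phi> (a \<odot>\<^bsub>?F\<^esub> ?b \<oplus>\<^bsub>?F\<^esub> g)"
        using add b \<chi>(3) \<phi>(2) by (simp add: \<phi>' pg)
      finally show ?case .
    qed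
    then show "\<chi> C = \<psi> C" using h \<psi> by simp
  qed
  ultimately show ?thesis by (intro ex1I[of _ \<psi>]) blast+
qed


section \<open>Kaehler differentials, exterior square, Koszul homology\<close>

definition kaehler_rel :: "('k, 'm) ring_scheme \<Rightarrow> ('k, 'a) module \<Rightarrow> ('a \<Rightarrow> 'a) set" where
  "kaehler_rel k A =
    (let F = free_module A (carrier A); d = free_gen A (carrier A) in
      {d (x \<oplus>\<^bsub>A\<^esub> y) \<ominus>\<^bsub>F\<^esub> (d x \<oplus>\<^bsub>F\<^esub> d y) | x y. x \<in> carrier A \<and> y \<in> carrier A} \<union>
      {d (c \<odot>\<^bsub>A\<^esub> x) \<ominus>\<^bsub>F\<^esub> (c \<odot>\<^bsub>A\<^esub> \<one>\<^bsub>A\<^esub>) \<odot>\<^bsub>F\<^esub> d x | c x. c \<in> carrier k \<and> x \<in> carrier A} \<union>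
      {d (x \<otimes>\<^bsub>A\<^esub> y) \<ominus>\<^bsub>F\<^esub> (y \<odot>\<^bsub>F\<^esub> d x \<oplus>\<^bsub>F\<^esub> x \<odot>\<^bsub>F\<^esub> d y) | x y. x \<in> carrier A \<and> y \<in> carrier A})"

definition kaehler :: "('k, 'm) ring_scheme \<Rightarrow> ('k, 'a) module \<Rightarrow> ('a, ('a \<Rightarrow> 'a) set) module" where
  "kaehler k A = pres_module A (carrier A) (kaehler_rel k A)"

definition kaehler_d :: "('k, 'm) ring_scheme \<Rightarrow> ('k, 'a) module \<Rightarrow> 'a \<Rightarrow> ('a \<Rightarrow> 'a) set" where
  "kaehler_d k A = pres_gen A (carrier A) (kaehler_rel k A)"

definition ext2_rel :: "('a, 'm) ring_scheme \<Rightarrow> ('a, 'u) module \<Rightarrow> ('u \<times> 'u \<Rightarrow> 'a) set" where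
  "ext2_rel R M =
    (let X = carrier M \<times> carrier M; F = free_module R X; e = free_gen R X in
      {e (u \<oplus>\<^bsub>M\<^esub> v, w) \<ominus>\<^bsub>F\<^esub> (e (u, w) \<oplus>\<^bsub>F\<^esub> e (v, w)) | u v w.
         u \<in> carrier M \<and> v \<in> carrier M \<and> w \<in> carrier M} \<union>
      {e (u, v \<oplus>\<^bsub>M\<^esub> w) \<ominus>\<^bsub>F\<^esub> (e (u, v) \<oplus>\<^bsub>F\<^esub> e (u, w)) | u v w.
         u \<in> carrier M \<and> v \<in> carrier M \<and> w \<in> carrier M} \<union>
      {e (a \<odot>\<^bsub>M\<^esub> u, v) \<ominus>\<^bsub>F\<^esub> a \<odot>\<^bsub>F\<^esub> e (u, v) | a u v.
         a \<in> carrier R \<and> u \<in> carrier M \<and> v \<in> carrier M} \<union>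
      {e (u, a \<odot>\<^bsub>M\<^esub> v) \<ominus>\<^bsub>F\<^esub> a \<odot>\<^bsub>F\<^esub> e (u, v) | a u v.
         a \<in> carrier R \<and> u \<in> carrier M \<and> v \<in> carrier M} \<union>
      {e (u, u) | u. u \<in> carrier M})"

definition ext2 :: "('a, 'm) ring_scheme \<Rightarrow> ('a, 'u) module \<Rightarrow> ('a, ('u \<times> 'u \<Rightarrow> 'a) set) module" where
  "ext2 R M = pres_module R (carrier M \<times> carrier M) (ext2_rel R M)"

definition wedge :: "('a, 'm) ring_scheme \<Rightarrow> ('a, 'u) module \<Rightarrow> 'u \<Rightarrow> 'u \<Rightarrow> ('u \<times> 'u \<Rightarrow> 'a) set" where
  "wedge R M u v = pres_gen R (carrier M \<times> carrier M) (ext2_rel R M) (u, v)"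

text \<open>\<open>koszul_d1\<close> and \<open>koszul_d2\<close> are well-defined: see the lemmas \<open>koszul_d1_ex1\<close> and
  \<open>koszul_d2_ex1\<close> below.\<close>

definition koszul_d1 :: "('k, 'm) ring_scheme \<Rightarrow> ('k, 'a) module \<Rightarrow> ('a \<Rightarrow> 'a) \<Rightarrow> ('a \<Rightarrow> 'a) set \<Rightarrow> 'a" where
  "koszul_d1 k A T =
    (THE \<phi>. \<phi> \<in> mod_hom A (kaehler k A) (self_module A) \<inter> extensional (carrier (kaehler k A)) \<and>
       (\<forall>a\<in>carrier A. \<forall>x\<in>carrier A. \<phi> (a \<odot>\<^bsub>kaehler k A\<^esub> kaehler_d k A x) = a \<otimes>\<^bsub>A\<^esub> T x))"

definition koszul_d2 :: "('k, 'm) ring_scheme \<Rightarrow> ('k, 'a) module \<Rightarrow> ('a \<Rightarrow> 'a) \<Rightarrow>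
    (('a \<Rightarrow> 'a) set \<times> ('a \<Rightarrow> 'a) set \<Rightarrow> 'a) set \<Rightarrow> ('a \<Rightarrow> 'a) set" where
  "koszul_d2 k A T =
    (let \<Omega> = kaehler k A; d = kaehler_d k A in
      THE \<phi>. \<phi> \<in> mod_hom A (ext2 A \<Omega>) \<Omega> \<inter> extensional (carrier (ext2 A \<Omega>)) \<and>
        (\<forall>a\<in>carrier A. \<forall>x\<in>carrier A. \<forall>y\<in>carrier A.
           \<phi> (a \<odot>\<^bsub>ext2 A \<Omega>\<^esub> wedge A \<Omega> (d x) (d y)) =
             (a \<otimes>\<^bsub>A\<^esub> T x) \<odot>\<^bsub>\<Omega>\<^esub> d y \<ominus>\<^bsub>\<Omega>\<^esub> (a \<otimes>\<^bsub>A\<^esub> T y) \<odot>\<^bsub>\<Omega>\<^esub> d x))"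

definition HK1 :: "('k, 'm) ring_scheme \<Rightarrow> ('k, 'a) module \<Rightarrow> ('a \<Rightarrow> 'a) \<Rightarrow> ('a, ('a \<Rightarrow> 'a) set set) module" where
  "HK1 k A T =
    quot_module ((kaehler k A)\<lparr>carrier := a_kernel (kaehler k A) (self_module A) (koszul_d1 k A T)\<rparr>)
      (koszul_d2 k A T ` carrier (ext2 A (kaehler k A)))"


subsection \<open>Well-definedness\<close>

lemma pres_proj:
  assumes R: "cring R" and E: "E \<subseteq> carrier (free_module R B)"
  shows module_pres: "module R (pres_module R B E)"
    and pres_proj_hom: "(\<lambda>h. span_module R (free_module R B) E +>\<^bsub>free_module R B\<^esub> h)
      \<in> mod_hom R (free_module R B) (pres_module R B E)"
    and pres_proj_rel: "e \<in> E \<Longrightarrow>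
      span_module R (free_module R B) E +>\<^bsub>free_module R B\<^esub> e = \<zero>\<^bsub>pres_module R B E\<^esub>"
    and pres_gen_closed: "b \<in> B \<Longrightarrow> pres_gen R B E b \<in> carrier (pres_module R B E)"
proof -
  let ?F = "free_module R B" and ?P = "pres_module R B E"
  have F: "module R ?F" by (rule module_free[OF R])
  interpret F: module R ?F by fact
  let ?S = "span_module R ?F E"
  have S: "submodule ?S R ?F" by (rule span_submodule[OF F E])
  note q = quot_module_simps[OF F S]
  show "module R ?P" unfolding pres_module_def by (rule q)
  show "(\<lambda>h. ?S +>\<^bsub>?F\<^esub> h) \<in> mod_hom R ?F ?P"
    unfolding pres_module_def mod_hom_def by (auto simp: q)
  show "?S +>\<^bsub>?F\<^esub> e = \<zero>\<^bsub>?P\<^esub>" if "e \<in> E"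
  proof -
    have e: "e \<in> carrier ?F" "e \<in> ?S" using E span_superset[OF F E] that by auto
    have m0: "\<ominus>\<^bsub>?F\<^esub> \<zero>\<^bsub>?F\<^esub> = \<zero>\<^bsub>?F\<^esub>"
      by (metis F.M.r_neg F.M.l_zero F.M.zero_closed F.M.a_inv_closed)
    have "e \<ominus>\<^bsub>?F\<^esub> \<zero>\<^bsub>?F\<^esub> \<in> ?S"
      unfolding a_minus_def m0 F.M.r_zero[OF e(1)] by (rule e(2))
    then show ?thesis unfolding pres_module_def q(2) using e by (subst q(5)) auto
  qed
  show "b \<in> B \<Longrightarrow> pres_gen R B E b \<in> carrier ?P"
    unfolding pres_gen_def pres_module_def q(1) using free_gen_closed[OF R, of b B] by blast
qed

lemma pres_induct [consumes 3, case_names zero add]: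
  assumes R: "cring R" and E: "E \<subseteq> carrier (free_module R B)"
    and u: "u \<in> carrier (pres_module R B E)"
    and z: "P \<zero>\<^bsub>pres_module R B E\<^esub>"
    and s: "\<And>a b v. a \<in> carrier R \<Longrightarrow> b \<in> B \<Longrightarrow> v \<in> carrier (pres_module R B E) \<Longrightarrow> P v \<Longrightarrow>
       P (a \<odot>\<^bsub>pres_module R B E\<^esub> pres_gen R B E b \<oplus>\<^bsub>pres_module R B E\<^esub> v)"
  shows "P u"
proof -
  let ?F = "free_module R B" and ?P = "pres_module R B E"
  have F: "module R ?F" by (rule module_free[OF R])
  interpret F: module R ?F by fact
  let ?S = "span_module R ?F E"
  have S: "submodule ?S R ?F" by (rule span_submodule[OF F E])
  note q = quot_module_simps[OF F S]
  note p = mod_homD[OF pres_proj_hom[OF R E]]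
  obtain h where h: "h \<in> carrier ?F" "u = ?S +>\<^bsub>?F\<^esub> h"
    using u unfolding pres_module_def by (auto simp: q)
  have "P (?S +>\<^bsub>?F\<^esub> h)" using R h(1)
  proof (induction rule: free_induct)
    case zero
    then show ?case using z by (simp add: pres_module_def q)
  next
    case (add a b g)
    then show ?case using s[OF add(1,2) p(1)[OF add(3)] add(4)] free_gen_closed[OF R add(2)]
      by (simp add: p pres_gen_def)
  qed
  then show ?thesis using h by simp
qed

lemma kaehler_rel_subset:
  assumes alg: "algebra k A" shows "kaehler_rel k A \<subseteq> carrier (free_module A (carrier A))"
proof -
  interpret CA: cring A by (rule algebra.M_cring[OF alg])
  interpret algebra k A by fact
  interpret F: module A "free_module A (carrier A)" by (rule module_free) (rule M_cring)
  note [simp] = free_gen_closed[OF M_cring]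
  show ?thesis unfolding kaehler_rel_def Let_def by auto
qed

lemma
  assumes alg: "algebra k A"
  shows module_kaehler: "module A (kaehler k A)"
    and kaehler_d_closed: "x \<in> carrier A \<Longrightarrow> kaehler_d k A x \<in> carrier (kaehler k A)"
    and kaehler_d_add: "x \<in> carrier A \<Longrightarrow> y \<in> carrier A \<Longrightarrow>
      kaehler_d k A (x \<oplus>\<^bsub>A\<^esub> y) = kaehler_d k A x \<oplus>\<^bsub>kaehler k A\<^esub> kaehler_d k A y"
    and kaehler_d_smult: "c \<in> carrier k \<Longrightarrow> x \<in> carrier A \<Longrightarrow>
      kaehler_d k A (c \<odot>\<^bsub>A\<^esub> x) = (c \<odot>\<^bsub>A\<^esub> \<one>\<^bsub>A\<^esub>) \<odot>\<^bsub>kaehler k A\<^esub> kaehler_d k A x"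
    and kaehler_d_mult: "x \<in> carrier A \<Longrightarrow> y \<in> carrier A \<Longrightarrow>
      kaehler_d k A (x \<otimes>\<^bsub>A\<^esub> y) =
        y \<odot>\<^bsub>kaehler k A\<^esub> kaehler_d k A x \<oplus>\<^bsub>kaehler k A\<^esub> x \<odot>\<^bsub>kaehler k A\<^esub> kaehler_d k A y"
proof -
  interpret CA: cring A by (rule algebra.M_cring[OF alg])
  interpret algebra k A by fact
  let ?F = "free_module A (carrier A)" and ?E = "kaehler_rel k A" and ?\<Omega> = "kaehler k A"
  have F: "module A ?F" by (rule module_free[OF M_cring])
  interpret F: module A ?F by fact
  note E = kaehler_rel_subset[OF alg]
  note pp = pres_proj[OF M_cring E, folded kaehler_def]
  show om: "module A ?\<Omega>" by (rule pp)
  interpret O: module A ?\<Omega> by fact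
  note [simp] = free_gen_closed[OF M_cring]
  define p where "p = (\<lambda>h. span_module A ?F ?E +>\<^bsub>?F\<^esub> h)"
  have p: "p \<in> mod_hom A ?F ?\<Omega>" unfolding p_def by (rule pp)
  have p0: "p e = \<zero>\<^bsub>?\<Omega>\<^esub>" if "e \<in> ?E" for e unfolding p_def using that by (rule pp)
  have d: "kaehler_d k A x = p (free_gen A (carrier A) x)" for x
    by (simp add: kaehler_d_def pres_gen_def p_def)
  note p' = mod_homD[OF p]
  have pe: "p u = p v" if "u \<ominus>\<^bsub>?F\<^esub> v \<in> ?E" "u \<in> carrier ?F" "v \<in> carrier ?F" for u v
  proof (rule diff_zeroD[OF O.M.abelian_group_axioms p'(1)[OF that(2)] p'(1)[OF that(3)]])
    show "p u \<ominus>\<^bsub>?\<Omega>\<^esub> p v = \<zero>\<^bsub>?\<Omega>\<^esub>"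
      by (rule trans[OF mod_hom_diff[OF F om p that(2,3), symmetric] p0[OF that(1)]])
  qed
  show "x \<in> carrier A \<Longrightarrow> kaehler_d k A x \<in> carrier ?\<Omega>" by (simp add: d p')
  let ?d = "free_gen A (carrier A)"
  show "kaehler_d k A (x \<oplus>\<^bsub>A\<^esub> y) = kaehler_d k A x \<oplus>\<^bsub>?\<Omega>\<^esub> kaehler_d k A y"
    if xy: "x \<in> carrier A" "y \<in> carrier A"
  proof -
    have "p (?d (x \<oplus>\<^bsub>A\<^esub> y)) = p (?d x \<oplus>\<^bsub>?F\<^esub> ?d y)"
    proof (rule pe)
      show "?d (x \<oplus>\<^bsub>A\<^esub> y) \<ominus>\<^bsub>?F\<^esub> (?d x \<oplus>\<^bsub>?F\<^esub> ?d y) \<in> ?E"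
        unfolding kaehler_rel_def Let_def using xy by blast
    qed (use xy in simp_all)
    then show ?thesis unfolding d using xy by (simp add: p')
  qed
  show "kaehler_d k A (c \<odot>\<^bsub>A\<^esub> x) = (c \<odot>\<^bsub>A\<^esub> \<one>\<^bsub>A\<^esub>) \<odot>\<^bsub>?\<Omega>\<^esub> kaehler_d k A x"
    if xy: "c \<in> carrier k" "x \<in> carrier A"
  proof -
    have "p (?d (c \<odot>\<^bsub>A\<^esub> x)) = p ((c \<odot>\<^bsub>A\<^esub> \<one>\<^bsub>A\<^esub>) \<odot>\<^bsub>?F\<^esub> ?d x)"
    proof (rule pe)
      show "?d (c \<odot>\<^bsub>A\<^esub> x) \<ominus>\<^bsub>?F\<^esub> (c \<odot>\<^bsub>A\<^esub> \<one>\<^bsub>A\<^esub>) \<odot>\<^bsub>?F\<^esub> ?d x \<in> ?E"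
        unfolding kaehler_rel_def Let_def using xy by blast
    qed (use xy in simp_all)
    then show ?thesis unfolding d using xy by (simp add: p')
  qed
  show "kaehler_d k A (x \<otimes>\<^bsub>A\<^esub> y) = y \<odot>\<^bsub>?\<Omega>\<^esub> kaehler_d k A x \<oplus>\<^bsub>?\<Omega>\<^esub> x \<odot>\<^bsub>?\<Omega>\<^esub> kaehler_d k A y"
    if xy: "x \<in> carrier A" "y \<in> carrier A"
  proof -
    have "p (?d (x \<otimes>\<^bsub>A\<^esub> y)) = p (y \<odot>\<^bsub>?F\<^esub> ?d x \<oplus>\<^bsub>?F\<^esub> x \<odot>\<^bsub>?F\<^esub> ?d y)"
    proof (rule pe)
      show "?d (x \<otimes>\<^bsub>A\<^esub> y) \<ominus>\<^bsub>?F\<^esub> (y \<odot>\<^bsub>?F\<^esub> ?d x \<oplus>\<^bsub>?F\<^esub> x \<odot>\<^bsub>?F\<^esub> ?d y) \<in> ?E"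
        unfolding kaehler_rel_def Let_def using xy by blast
    qed (use xy in simp_all)
    then show ?thesis unfolding d using xy by (simp add: p')
  qed
qed

text \<open>The universal property of \<open>\<Omega>\<close>: \<open>k\<close>-derivations into \<open>N\<close> are \<open>A\<close>-linear maps
  out of \<open>\<Omega>\<close>.\<close>

lemma kaehler_universal:
  assumes alg: "algebra k A" and N: "module A N" and del: "\<delta> \<in> carrier A \<rightarrow> carrier N"
    and add: "\<And>x y. x \<in> carrier A \<Longrightarrow> y \<in> carrier A \<Longrightarrow> \<delta> (x \<oplus>\<^bsub>A\<^esub> y) = \<delta> x \<oplus>\<^bsub>N\<^esub> \<delta> y"
    and scal: "\<And>c x. c \<in> carrier k \<Longrightarrow> x \<in> carrier A \<Longrightarrow>
      \<delta> (c \<odot>\<^bsub>A\<^esub> x) = (c \<odot>\<^bsub>A\<^esub> \<one>\<^bsub>A\<^esub>) \<odot>\<^bsub>N\<^esub> \<delta> x"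
    and leib: "\<And>x y. x \<in> carrier A \<Longrightarrow> y \<in> carrier A \<Longrightarrow>
      \<delta> (x \<otimes>\<^bsub>A\<^esub> y) = y \<odot>\<^bsub>N\<^esub> \<delta> x \<oplus>\<^bsub>N\<^esub> x \<odot>\<^bsub>N\<^esub> \<delta> y"
  shows "\<exists>!\<psi>. \<psi> \<in> mod_hom A (kaehler k A) N \<inter> extensional (carrier (kaehler k A)) \<and>
     (\<forall>x\<in>carrier A. \<psi> (kaehler_d k A x) = \<delta> x)"
  unfolding kaehler_def kaehler_d_def
proof (rule pres_universal[OF N del kaehler_rel_subset[OF alg]])
  interpret CA: cring A by (rule algebra.M_cring[OF alg])
  interpret algebra k A by fact
  interpret N: module A N by fact
  let ?F = "free_module A (carrier A)"
  have F: "module A ?F" by (rule module_free[OF M_cring])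
  interpret F: module A ?F by fact
  note [simp] = free_gen_closed[OF M_cring]
  have dc: "\<delta> x \<in> carrier N" if "x \<in> carrier A" for x using del that by auto
  fix \<phi> e assume \<phi>: "\<phi> \<in> mod_hom A ?F N" "\<forall>x\<in>carrier A. \<phi> (free_gen A (carrier A) x) = \<delta> x"
    and e: "e \<in> kaehler_rel k A"
  note [simp] = mod_homD[OF \<phi>(1)] mod_hom_diff[OF F N \<phi>(1)]
  show "\<phi> e = \<zero>\<^bsub>N\<^esub>"
    using e \<phi>(2) dc unfolding kaehler_rel_def Let_def
    by (auto simp: add scal leib a_minus_def[of N] N.M.r_neg)
qed

lemma koszul_d1_ex1:
  assumes dA: "diff_algebra k A T"
  shows "\<exists>!\<phi>. \<phi> \<in> mod_hom A (kaehler k A) (self_module A) \<inter> extensional (carrier (kaehler k A)) \<and>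
       (\<forall>a\<in>carrier A. \<forall>x\<in>carrier A. \<phi> (a \<odot>\<^bsub>kaehler k A\<^esub> kaehler_d k A x) = a \<otimes>\<^bsub>A\<^esub> T x)"
proof -
  have alg: "algebra k A" and T: "derivation k A T" using dA by (auto simp: diff_algebra_def)
  interpret CA: cring A by (rule algebra.M_cring[OF alg])
  interpret algebra k A by fact
  note \<Omega> = module_kaehler[OF alg] kaehler_d_closed[OF alg]
  interpret O: module A "kaehler k A" by (rule \<Omega>)
  have N: "module A (self_module A)" by (rule module_self[OF M_cring])
  have s: "carrier (self_module A) = carrier A" "add (self_module A) = add A"
    "smult (self_module A) = mult A" by (simp_all add: self_module_def)
  have T': "T x \<in> carrier A" if "x \<in> carrier A" for x using T that by (auto simp: derivation_def)
  have *: "\<exists>!\<psi>. \<psi> \<in> mod_hom A (kaehler k A) (self_module A) \<inter> extensional (carrier (kaehler k A)) \<and>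
     (\<forall>x\<in>carrier A. \<psi> (kaehler_d k A x) = T x)"
  proof (rule kaehler_universal[OF alg N])
    show "T \<in> carrier A \<rightarrow> carrier (self_module A)" using T' by (auto simp: s)
  next
    fix x y assume "x \<in> carrier A" "y \<in> carrier A"
    then show "T (x \<oplus>\<^bsub>A\<^esub> y) = T x \<oplus>\<^bsub>self_module A\<^esub> T y"
      and "T (x \<otimes>\<^bsub>A\<^esub> y) = y \<odot>\<^bsub>self_module A\<^esub> T x \<oplus>\<^bsub>self_module A\<^esub> x \<odot>\<^bsub>self_module A\<^esub> T y"
      using T T' by (auto simp: s derivation_def CA.m_comm)
  next
    fix c x assume "c \<in> carrier k" "x \<in> carrier A"
    then show "T (c \<odot>\<^bsub>A\<^esub> x) = (c \<odot>\<^bsub>A\<^esub> \<one>\<^bsub>A\<^esub>) \<odot>\<^bsub>self_module A\<^esub> T x"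
      using T T' by (auto simp: s derivation_def smult_assoc2)
  qed
  have eq: "(\<forall>a\<in>carrier A. \<forall>x\<in>carrier A. \<phi> (a \<odot>\<^bsub>kaehler k A\<^esub> kaehler_d k A x) = a \<otimes>\<^bsub>A\<^esub> T x) \<longleftrightarrow>
      (\<forall>x\<in>carrier A. \<phi> (kaehler_d k A x) = T x)" (is "?L \<longleftrightarrow> ?R")
    if \<phi>: "\<phi> \<in> mod_hom A (kaehler k A) (self_module A)" for \<phi>
  proof
    assume L: ?L
    show ?R
    proof
      fix x assume x: "x \<in> carrier A"
      show "\<phi> (kaehler_d k A x) = T x"
        using L[rule_format, OF CA.one_closed x] \<Omega>(2)[OF x] T'[OF x] by simp
    qed
  next
    assume ?R
    then show ?L using mod_homD(3)[OF \<phi>] \<Omega>(2) by (simp add: s)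
  qed
  show ?thesis using * eq by (simp cong: conj_cong)
qed

lemma
  assumes dA: "diff_algebra k A T"
  shows koszul_d1_hom: "koszul_d1 k A T \<in> mod_hom A (kaehler k A) (self_module A)"
    and koszul_d1_d: "x \<in> carrier A \<Longrightarrow> koszul_d1 k A T (kaehler_d k A x) = T x"
proof -
  have alg: "algebra k A" using dA by (auto simp: diff_algebra_def)
  interpret CA: cring A by (rule algebra.M_cring[OF alg])
  interpret algebra k A by fact
  interpret O: module A "kaehler k A" by (rule module_kaehler[OF alg])
  note * = theI'[OF koszul_d1_ex1[OF dA], folded koszul_d1_def]
  show "koszul_d1 k A T \<in> mod_hom A (kaehler k A) (self_module A)" using * by blast
  assume x: "x \<in> carrier A"
  then have "T x \<in> carrier A" using dA by (auto simp: diff_algebra_def derivation_def)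
  then show "koszul_d1 k A T (kaehler_d k A x) = T x"
    using conjunct2[OF *, rule_format, OF CA.one_closed x] kaehler_d_closed[OF alg x] by simp
qed

lemma ext2_rel_subset:
  assumes "module R M" shows "ext2_rel R M \<subseteq> carrier (free_module R (carrier M \<times> carrier M))"
proof -
  interpret module R M by fact
  interpret F: module R "free_module R (carrier M \<times> carrier M)"
    by (rule module_free) (rule R.is_cring)
  note [simp] = free_gen_closed[OF R.is_cring]
  show ?thesis unfolding ext2_rel_def Let_def by auto
qed

lemma
  assumes M: "module R M"
  shows module_ext2: "module R (ext2 R M)"
    and wedge_closed: "u \<in> carrier M \<Longrightarrow> v \<in> carrier M \<Longrightarrow> wedge R M u v \<in> carrier (ext2 R M)"
    and wedge_add_left: "u \<in> carrier M \<Longrightarrow> v \<in> carrier M \<Longrightarrow> w \<in> carrier M \<Longrightarrow>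
      wedge R M (u \<oplus>\<^bsub>M\<^esub> v) w = wedge R M u w \<oplus>\<^bsub>ext2 R M\<^esub> wedge R M v w"
    and wedge_add_right: "u \<in> carrier M \<Longrightarrow> v \<in> carrier M \<Longrightarrow> w \<in> carrier M \<Longrightarrow>
      wedge R M u (v \<oplus>\<^bsub>M\<^esub> w) = wedge R M u v \<oplus>\<^bsub>ext2 R M\<^esub> wedge R M u w"
    and wedge_smult_left: "a \<in> carrier R \<Longrightarrow> u \<in> carrier M \<Longrightarrow> v \<in> carrier M \<Longrightarrow>
      wedge R M (a \<odot>\<^bsub>M\<^esub> u) v = a \<odot>\<^bsub>ext2 R M\<^esub> wedge R M u v"
    and wedge_smult_right: "a \<in> carrier R \<Longrightarrow> u \<in> carrier M \<Longrightarrow> v \<in> carrier M \<Longrightarrow>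
      wedge R M u (a \<odot>\<^bsub>M\<^esub> v) = a \<odot>\<^bsub>ext2 R M\<^esub> wedge R M u v"
    and wedge_self: "u \<in> carrier M \<Longrightarrow> wedge R M u u = \<zero>\<^bsub>ext2 R M\<^esub>"
proof -
  interpret module R M by fact
  let ?B = "carrier M \<times> carrier M"
  let ?F = "free_module R ?B" and ?E = "ext2_rel R M" and ?P = "ext2 R M"
  have F: "module R ?F" by (rule module_free[OF R.is_cring])
  interpret F: module R ?F by fact
  note pp = pres_proj[OF R.is_cring ext2_rel_subset[OF M], folded ext2_def]
  show om: "module R ?P" by (rule pp)
  interpret O: module R ?P by fact
  note [simp] = free_gen_closed[OF R.is_cring]
  define p where "p = (\<lambda>h. span_module R ?F ?E +>\<^bsub>?F\<^esub> h)"
  have p: "p \<in> mod_hom R ?F ?P" unfolding p_def by (rule pp)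
  have p0: "p e = \<zero>\<^bsub>?P\<^esub>" if "e \<in> ?E" for e unfolding p_def using that by (rule pp)
  have d: "wedge R M u v = p (free_gen R ?B (u, v))" for u v
    by (simp add: wedge_def pres_gen_def p_def)
  note p' = mod_homD[OF p]
  have pe: "p u = p v" if "u \<ominus>\<^bsub>?F\<^esub> v \<in> ?E" "u \<in> carrier ?F" "v \<in> carrier ?F" for u v
  proof (rule diff_zeroD[OF O.M.abelian_group_axioms p'(1)[OF that(2)] p'(1)[OF that(3)]])
    show "p u \<ominus>\<^bsub>?P\<^esub> p v = \<zero>\<^bsub>?P\<^esub>"
      by (rule trans[OF mod_hom_diff[OF F om p that(2,3), symmetric] p0[OF that(1)]])
  qed
  show "u \<in> carrier M \<Longrightarrow> v \<in> carrier M \<Longrightarrow> wedge R M u v \<in> carrier ?P" by (simp add: d p')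
  show "u \<in> carrier M \<Longrightarrow> wedge R M u u = \<zero>\<^bsub>?P\<^esub>"
    unfolding d by (rule p0) (unfold ext2_rel_def Let_def, blast)
  let ?e = "free_gen R ?B"
  show "wedge R M (u \<oplus>\<^bsub>M\<^esub> v) w = wedge R M u w \<oplus>\<^bsub>?P\<^esub> wedge R M v w"
    if uv: "u \<in> carrier M" "v \<in> carrier M" "w \<in> carrier M"
  proof -
    have "p (?e (u \<oplus>\<^bsub>M\<^esub> v, w)) = p (?e (u, w) \<oplus>\<^bsub>?F\<^esub> ?e (v, w))"
    proof (rule pe)
      show "?e (u \<oplus>\<^bsub>M\<^esub> v, w) \<ominus>\<^bsub>?F\<^esub> (?e (u, w) \<oplus>\<^bsub>?F\<^esub> ?e (v, w)) \<in> ?E"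
        unfolding ext2_rel_def Let_def using uv by blast
    qed (use uv in simp_all)
    then show ?thesis unfolding d using uv by (simp add: p')
  qed
  show "wedge R M u (v \<oplus>\<^bsub>M\<^esub> w) = wedge R M u v \<oplus>\<^bsub>?P\<^esub> wedge R M u w"
    if uv: "u \<in> carrier M" "v \<in> carrier M" "w \<in> carrier M"
  proof -
    have "p (?e (u, v \<oplus>\<^bsub>M\<^esub> w)) = p (?e (u, v) \<oplus>\<^bsub>?F\<^esub> ?e (u, w))"
    proof (rule pe)
      show "?e (u, v \<oplus>\<^bsub>M\<^esub> w) \<ominus>\<^bsub>?F\<^esub> (?e (u, v) \<oplus>\<^bsub>?F\<^esub> ?e (u, w)) \<in> ?E"
        unfolding ext2_rel_def Let_def using uv by blast
    qed (use uv in simp_all)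
    then show ?thesis unfolding d using uv by (simp add: p')
  qed
  show "wedge R M (a \<odot>\<^bsub>M\<^esub> u) v = a \<odot>\<^bsub>?P\<^esub> wedge R M u v"
    if uv: "a \<in> carrier R" "u \<in> carrier M" "v \<in> carrier M"
  proof -
    have "p (?e (a \<odot>\<^bsub>M\<^esub> u, v)) = p (a \<odot>\<^bsub>?F\<^esub> ?e (u, v))"
    proof (rule pe)
      show "?e (a \<odot>\<^bsub>M\<^esub> u, v) \<ominus>\<^bsub>?F\<^esub> a \<odot>\<^bsub>?F\<^esub> ?e (u, v) \<in> ?E"
        unfolding ext2_rel_def Let_def using uv by blast
    qed (use uv in simp_all)
    then show ?thesis unfolding d using uv by (simp add: p')
  qed
  show "wedge R M u (a \<odot>\<^bsub>M\<^esub> v) = a \<odot>\<^bsub>?P\<^esub> wedge R M u v"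
    if uv: "a \<in> carrier R" "u \<in> carrier M" "v \<in> carrier M"
  proof -
    have "p (?e (u, a \<odot>\<^bsub>M\<^esub> v)) = p (a \<odot>\<^bsub>?F\<^esub> ?e (u, v))"
    proof (rule pe)
      show "?e (u, a \<odot>\<^bsub>M\<^esub> v) \<ominus>\<^bsub>?F\<^esub> a \<odot>\<^bsub>?F\<^esub> ?e (u, v) \<in> ?E"
        unfolding ext2_rel_def Let_def using uv by blast
    qed (use uv in simp_all)
    then show ?thesis unfolding d using uv by (simp add: p')
  qed
qed

lemma ext2_universal:
  assumes M: "module R M" and N: "module R N"
    and cl: "\<And>u v. u \<in> carrier M \<Longrightarrow> v \<in> carrier M \<Longrightarrow> \<beta> u v \<in> carrier N"
    and al: "\<And>u v w. u \<in> carrier M \<Longrightarrow> v \<in> carrier M \<Longrightarrow> w \<in> carrier M \<Longrightarrow>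
      \<beta> (u \<oplus>\<^bsub>M\<^esub> v) w = \<beta> u w \<oplus>\<^bsub>N\<^esub> \<beta> v w"
    and ar: "\<And>u v w. u \<in> carrier M \<Longrightarrow> v \<in> carrier M \<Longrightarrow> w \<in> carrier M \<Longrightarrow>
      \<beta> u (v \<oplus>\<^bsub>M\<^esub> w) = \<beta> u v \<oplus>\<^bsub>N\<^esub> \<beta> u w"
    and sl: "\<And>a u v. a \<in> carrier R \<Longrightarrow> u \<in> carrier M \<Longrightarrow> v \<in> carrier M \<Longrightarrow>
      \<beta> (a \<odot>\<^bsub>M\<^esub> u) v = a \<odot>\<^bsub>N\<^esub> \<beta> u v"
    and sr: "\<And>a u v. a \<in> carrier R \<Longrightarrow> u \<in> carrier M \<Longrightarrow> v \<in> carrier M \<Longrightarrow>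
      \<beta> u (a \<odot>\<^bsub>M\<^esub> v) = a \<odot>\<^bsub>N\<^esub> \<beta> u v"
    and alt: "\<And>u. u \<in> carrier M \<Longrightarrow> \<beta> u u = \<zero>\<^bsub>N\<^esub>"
  shows "\<exists>!\<psi>. \<psi> \<in> mod_hom R (ext2 R M) N \<inter> extensional (carrier (ext2 R M)) \<and>
     (\<forall>u\<in>carrier M. \<forall>v\<in>carrier M. \<psi> (wedge R M u v) = \<beta> u v)"
proof -
  interpret M: module R M by fact
  interpret N: module R N by fact
  let ?B = "carrier M \<times> carrier M"
  let ?F = "free_module R ?B"
  have F: "module R ?F" by (rule module_free[OF M.R.is_cring])
  interpret F: module R ?F by fact
  note [simp] = free_gen_closed[OF M.R.is_cring]
  have "\<exists>!\<psi>. \<psi> \<in> mod_hom R (ext2 R M) N \<inter> extensional (carrier (ext2 R M)) \<and>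
     (\<forall>b\<in>?B. \<psi> (pres_gen R ?B (ext2_rel R M) b) = case_prod \<beta> b)"
    unfolding ext2_def
  proof (rule pres_universal[OF N _ ext2_rel_subset[OF M]])
    show "case_prod \<beta> \<in> ?B \<rightarrow> carrier N" using cl by auto
    fix \<phi> e assume \<phi>: "\<phi> \<in> mod_hom R ?F N" "\<forall>b\<in>?B. \<phi> (free_gen R ?B b) = case_prod \<beta> b"
      and e: "e \<in> ext2_rel R M"
    note [simp] = mod_homD[OF \<phi>(1)] mod_hom_diff[OF F N \<phi>(1)]
    have \<phi>': "\<phi> (free_gen R ?B (u, v)) = \<beta> u v" if "u \<in> carrier M" "v \<in> carrier M" for u v
      using \<phi>(2) that by auto
    show "\<phi> e = \<zero>\<^bsub>N\<^esub>"
      using e cl unfolding ext2_rel_def Let_def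
      by (auto simp: \<phi>' al ar sl sr alt a_minus_def[of N] N.M.r_neg)
  qed
  moreover have "(\<forall>b\<in>?B. \<psi> (pres_gen R ?B (ext2_rel R M) b) = case_prod \<beta> b) \<longleftrightarrow>
    (\<forall>u\<in>carrier M. \<forall>v\<in>carrier M. \<psi> (wedge R M u v) = \<beta> u v)" for \<psi>
    by (auto simp: wedge_def)
  ultimately show ?thesis by simp
qed

lemma
  assumes dA: "diff_algebra k A T"
  defines "\<Omega> \<equiv> kaehler k A" and "d \<equiv> kaehler_d k A"
  shows koszul_d2_ex1: "\<exists>!\<phi>. \<phi> \<in> mod_hom A (ext2 A \<Omega>) \<Omega> \<inter> extensional (carrier (ext2 A \<Omega>)) \<and>
        (\<forall>a\<in>carrier A. \<forall>x\<in>carrier A. \<forall>y\<in>carrier A.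
           \<phi> (a \<odot>\<^bsub>ext2 A \<Omega>\<^esub> wedge A \<Omega> (d x) (d y)) =
             (a \<otimes>\<^bsub>A\<^esub> T x) \<odot>\<^bsub>\<Omega>\<^esub> d y \<ominus>\<^bsub>\<Omega>\<^esub> (a \<otimes>\<^bsub>A\<^esub> T y) \<odot>\<^bsub>\<Omega>\<^esub> d x)"
    and koszul_d2_hom: "koszul_d2 k A T \<in> mod_hom A (ext2 A \<Omega>) \<Omega>"
    and koszul_d2_wedge: "u \<in> carrier \<Omega> \<Longrightarrow> v \<in> carrier \<Omega> \<Longrightarrow> koszul_d2 k A T (wedge A \<Omega> u v) =
      koszul_d1 k A T u \<odot>\<^bsub>\<Omega>\<^esub> v \<ominus>\<^bsub>\<Omega>\<^esub> koszul_d1 k A T v \<odot>\<^bsub>\<Omega>\<^esub> u"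
proof -
  have alg: "algebra k A" and T: "derivation k A T" using dA by (auto simp: diff_algebra_def)
  interpret CA: cring A by (rule algebra.M_cring[OF alg])
  interpret algebra k A by fact
  have \<Omega>: "module A \<Omega>" unfolding \<Omega>_def by (rule module_kaehler[OF alg])
  interpret O: module A \<Omega> by fact
  let ?W = "ext2 A \<Omega>"
  have W: "module A ?W" by (rule module_ext2[OF \<Omega>])
  interpret W: module A ?W by fact
  have dc [simp]: "d x \<in> carrier \<Omega>" if "x \<in> carrier A" for x
    unfolding \<Omega>_def d_def by (rule kaehler_d_closed[OF alg that])
  have Tc [simp]: "T x \<in> carrier A" if "x \<in> carrier A" for x using T that by (auto simp: derivation_def)
  let ?d1 = "koszul_d1 k A T"
  have d1: "?d1 \<in> mod_hom A \<Omega> (self_module A)" unfolding \<Omega>_def by (rule koszul_d1_hom[OF dA])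
  have d1' [simp]: "?d1 u \<in> carrier A" "v \<in> carrier \<Omega> \<Longrightarrow> ?d1 (u \<oplus>\<^bsub>\<Omega>\<^esub> v) = ?d1 u \<oplus>\<^bsub>A\<^esub> ?d1 v"
    "a \<in> carrier A \<Longrightarrow> ?d1 (a \<odot>\<^bsub>\<Omega>\<^esub> u) = a \<otimes>\<^bsub>A\<^esub> ?d1 u" if "u \<in> carrier \<Omega>" for u v a
    using mod_homD[OF d1] that by (auto simp: self_module_def)
  have d1d [simp]: "?d1 (d x) = T x" if "x \<in> carrier A" for x
    unfolding d_def by (rule koszul_d1_d[OF dA that])
  define \<beta> where "\<beta> u v = ?d1 u \<odot>\<^bsub>\<Omega>\<^esub> v \<ominus>\<^bsub>\<Omega>\<^esub> ?d1 v \<odot>\<^bsub>\<Omega>\<^esub> u" for u v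
  have bc [simp]: "\<beta> u v \<in> carrier \<Omega>" if "u \<in> carrier \<Omega>" "v \<in> carrier \<Omega>" for u v
    using that by (simp add: \<beta>_def)
  have al: "\<beta> (u \<oplus>\<^bsub>\<Omega>\<^esub> v) w = \<beta> u w \<oplus>\<^bsub>\<Omega>\<^esub> \<beta> v w"
    if "u \<in> carrier \<Omega>" "v \<in> carrier \<Omega>" "w \<in> carrier \<Omega>" for u v w
    using that by (simp add: \<beta>_def a_minus_def O.smult_l_distr O.smult_r_distr O.M.minus_add O.M.a_ac)
  have ar: "\<beta> u (v \<oplus>\<^bsub>\<Omega>\<^esub> w) = \<beta> u v \<oplus>\<^bsub>\<Omega>\<^esub> \<beta> u w"
    if "u \<in> carrier \<Omega>" "v \<in> carrier \<Omega>" "w \<in> carrier \<Omega>" for u v w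
    using that by (simp add: \<beta>_def a_minus_def O.smult_l_distr O.smult_r_distr O.M.minus_add O.M.a_ac)
  have sl: "\<beta> (a \<odot>\<^bsub>\<Omega>\<^esub> u) v = a \<odot>\<^bsub>\<Omega>\<^esub> \<beta> u v"
    if "a \<in> carrier A" "u \<in> carrier \<Omega>" "v \<in> carrier \<Omega>" for a u v
    using that
    by (simp add: \<beta>_def a_minus_def O.smult_r_distr O.smult_r_minus CA.m_comm flip: O.smult_assoc1)
  have sr: "\<beta> u (a \<odot>\<^bsub>\<Omega>\<^esub> v) = a \<odot>\<^bsub>\<Omega>\<^esub> \<beta> u v"
    if "a \<in> carrier A" "u \<in> carrier \<Omega>" "v \<in> carrier \<Omega>" for a u v
    using that
    by (simp add: \<beta>_def a_minus_def O.smult_r_distr O.smult_r_minus CA.m_comm flip: O.smult_assoc1)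
  have alt: "\<beta> u u = \<zero>\<^bsub>\<Omega>\<^esub>" if "u \<in> carrier \<Omega>" for u
    using that by (simp add: \<beta>_def a_minus_def O.M.r_neg)
  note ex = ext2_universal[OF \<Omega> \<Omega> bc al ar sl sr alt]
  define C where "C \<phi> \<longleftrightarrow> (\<forall>a\<in>carrier A. \<forall>x\<in>carrier A. \<forall>y\<in>carrier A.
           \<phi> (a \<odot>\<^bsub>?W\<^esub> wedge A \<Omega> (d x) (d y)) =
             (a \<otimes>\<^bsub>A\<^esub> T x) \<odot>\<^bsub>\<Omega>\<^esub> d y \<ominus>\<^bsub>\<Omega>\<^esub> (a \<otimes>\<^bsub>A\<^esub> T y) \<odot>\<^bsub>\<Omega>\<^esub> d x)" for \<phi>
  have eq: "C \<phi> \<longleftrightarrow> (\<forall>u\<in>carrier \<Omega>. \<forall>v\<in>carrier \<Omega>. \<phi> (wedge A \<Omega> u v) = \<beta> u v)"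
    if \<phi>: "\<phi> \<in> mod_hom A ?W \<Omega>" for \<phi>
  proof
    note \<phi>' = mod_homD[OF \<phi>]
    note wc [simp] = wedge_closed[OF \<Omega>]
    {
      assume R: "\<forall>u\<in>carrier \<Omega>. \<forall>v\<in>carrier \<Omega>. \<phi> (wedge A \<Omega> u v) = \<beta> u v"
      show "C \<phi>"
        unfolding C_def
        by (auto simp: \<phi>' R \<beta>_def a_minus_def O.smult_r_distr O.smult_r_minus O.smult_assoc1)
    }
    assume L: "C \<phi>"
    have dd: "\<phi> (wedge A \<Omega> (d x) (d y)) = \<beta> (d x) (d y)" if "x \<in> carrier A" "y \<in> carrier A" for x y
      using L[unfolded C_def, rule_format, OF CA.one_closed that] that by (simp add: \<beta>_def)
    have ind: "P u" if "u \<in> carrier \<Omega>" "P \<zero>\<^bsub>\<Omega>\<^esub>"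
      "\<And>a x v. a \<in> carrier A \<Longrightarrow> x \<in> carrier A \<Longrightarrow> v \<in> carrier \<Omega> \<Longrightarrow> P v \<Longrightarrow> P (a \<odot>\<^bsub>\<Omega>\<^esub> d x \<oplus>\<^bsub>\<Omega>\<^esub> v)" for P u
      using pres_induct[OF M_cring kaehler_rel_subset[OF alg], of u P] that
      by (simp add: \<Omega>_def d_def kaehler_def kaehler_d_def)
    have lz: "\<beta> \<zero>\<^bsub>\<Omega>\<^esub> v = \<zero>\<^bsub>\<Omega>\<^esub>" "wedge A \<Omega> \<zero>\<^bsub>\<Omega>\<^esub> v = \<zero>\<^bsub>?W\<^esub>"
      "\<beta> v \<zero>\<^bsub>\<Omega>\<^esub> = \<zero>\<^bsub>\<Omega>\<^esub>" "wedge A \<Omega> v \<zero>\<^bsub>\<Omega>\<^esub> = \<zero>\<^bsub>?W\<^esub>" if "v \<in> carrier \<Omega>" for v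
      using sl[of "\<zero>\<^bsub>A\<^esub>" "\<zero>\<^bsub>\<Omega>\<^esub>" v] wedge_smult_left[OF \<Omega>, of "\<zero>\<^bsub>A\<^esub>" "\<zero>\<^bsub>\<Omega>\<^esub>" v]
        sr[of "\<zero>\<^bsub>A\<^esub>" v "\<zero>\<^bsub>\<Omega>\<^esub>"] wedge_smult_right[OF \<Omega>, of "\<zero>\<^bsub>A\<^esub>" v "\<zero>\<^bsub>\<Omega>\<^esub>"] that by simp_all
    have pz: "\<phi> \<zero>\<^bsub>?W\<^esub> = \<zero>\<^bsub>\<Omega>\<^esub>" by (rule mod_hom_zero[OF W \<Omega> \<phi>])
    have 1: "\<phi> (wedge A \<Omega> (d x) v) = \<beta> (d x) v" if x: "x \<in> carrier A" and v: "v \<in> carrier \<Omega>" for x v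
      using v
    proof (rule ind)
      show "\<phi> (wedge A \<Omega> (d x) \<zero>\<^bsub>\<Omega>\<^esub>) = \<beta> (d x) \<zero>\<^bsub>\<Omega>\<^esub>" using x by (simp add: lz pz)
      fix a y v assume "a \<in> carrier A" "y \<in> carrier A" "v \<in> carrier \<Omega>" "\<phi> (wedge A \<Omega> (d x) v) = \<beta> (d x) v"
      then show "\<phi> (wedge A \<Omega> (d x) (a \<odot>\<^bsub>\<Omega>\<^esub> d y \<oplus>\<^bsub>\<Omega>\<^esub> v)) = \<beta> (d x) (a \<odot>\<^bsub>\<Omega>\<^esub> d y \<oplus>\<^bsub>\<Omega>\<^esub> v)"
        using x by (simp add: wedge_add_right[OF \<Omega>] wedge_smult_right[OF \<Omega>] \<phi>' ar sr dd)
    qed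
    have "\<phi> (wedge A \<Omega> u v) = \<beta> u v" if u: "u \<in> carrier \<Omega>" and v: "v \<in> carrier \<Omega>" for u v
      using u
    proof (rule ind)
      show "\<phi> (wedge A \<Omega> \<zero>\<^bsub>\<Omega>\<^esub> v) = \<beta> \<zero>\<^bsub>\<Omega>\<^esub> v" using v by (simp add: lz pz)
      fix a y u assume "a \<in> carrier A" "y \<in> carrier A" "u \<in> carrier \<Omega>" "\<phi> (wedge A \<Omega> u v) = \<beta> u v"
      then show "\<phi> (wedge A \<Omega> (a \<odot>\<^bsub>\<Omega>\<^esub> d y \<oplus>\<^bsub>\<Omega>\<^esub> u) v) = \<beta> (a \<odot>\<^bsub>\<Omega>\<^esub> d y \<oplus>\<^bsub>\<Omega>\<^esub> u) v"
        using v by (simp add: wedge_add_left[OF \<Omega>] wedge_smult_left[OF \<Omega>] \<phi>' al sl 1)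
    qed
    then show "\<forall>u\<in>carrier \<Omega>. \<forall>v\<in>carrier \<Omega>. \<phi> (wedge A \<Omega> u v) = \<beta> u v" by blast
  qed
  have ex': "\<exists>!\<phi>. \<phi> \<in> mod_hom A ?W \<Omega> \<inter> extensional (carrier ?W) \<and> C \<phi>"
    using ex eq by (simp cong: conj_cong)
  then show "\<exists>!\<phi>. \<phi> \<in> mod_hom A (ext2 A \<Omega>) \<Omega> \<inter> extensional (carrier (ext2 A \<Omega>)) \<and>
        (\<forall>a\<in>carrier A. \<forall>x\<in>carrier A. \<forall>y\<in>carrier A.
           \<phi> (a \<odot>\<^bsub>ext2 A \<Omega>\<^esub> wedge A \<Omega> (d x) (d y)) =
             (a \<otimes>\<^bsub>A\<^esub> T x) \<odot>\<^bsub>\<Omega>\<^esub> d y \<ominus>\<^bsub>\<Omega>\<^esub> (a \<otimes>\<^bsub>A\<^esub> T y) \<odot>\<^bsub>\<Omega>\<^esub> d x)"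
    unfolding C_def .
  have k: "koszul_d2 k A T = (THE \<phi>. \<phi> \<in> mod_hom A ?W \<Omega> \<inter> extensional (carrier ?W) \<and> C \<phi>)"
    unfolding koszul_d2_def Let_def C_def \<Omega>_def d_def ..
  note 2 = theI'[OF ex', folded k]
  show "koszul_d2 k A T \<in> mod_hom A ?W \<Omega>" using 2 by blast
  assume "u \<in> carrier \<Omega>" "v \<in> carrier \<Omega>"
  moreover have "koszul_d2 k A T \<in> mod_hom A ?W \<Omega>" "C (koszul_d2 k A T)" using 2 by auto
  ultimately show "koszul_d2 k A T (wedge A \<Omega> u v) =
      koszul_d1 k A T u \<odot>\<^bsub>\<Omega>\<^esub> v \<ominus>\<^bsub>\<Omega>\<^esub> koszul_d1 k A T v \<odot>\<^bsub>\<Omega>\<^esub> u"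
    using eq by (simp add: \<beta>_def)
qed

lemma koszul_d1_d2:
  assumes dA: "diff_algebra k A T" and w: "w \<in> carrier (ext2 A (kaehler k A))"
  shows "koszul_d1 k A T (koszul_d2 k A T w) = \<zero>\<^bsub>A\<^esub>"
proof -
  have alg: "algebra k A" using dA by (auto simp: diff_algebra_def)
  interpret CA: cring A by (rule algebra.M_cring[OF alg])
  let ?\<Omega> = "kaehler k A"
  have om: "module A ?\<Omega>" by (rule module_kaehler[OF alg])
  interpret O: module A ?\<Omega> by (rule om)
  let ?W = "ext2 A ?\<Omega>"
  have W: "module A ?W" by (rule module_ext2[OF om])
  let ?d1 = "koszul_d1 k A T" and ?d2 = "koszul_d2 k A T"
  have N: "module A (self_module A)" by (rule module_self[OF CA.is_cring])
  have s: "carrier (self_module A) = carrier A" "add (self_module A) = add A"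
    "smult (self_module A) = mult A" "zero (self_module A) = zero A" by (simp_all add: self_module_def)
  note d1 = mod_homD[OF koszul_d1_hom[OF dA], unfolded s]
  note d2 = mod_homD[OF koszul_d2_hom[OF dA]]
  note d1_diff = mod_hom_diff[OF om N koszul_d1_hom[OF dA]]
  show ?thesis
    using CA.is_cring ext2_rel_subset[OF om] w[unfolded ext2_def]
  proof (induction rule: pres_induct)
    case zero
    show ?case
      using mod_hom_zero[OF W om koszul_d2_hom[OF dA]] mod_hom_zero[OF om N koszul_d1_hom[OF dA]]
      by (simp add: s flip: ext2_def)
  next
    case (add a b v)
    obtain x y where b: "b = (x, y)" by (cases b)
    have xy: "x \<in> carrier ?\<Omega>" "y \<in> carrier ?\<Omega>" using add(2) b by auto
    have v: "v \<in> carrier ?W" using add(3) by (simp add: ext2_def)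
    note wc = wedge_closed[OF om xy]
    have aw: "a \<odot>\<^bsub>?W\<^esub> wedge A ?\<Omega> x y \<in> carrier ?W" by (rule module.smult_closed[OF W add(1) wc])
    let ?z = "?d1 x \<odot>\<^bsub>?\<Omega>\<^esub> y \<ominus>\<^bsub>?\<Omega>\<^esub> ?d1 y \<odot>\<^bsub>?\<Omega>\<^esub> x"
    have zc: "?z \<in> carrier ?\<Omega>" using xy by (simp add: d1)
    have "?d1 ?z = \<zero>\<^bsub>self_module A\<^esub>"
    proof -
      have "?d1 ?z = ?d1 (?d1 x \<odot>\<^bsub>?\<Omega>\<^esub> y) \<ominus>\<^bsub>self_module A\<^esub> ?d1 (?d1 y \<odot>\<^bsub>?\<Omega>\<^esub> x)"
        using xy by (intro d1_diff) (simp_all add: d1)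
      also have "?d1 (?d1 x \<odot>\<^bsub>?\<Omega>\<^esub> y) = ?d1 (?d1 y \<odot>\<^bsub>?\<Omega>\<^esub> x)"
        using xy by (simp add: d1 CA.m_comm)
      finally show ?thesis
        using abelian_group.r_neg[OF module.axioms(2)[OF N]] xy by (simp add: a_minus_def d1 s)
    qed
    then have "?d1 (a \<odot>\<^bsub>?\<Omega>\<^esub> ?z) = \<zero>\<^bsub>A\<^esub>" using add(1) zc by (simp add: d1 s)
    moreover have "?d2 (a \<odot>\<^bsub>?W\<^esub> wedge A ?\<Omega> x y) = a \<odot>\<^bsub>?\<Omega>\<^esub> ?z"
      using d2(3)[OF add(1) wc] koszul_d2_wedge[OF dA xy] by simp
    moreover have "?d2 (a \<odot>\<^bsub>?W\<^esub> wedge A ?\<Omega> x y \<oplus>\<^bsub>?W\<^esub> v) =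
        ?d2 (a \<odot>\<^bsub>?W\<^esub> wedge A ?\<Omega> x y) \<oplus>\<^bsub>?\<Omega>\<^esub> ?d2 v"
      by (rule d2(2)[OF aw v])
    moreover have "?d1 (a \<odot>\<^bsub>?\<Omega>\<^esub> ?z \<oplus>\<^bsub>?\<Omega>\<^esub> ?d2 v) = ?d1 (a \<odot>\<^bsub>?\<Omega>\<^esub> ?z) \<oplus>\<^bsub>A\<^esub> ?d1 (?d2 v)"
      using add(1) zc d2(1)[OF v] by (intro d1) auto
    ultimately show ?case using add(4) by (simp add: b flip: ext2_def wedge_def)
  qed
qed

lemma module_HK1:
  assumes dA: "diff_algebra k A T"
  shows "module A (HK1 k A T)"
proof -
  have alg: "algebra k A" using dA by (auto simp: diff_algebra_def)
  interpret CA: cring A by (rule algebra.M_cring[OF alg])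
  let ?\<Omega> = "kaehler k A"
  have om: "module A ?\<Omega>" by (rule module_kaehler[OF alg])
  interpret O: module A ?\<Omega> by (rule om)
  have W: "module A (ext2 A ?\<Omega>)" by (rule module_ext2[OF om])
  have N: "module A (self_module A)" by (rule module_self[OF CA.is_cring])
  let ?Z = "a_kernel ?\<Omega> (self_module A) (koszul_d1 k A T)"
  let ?B = "koszul_d2 k A T ` carrier (ext2 A ?\<Omega>)"
  have Z: "submodule ?Z A ?\<Omega>" by (rule mod_hom_ker[OF om N koszul_d1_hom[OF dA]])
  have B: "submodule ?B A ?\<Omega>" by (rule mod_hom_image[OF W om koszul_d2_hom[OF dA]])
  have ZM: "module A (?\<Omega>\<lparr>carrier := ?Z\<rparr>)" by (rule submodule.submodule_is_module[OF Z om])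
  interpret ZM: module A "?\<Omega>\<lparr>carrier := ?Z\<rparr>" by (rule ZM)
  have BZ: "?B \<subseteq> ?Z"
    using koszul_d1_d2[OF dA] mod_homD(1)[OF koszul_d2_hom[OF dA]]
    by (auto simp: a_kernel_def kernel_def self_module_def)
  have BM: "module A (?\<Omega>\<lparr>carrier := ?B\<rparr>)" by (rule submodule.submodule_is_module[OF B om])
  have "submodule ?B A (?\<Omega>\<lparr>carrier := ?Z\<rparr>)"
    by (rule ZM.module_incl_imp_submodule) (use BZ BM in simp_all)
  then show ?thesis unfolding HK1_def by (rule module_quot[OF ZM])
qed

end

theory Submission
  imports Defs "HOL-Algebra.UnivPoly"
begin

text \<open>
  The proof rests on one construction. Let \<open>Q = \<Omega> / im d\<^sub>2\<close>, where \<open>\<Omega>\<close> is the module of Kaehler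
  differentials of \<open>A\<close>. The relations imposed by \<open>d\<^sub>2\<close> say exactly that
  \<open>d\<^sub>1 u \<cdot> v = d\<^sub>1 v \<cdot> u\<close> in \<open>Q\<close>, that is, \<open>d\<^sub>1\<close> makes \<open>Q\<close> a quasi-ideal over \<open>A\<close>
  (\<open>koszul_quasi_ideal\<close>). Hence \<open>B = A \<oplus> Q\<close> is a commutative ring under
  \<open>(a, u) (b, v) = (a b, a v + b u + d\<^sub>1 u \<cdot> v)\<close>, the map \<open>p (a, u) = a + d\<^sub>1 u\<close> is a ring homomorphism to
  \<open>A\<close>, and \<open>x \<mapsto> (0, d (p x))\<close> is a derivation of \<open>B\<close> for which \<open>p\<close> is a homomorphism of differential
  algebras (\<open>quasi_ideal_diff_algebra\<close>). By the universal property of \<open>J\<close>, the map \<open>\<pi>\<close> lifts to a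
  differential homomorphism \<open>\<psi>\<close> from \<open>J\<close> to \<open>B\<close> (\<open>arc_lift_quasi_ideal\<close>), and
  \<open>\<psi> (b \<cdot> D x) = (0, \<pi> b \<cdot> d (\<pi> x))\<close>.

  In the other direction, \<open>b \<cdot> D x = D (b x) - D b \<cdot> x\<close> shows that \<open>I\<close> kills
  \<open>(J \<cdot> D J) / (J \<cdot> D I)\<close>. This quotient is therefore an \<open>A\<close>-module, and \<open>D\<close> induces a derivation from
  \<open>A\<close> to it, hence an \<open>A\<close>-linear map \<open>\<theta>\<close> on \<open>\<Omega>\<close> (\<open>kaehler_lift\<close>). It kills the image of \<open>d\<^sub>2\<close>
  (\<open>\<theta>_boundary\<close>), and \<open>\<psi>\<close> induces a left inverse of it on \<open>Q\<close> (\<open>\<theta>_eq_zero_imp_boundary\<close>). Since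
  \<open>\<pi>\<close> takes the class \<open>\<theta> u\<close> to \<open>d\<^sub>1 u\<close>, the map \<open>\<theta>\<close> restricts to an injection of \<open>HK\<^sub>1(A)\<close> into
  \<open>I / (J \<cdot> D I)\<close>, which is (b). If \<open>\<pi>\<close> is an isomorphism, the target is zero and so is \<open>HK\<^sub>1(A)\<close>.

  For the converse in (a), \<open>J = A\<^sup>0 + J \<cdot> D J\<close> (\<open>arc_decomposition\<close>), and the grading of \<open>A\<close> separates
  \<open>A\<^sup>0\<close> from the ideal generated by the image of \<open>T\<close> (\<open>degree_zero_positive\<close>), so \<open>I\<close> is contained in
  \<open>J \<cdot> D J\<close>. There every element represents a differential, and if \<open>HK\<^sub>1(A)\<close> vanishes one gets
  \<open>I = J \<cdot> D I\<close> (\<open>HK1_trivial_imp\<close>). As \<open>D\<close> raises the weight on \<open>J\<close> by one, \<open>I\<close> then lies in every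
  step of the weight filtration, and it is zero (\<open>arc_nakayama\<close>).
\<close>

section \<open>Differential algebras\<close>

lemma derivationD:
  assumes "derivation k A T"
  shows "x \<in> carrier A \<Longrightarrow> T x \<in> carrier A"
    and "x \<in> carrier A \<Longrightarrow> y \<in> carrier A \<Longrightarrow> T (x \<oplus>\<^bsub>A\<^esub> y) = T x \<oplus>\<^bsub>A\<^esub> T y"
    and "c \<in> carrier k \<Longrightarrow> x \<in> carrier A \<Longrightarrow> T (c \<odot>\<^bsub>A\<^esub> x) = c \<odot>\<^bsub>A\<^esub> T x"
    and "x \<in> carrier A \<Longrightarrow> y \<in> carrier A \<Longrightarrow> T (x \<otimes>\<^bsub>A\<^esub> y) = T x \<otimes>\<^bsub>A\<^esub> y \<oplus>\<^bsub>A\<^esub> x \<otimes>\<^bsub>A\<^esub> T y"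
  using assms by (auto simp: derivation_def)

lemma diff_homD:
  assumes "f \<in> diff_hom k A T B S"
  shows "f \<in> ring_hom A B"
    and "x \<in> carrier A \<Longrightarrow> f x \<in> carrier B"
    and "x \<in> carrier A \<Longrightarrow> y \<in> carrier A \<Longrightarrow> f (x \<oplus>\<^bsub>A\<^esub> y) = f x \<oplus>\<^bsub>B\<^esub> f y"
    and "x \<in> carrier A \<Longrightarrow> y \<in> carrier A \<Longrightarrow> f (x \<otimes>\<^bsub>A\<^esub> y) = f x \<otimes>\<^bsub>B\<^esub> f y"
    and "x \<in> carrier A \<Longrightarrow> f (T x) = S (f x)"
    and "c \<in> carrier k \<Longrightarrow> x \<in> carrier A \<Longrightarrow> f (c \<odot>\<^bsub>A\<^esub> x) = c \<odot>\<^bsub>B\<^esub> f x"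
  using assms by (auto simp: diff_hom_def alg_hom_def ring_hom_def)

lemma additive_zero:
  assumes "abelian_group G" "abelian_group H" "f \<in> carrier G \<rightarrow> carrier H"
    and "\<And>x y. x \<in> carrier G \<Longrightarrow> y \<in> carrier G \<Longrightarrow> f (x \<oplus>\<^bsub>G\<^esub> y) = f x \<oplus>\<^bsub>H\<^esub> f y"
  shows "f \<zero>\<^bsub>G\<^esub> = \<zero>\<^bsub>H\<^esub>"
proof -
  interpret G: abelian_group G by fact
  interpret H: abelian_group H by fact
  have c: "f \<zero>\<^bsub>G\<^esub> \<in> carrier H" using assms(3) by auto
  have "f \<zero>\<^bsub>G\<^esub> \<oplus>\<^bsub>H\<^esub> f \<zero>\<^bsub>G\<^esub> = f \<zero>\<^bsub>G\<^esub>" using assms(4)[of "\<zero>\<^bsub>G\<^esub>" "\<zero>\<^bsub>G\<^esub>"] by simp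
  then show ?thesis using c by (simp add: H.add.l_cancel_one')
qed

lemma diff_algebra_zero_one:
  assumes dA: "diff_algebra k A T"
  shows derivation_zero: "T \<zero>\<^bsub>A\<^esub> = \<zero>\<^bsub>A\<^esub>"
    and derivation_one: "T \<one>\<^bsub>A\<^esub> = \<zero>\<^bsub>A\<^esub>"
proof -
  interpret algebra k A using dA by (simp add: diff_algebra_def)
  have T: "derivation k A T" using dA by (simp add: diff_algebra_def)
  note T' = derivationD[OF T]
  interpret M: cring A by (rule M_cring)
  show "T \<zero>\<^bsub>A\<^esub> = \<zero>\<^bsub>A\<^esub>"
    by (rule additive_zero) (use T' M.abelian_group_axioms in auto)
  have "T \<one>\<^bsub>A\<^esub> \<oplus>\<^bsub>A\<^esub> T \<one>\<^bsub>A\<^esub> = T \<one>\<^bsub>A\<^esub>" using T'(4)[of "\<one>\<^bsub>A\<^esub>" "\<one>\<^bsub>A\<^esub>"] T'(1) by simp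
  then show "T \<one>\<^bsub>A\<^esub> = \<zero>\<^bsub>A\<^esub>" using T'(1) by (simp add: M.add.l_cancel_one')
qed

lemma algebra_unit_hom:
  assumes "algebra k A"
  shows "(\<lambda>c. c \<odot>\<^bsub>A\<^esub> \<one>\<^bsub>A\<^esub>) \<in> ring_hom k A"
proof -
  interpret algebra k A by fact
  show ?thesis
    by (rule ring_hom_memI) (simp_all add: smult_l_distr smult_assoc1 smult_assoc2)
qed

text \<open>A \<open>k\<close>-algebra structure on \<open>B\<close> is the same as a ring homomorphism \<open>h\<close> from \<open>k\<close> to \<open>B\<close>, and a derivation
of the ring \<open>B\<close> is \<open>k\<close>-linear as soon as it vanishes on the image of \<open>h\<close>. Both auxiliary differential
algebras below, polynomials and extensions by quasi-ideals, are most easily built in this way.\<close>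

definition algebra_via :: "('k \<Rightarrow> 'b) \<Rightarrow> ('b, 'm) ring_scheme \<Rightarrow> ('k, 'b) module" where
  "algebra_via h B =
    \<lparr>carrier = carrier B, mult = mult B, one = one B, zero = zero B, add = add B,
     smult = (\<lambda>c x. h c \<otimes>\<^bsub>B\<^esub> x)\<rparr>"

lemma algebra_via_simps [simp]:
  "carrier (algebra_via h B) = carrier B" "mult (algebra_via h B) = mult B"
  "one (algebra_via h B) = one B" "zero (algebra_via h B) = zero B"
  "add (algebra_via h B) = add B" "smult (algebra_via h B) c x = h c \<otimes>\<^bsub>B\<^esub> x"
  by (simp_all add: algebra_via_def)

lemma diff_algebra_via:
  assumes k: "cring k" and B: "cring B" and h: "h \<in> ring_hom k B"
    and S: "\<And>x. x \<in> carrier B \<Longrightarrow> S x \<in> carrier B"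
    and add: "\<And>x y. x \<in> carrier B \<Longrightarrow> y \<in> carrier B \<Longrightarrow> S (x \<oplus>\<^bsub>B\<^esub> y) = S x \<oplus>\<^bsub>B\<^esub> S y"
    and leib: "\<And>x y. x \<in> carrier B \<Longrightarrow> y \<in> carrier B \<Longrightarrow>
      S (x \<otimes>\<^bsub>B\<^esub> y) = S x \<otimes>\<^bsub>B\<^esub> y \<oplus>\<^bsub>B\<^esub> x \<otimes>\<^bsub>B\<^esub> S y"
    and const: "\<And>c. c \<in> carrier k \<Longrightarrow> S (h c) = \<zero>\<^bsub>B\<^esub>"
  shows "diff_algebra k (algebra_via h B) S"
proof -
  interpret B: cring B by fact
  note h' = ring_hom_closed[OF h] ring_hom_add[OF h] ring_hom_mult[OF h] ring_hom_one[OF h]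
  have c: "cring (algebra_via h B)"
  proof (intro cringI abelian_groupI comm_monoidI)
    show "\<exists>y\<in>carrier (algebra_via h B). y \<oplus>\<^bsub>algebra_via h B\<^esub> x = \<zero>\<^bsub>algebra_via h B\<^esub>"
      if "x \<in> carrier (algebra_via h B)" for x
      using that by (auto intro!: bexI[of _ "\<ominus>\<^bsub>B\<^esub> x"] simp: B.l_neg)
  qed (simp_all add: B.a_assoc B.m_assoc B.l_distr, simp_all add: B.a_comm B.m_comm)
  have "algebra k (algebra_via h B)"
    by (rule algebraI[OF k c]) (auto simp: h' B.l_distr B.r_distr B.m_assoc)
  moreover have "derivation k (algebra_via h B) S"
    by (auto simp: derivation_def S add leib const h')
  ultimately show ?thesis by (simp add: diff_algebra_def)
qed

section \<open>The arc algebra: generation, weight filtration, graded Nakayama lemma\<close>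

text \<open>The arc algebra is generated by the image of \<open>R\<close> under the ring operations and the derivation. This
induction principle replaces all further work with expressions and their congruence.\<close>

lemma arc_induct [consumes 2, case_names gen add mult der]:
  assumes alg: "algebra k R" and x: "x \<in> carrier (arc_algebra k R)"
    and "\<And>a. a \<in> carrier R \<Longrightarrow> P (arc_in k R a)"
    and "\<And>x y. x \<in> carrier (arc_algebra k R) \<Longrightarrow> y \<in> carrier (arc_algebra k R) \<Longrightarrow>
      P x \<Longrightarrow> P y \<Longrightarrow> P (x \<oplus>\<^bsub>arc_algebra k R\<^esub> y)"
    and "\<And>x y. x \<in> carrier (arc_algebra k R) \<Longrightarrow> y \<in> carrier (arc_algebra k R) \<Longrightarrow>
      P x \<Longrightarrow> P y \<Longrightarrow> P (x \<otimes>\<^bsub>arc_algebra k R\<^esub> y)"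
    and "\<And>x. x \<in> carrier (arc_algebra k R) \<Longrightarrow> P x \<Longrightarrow> P (arc_der k R x)"
  shows "P x"
proof -
  obtain t where t: "t \<in> dterms R" "x = arc_class k R t" using x by (rule arc_carrierE)
  have "P (arc_class k R t)" using t(1)
  proof (induction t)
    case (DGen a)
    then show ?case using assms(3)[of a] by (simp add: arc_in_def)
  next
    case (DAdd s t)
    then show ?case
      using assms(4)[of "arc_class k R s" "arc_class k R t"] by (simp add: arc_carrierI add_arc)
  next
    case (DMul s t)
    then show ?case
      using assms(5)[of "arc_class k R s" "arc_class k R t"] by (simp add: arc_carrierI mult_arc)
  next
    case (DDer s)
    then show ?case
      using assms(6)[of "arc_class k R s"] by (simp add: arc_carrierI der_arc)
  qed
  then show ?thesis using t by simp
qed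

lemma (in UP_cring) UP_induct [consumes 1, case_names monom add]:
  assumes p: "p \<in> carrier P"
    and m: "\<And>a n. a \<in> carrier R \<Longrightarrow> Q (monom P a n)"
    and a: "\<And>p q. p \<in> carrier P \<Longrightarrow> q \<in> carrier P \<Longrightarrow> Q p \<Longrightarrow> Q q \<Longrightarrow> Q (p \<oplus>\<^bsub>P\<^esub> q)"
  shows "Q p"
proof -
  have "Q (\<Oplus>\<^bsub>P\<^esub>i\<in>{..n}. monom P (coeff P p i) i)" for n
    by (induction n) (use p in \<open>auto intro!: m a P.finsum_closed\<close>)
  then show ?thesis using up_repr[OF p] by metis
qed

text \<open>This is \<open>t \<cdot> D\<close> on the polynomial ring in \<open>t\<close>, with \<open>D\<close> acting on coefficients. It raises the
\<open>t\<close>-degree by one, so a differential homomorphism into polynomials with this derivation records how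
often the derivation has been applied.\<close>

definition shift_der :: "('a, 'm) ring_scheme \<Rightarrow> ('a \<Rightarrow> 'a) \<Rightarrow> (nat \<Rightarrow> 'a) \<Rightarrow> nat \<Rightarrow> 'a" where
  "shift_der R D p n = (case n of 0 \<Rightarrow> \<zero>\<^bsub>R\<^esub> | Suc m \<Rightarrow> D (p m))"

text \<open>Both sides of the Leibniz rule, and of the rule for evaluation, are additive in each argument, so that
monomials suffice. By the latter rule, setting \<open>t = 1\<close> turns \<open>t \<cdot> D\<close> back into \<open>D\<close>.\<close>

lemma shift_der_UP:
  fixes R :: "('a, 'm) ring_scheme"
  assumes R: "cring R" and D: "\<And>x. x \<in> carrier R \<Longrightarrow> D x \<in> carrier R"
    and add: "\<And>x y. x \<in> carrier R \<Longrightarrow> y \<in> carrier R \<Longrightarrow> D (x \<oplus>\<^bsub>R\<^esub> y) = D x \<oplus>\<^bsub>R\<^esub> D y"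
    and leib: "\<And>x y. x \<in> carrier R \<Longrightarrow> y \<in> carrier R \<Longrightarrow>
      D (x \<otimes>\<^bsub>R\<^esub> y) = D x \<otimes>\<^bsub>R\<^esub> y \<oplus>\<^bsub>R\<^esub> x \<otimes>\<^bsub>R\<^esub> D y"
  defines "P \<equiv> UP R"
  shows shift_der_closed: "p \<in> carrier P \<Longrightarrow> shift_der R D p \<in> carrier P"
    and shift_der_coeff: "p \<in> carrier P \<Longrightarrow>
      coeff P (shift_der R D p) n = (case n of 0 \<Rightarrow> \<zero>\<^bsub>R\<^esub> | Suc m \<Rightarrow> D (coeff P p m))"
    and shift_der_monom: "a \<in> carrier R \<Longrightarrow> shift_der R D (monom P a n) = monom P (D a) (Suc n)"
    and shift_der_add: "p \<in> carrier P \<Longrightarrow> q \<in> carrier P \<Longrightarrow>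
      shift_der R D (p \<oplus>\<^bsub>P\<^esub> q) = shift_der R D p \<oplus>\<^bsub>P\<^esub> shift_der R D q"
    and shift_der_mult: "p \<in> carrier P \<Longrightarrow> q \<in> carrier P \<Longrightarrow>
      shift_der R D (p \<otimes>\<^bsub>P\<^esub> q) = shift_der R D p \<otimes>\<^bsub>P\<^esub> q \<oplus>\<^bsub>P\<^esub> p \<otimes>\<^bsub>P\<^esub> shift_der R D q"
    and shift_der_eval: "p \<in> carrier P \<Longrightarrow>
      eval R R (\<lambda>x. x) \<one>\<^bsub>R\<^esub> (shift_der R D p) = D (eval R R (\<lambda>x. x) \<one>\<^bsub>R\<^esub> p)"
proof -
  interpret UP_cring R P
    by (intro UP_cring.intro R) (simp_all add: P_def)
  let ?S = "shift_der R D"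
  have D0: "D \<zero>\<^bsub>R\<^esub> = \<zero>\<^bsub>R\<^esub>"
    by (rule additive_zero) (use D add R.abelian_group_axioms in auto)
  have cf: "coeff P p = p" if "p \<in> carrier P" for p using that by (auto simp: P_def UP_def)
  show cl: "?S p \<in> carrier P" if "p \<in> carrier P" for p
  proof -
    have p: "p \<in> up R" using that by (simp add: P_def UP_def)
    then obtain m where m: "bound \<zero>\<^bsub>R\<^esub> m p" by auto
    have "?S p \<in> up R"
    proof
      show "?S p n \<in> carrier R" for n using p by (auto simp: shift_der_def mem_upD intro!: D split: nat.split)
      show "\<exists>n. bound \<zero>\<^bsub>R\<^esub> n (?S p)"
        using m by (intro exI[of _ "Suc m"]) (auto simp: bound_def shift_der_def D0 split: nat.split)
    qed
    then show ?thesis by (simp add: P_def UP_def)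
  qed
  show co: "coeff P (?S p) n = (case n of 0 \<Rightarrow> \<zero>\<^bsub>R\<^esub> | Suc m \<Rightarrow> D (coeff P p m))"
    if "p \<in> carrier P" for p n
    by (simp add: cf cl that shift_der_def split: nat.split)
  show mo: "?S (monom P a n) = monom P (D a) (Suc n)" if "a \<in> carrier R" for a n
    by (rule up_eqI) (use that in \<open>auto simp: cl co D D0 split: nat.split\<close>)
  show ad: "?S (p \<oplus>\<^bsub>P\<^esub> q) = ?S p \<oplus>\<^bsub>P\<^esub> ?S q" if "p \<in> carrier P" "q \<in> carrier P" for p q
    by (rule up_eqI) (use that in \<open>auto simp: cl co add split: nat.split\<close>)
  have mm: "?S (monom P a n \<otimes>\<^bsub>P\<^esub> monom P b m) =
      ?S (monom P a n) \<otimes>\<^bsub>P\<^esub> monom P b m \<oplus>\<^bsub>P\<^esub> monom P a n \<otimes>\<^bsub>P\<^esub> ?S (monom P b m)"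
    if "a \<in> carrier R" "b \<in> carrier R" for a b n m
    using that by (simp add: mo D leib flip: monom_mult)
  have mq: "?S (monom P a n \<otimes>\<^bsub>P\<^esub> q) =
      ?S (monom P a n) \<otimes>\<^bsub>P\<^esub> q \<oplus>\<^bsub>P\<^esub> monom P a n \<otimes>\<^bsub>P\<^esub> ?S q"
    if "a \<in> carrier R" "q \<in> carrier P" for a n q
    using that(2)
  proof (induction rule: UP_induct)
    case (monom b m)
    then show ?case using that mm by simp
  next
    case (add q r)
    then show ?case using that by (simp add: P.r_distr ad cl P.a_ac)
  qed
  show "?S (p \<otimes>\<^bsub>P\<^esub> q) = ?S p \<otimes>\<^bsub>P\<^esub> q \<oplus>\<^bsub>P\<^esub> p \<otimes>\<^bsub>P\<^esub> ?S q"
    if "p \<in> carrier P" "q \<in> carrier P" for p q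
    using that(1)
  proof (induction rule: UP_induct)
    case (monom a n)
    then show ?case using that mq by simp
  next
    case (add r s)
    then show ?case using that by (simp add: P.l_distr ad cl P.a_ac)
  qed
  have ev: "UP_pre_univ_prop R R (\<lambda>x. x)"
    by (intro UP_pre_univ_prop.intro ring_hom_cringI R UP_cring_axioms)
      (auto simp: ring_hom_def P_def)
  let ?e = "eval R R (\<lambda>x. x) \<one>\<^bsub>R\<^esub>"
  have e: "?e \<in> ring_hom P R" by (rule UP_pre_univ_prop.eval_ring_hom[OF ev, folded P_def]) simp
  have em: "?e (monom P a n) = a" if "a \<in> carrier R" for a n
    using UP_pre_univ_prop.eval_monom[OF ev that, folded P_def] that by simp
  show "?e (?S p) = D (?e p)" if "p \<in> carrier P" for p
    using that
  proof (induction rule: UP_induct)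
    case (monom a n)
    then show ?case by (simp add: mo em D)
  next
    case (add p q)
    then show ?case
      by (simp add: ad cl ring_hom_add[OF e] assms(3) ring_hom_closed[OF e])
  qed
qed

text \<open>The arc algebra is graded by the number of derivations, and \<open>V n\<close> is the part of weight at least
\<open>n\<close>. The grading is detected by the universal property: the constants \<open>R \<rightarrow> J[t]\<close> extend to a
differential homomorphism \<open>\<phi>\<close> from \<open>J\<close> to \<open>J[t]\<close> with derivation \<open>t \<cdot> D\<close>, and the coefficients of
\<open>\<phi> x\<close> are the homogeneous components of \<open>x\<close>. Setting \<open>t = 1\<close> is a left inverse of \<open>\<phi>\<close>, so an element
all of whose components vanish is zero; this is why the filtration is separated.\<close>

lemma arc_filtration:
  fixes k :: "('k, 'm) ring_scheme" and R :: "('k, 'r) module"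
  assumes alg: "algebra k R"
  obtains V where "V 0 = carrier (arc_algebra k R)" "\<And>n. ideal (V n) (arc_algebra k R)"
    "\<And>n. arc_der k R ` V n \<subseteq> V (Suc n)" "(\<Inter>n. V n) = {\<zero>\<^bsub>arc_algebra k R\<^esub>}"
proof -
  define J where "J = arc_algebra k R"
  define D where "D = arc_der k R"
  define P where "P = UP J"
  have dJ: "diff_algebra k J D" unfolding J_def D_def by (rule arc_diff_algebra[OF alg])
  interpret R: algebra k R by fact
  have aJ: "algebra k J" using dJ by (simp add: diff_algebra_def)
  interpret J: algebra k J by (rule aJ)
  have D: "derivation k J D" using dJ by (simp add: diff_algebra_def)
  note D' = derivationD[OF D]
  have Jc: "cring J" by (rule J.M_cring)
  interpret UP_cring J P
    by (intro UP_cring.intro Jc) (simp add: P_def)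
  note S = shift_der_UP[OF Jc D'(1,2,4), folded P_def]
  define h where "h c = monom P (c \<odot>\<^bsub>J\<^esub> \<one>\<^bsub>J\<^esub>) 0" for c
  define B where "B = algebra_via h P"
  have const: "(\<lambda>a. monom P a 0) \<in> ring_hom J P"
    by (rule const_ring_hom)
  have h: "h \<in> ring_hom k P"
    unfolding h_def
    using ring_hom_trans[OF algebra_unit_hom[OF aJ] const] by (simp add: comp_def)
  have D1: "D (c \<odot>\<^bsub>J\<^esub> \<one>\<^bsub>J\<^esub>) = \<zero>\<^bsub>J\<^esub>" if "c \<in> carrier k" for c
    using that derivation_one[OF dJ] by (simp add: D'(3))
  have Bd: "diff_algebra k B (shift_der J D)"
    unfolding B_def
    by (rule diff_algebra_via)
      (use h in \<open>auto simp: S R.R_cring P.is_cring h_def D1\<close>)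
  note i = arc_in_hom[OF alg, folded J_def]
  define f where "f a = monom P (arc_in k R a) 0" for a
  have f: "f \<in> alg_hom k R B"
  proof -
    have i1: "arc_in k R \<in> ring_hom R J" using i by (simp add: alg_hom_def)
    have "f \<in> ring_hom R P"
      unfolding f_def using ring_hom_trans[OF i1 const] by (simp add: comp_def)
    then have "f \<in> ring_hom R B" by (simp add: ring_hom_def B_def)
    moreover have "f (c \<odot>\<^bsub>R\<^esub> x) = c \<odot>\<^bsub>B\<^esub> f x" if "c \<in> carrier k" "x \<in> carrier R" for c x
    proof -
      have "arc_in k R (c \<odot>\<^bsub>R\<^esub> x) = c \<odot>\<^bsub>J\<^esub> arc_in k R x" using i that by (simp add: alg_hom_def)
      also have "\<dots> = (c \<odot>\<^bsub>J\<^esub> \<one>\<^bsub>J\<^esub>) \<otimes>\<^bsub>J\<^esub> arc_in k R x"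
        using that ring_hom_closed[OF i1] by (simp add: J.smult_assoc2)
      finally show ?thesis
        using that ring_hom_closed[OF i1] by (simp add: B_def f_def h_def flip: monom_mult)
    qed
    ultimately show ?thesis by (simp add: alg_hom_def)
  qed
  define \<phi> where "\<phi> = arc_ext k R B (shift_der J D) f"
  note \<phi>' = diff_homD[OF arc_ext_hom[OF alg Bd f], folded \<phi>_def J_def D_def, unfolded B_def algebra_via_simps]
  have \<phi>_in: "\<phi> (arc_in k R a) = monom P (arc_in k R a) 0" if "a \<in> carrier R" for a
    using arc_ext_in[OF alg Bd f that] by (simp add: \<phi>_def f_def)
  have ev: "UP_pre_univ_prop J J (\<lambda>x. x)"
    by (intro UP_pre_univ_prop.intro ring_hom_cringI Jc UP_cring_axioms)
      (auto simp: ring_hom_def P_def)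
  let ?e = "eval J J (\<lambda>x. x) \<one>\<^bsub>J\<^esub>"
  have e: "?e \<in> ring_hom P J" by (rule UP_pre_univ_prop.eval_ring_hom[OF ev, folded P_def]) simp
  \<comment> \<open>evaluation at 1 after \<open>\<phi>\<close> is a differential endomorphism of \<open>J\<close> that fixes \<open>R\<close>\<close>
  have inv: "?e (\<phi> x) = x" if "x \<in> carrier J" for x
    using alg that[unfolded J_def]
  proof (induction rule: arc_induct)
    case (gen a)
    have "arc_in k R a \<in> carrier J" using i gen by (auto simp: alg_hom_def ring_hom_def)
    then show ?case using gen UP_pre_univ_prop.eval_const[OF ev, of "\<one>\<^bsub>J\<^esub>" "arc_in k R a", folded P_def] by (simp add: \<phi>_in)
  next
    case (add x y)
    then show ?case by (simp add: \<phi>' ring_hom_add[OF e] flip: J_def)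
  next
    case (mult x y)
    then show ?case by (simp add: \<phi>' ring_hom_mult[OF e] flip: J_def)
  next
    case (der x)
    then show ?case by (simp add: \<phi>' S flip: J_def D_def)
  qed
  define V where "V n = {x \<in> carrier J. \<forall>m<n. coeff P (\<phi> x) m = \<zero>\<^bsub>J\<^esub>}" for n
  have \<phi>0: "\<phi> \<zero>\<^bsub>J\<^esub> = \<zero>\<^bsub>P\<^esub>"
    by (rule additive_zero) (use \<phi>' in \<open>auto intro: J.M.abelian_group_axioms P.abelian_group_axioms\<close>)
  have \<phi>m: "\<phi> (\<ominus>\<^bsub>J\<^esub> x) = \<ominus>\<^bsub>P\<^esub> \<phi> x" if "x \<in> carrier J" for x
    using that \<phi>'(3)[of "\<ominus>\<^bsub>J\<^esub> x" x] \<phi>'(2) by (simp add: J.M.l_neg \<phi>0 P.minus_equality)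
  have mult0: "coeff P (\<phi> (a \<otimes>\<^bsub>J\<^esub> x)) m = \<zero>\<^bsub>J\<^esub>"
    if a: "a \<in> carrier J" and x: "x \<in> V n" and m: "m < n" for a x m n
  proof -
    have xc: "x \<in> carrier J" using x by (simp add: V_def)
    have "coeff P (\<phi> (a \<otimes>\<^bsub>J\<^esub> x)) m = (\<Oplus>\<^bsub>J\<^esub>i\<in>{..m}. coeff P (\<phi> a) i \<otimes>\<^bsub>J\<^esub> coeff P (\<phi> x) (m - i))"
      using a xc by (simp add: \<phi>')
    also have "\<dots> = (\<Oplus>\<^bsub>J\<^esub>i\<in>{..m}. \<zero>\<^bsub>J\<^esub>)"
      by (rule J.M.finsum_cong') (use a x m in \<open>auto simp: V_def \<phi>'\<close>)
    finally show ?thesis by simp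
  qed
  have ideal: "ideal (V n) J" for n
  proof (rule idealI)
    show "ring J" by (rule cring.axioms(1)[OF Jc])
    show "subgroup (V n) (add_monoid J)"
      by (rule J.M.add.subgroupI) (auto simp: V_def \<phi>0 \<phi>m \<phi>' simp flip: a_inv_def intro!: exI[of _ "\<zero>\<^bsub>J\<^esub>"])
    fix x a assume xa: "x \<in> V n" "a \<in> carrier J"
    then have xc: "x \<in> carrier J" by (simp add: V_def)
    show "a \<otimes>\<^bsub>J\<^esub> x \<in> V n" using xa xc mult0[OF xa(2,1)] by (simp add: V_def)
    then show "x \<otimes>\<^bsub>J\<^esub> a \<in> V n" using xa xc by (simp add: J.m_comm)
  qed
  show ?thesis
  proof (rule that[of V, folded J_def D_def, OF _ ideal])
    show "V 0 = carrier J" by (simp add: V_def)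
    show "D ` V n \<subseteq> V (Suc n)" for n
    proof
      fix y assume "y \<in> D ` V n"
      then obtain x where x: "x \<in> carrier J" "\<And>m. m < n \<Longrightarrow> coeff P (\<phi> x) m = \<zero>\<^bsub>J\<^esub>" "y = D x"
        by (auto simp: V_def)
      have "coeff P (\<phi> y) m = \<zero>\<^bsub>J\<^esub>" if "m < Suc n" for m
        using x that derivation_zero[OF dJ] by (cases m) (simp_all add: \<phi>' S)
      then show "y \<in> V (Suc n)" using x by (simp add: V_def D')
    qed
    show "(\<Inter>n. V n) = {\<zero>\<^bsub>J\<^esub>}"
    proof (intro equalityI subsetI)
      fix x assume x: "x \<in> (\<Inter>n. V n)"
      then have xc: "x \<in> carrier J" by (auto simp: V_def)
      have "coeff P (\<phi> x) n = \<zero>\<^bsub>J\<^esub>" for n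
      proof -
        have "x \<in> V (Suc n)" using x by blast
        then show ?thesis by (simp add: V_def)
      qed
      then have "\<phi> x = \<zero>\<^bsub>P\<^esub>" by (intro up_eqI) (auto simp: \<phi>' xc)
      then have "\<phi> x = \<phi> \<zero>\<^bsub>J\<^esub>" by (simp add: \<phi>0)
      then have "x = \<zero>\<^bsub>J\<^esub>" by (metis inv xc J.M.zero_closed)
      then show "x \<in> {\<zero>\<^bsub>J\<^esub>}" by simp
    qed (auto simp: V_def \<phi>0)
  qed
qed

text \<open>Iterating the hypothesis pushes \<open>I\<close> into every step of the weight filtration: if \<open>I\<close> has weight at least
\<open>n\<close>, then the ideal generated by the derivatives of \<open>I\<close> has weight at least \<open>n + 1\<close>.\<close>

lemma arc_nakayama:
  assumes alg: "algebra k R" and I: "ideal I (arc_algebra k R)"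
    and sub: "I \<subseteq> Idl\<^bsub>arc_algebra k R\<^esub> (arc_der k R ` I)"
  shows "I = {\<zero>\<^bsub>arc_algebra k R\<^esub>}"
proof -
  interpret I: ideal I "arc_algebra k R" by fact
  obtain V where V: "V 0 = carrier (arc_algebra k R)" "\<And>n. ideal (V n) (arc_algebra k R)"
    "\<And>n. arc_der k R ` V n \<subseteq> V (Suc n)" "(\<Inter>n. V n) = {\<zero>\<^bsub>arc_algebra k R\<^esub>}"
    using arc_filtration[OF alg] by blast
  have "I \<subseteq> V n" for n
  proof (induction n)
    case 0
    show ?case using V(1) I.a_subset by simp
  next
    case (Suc n)
    then have "arc_der k R ` I \<subseteq> V (Suc n)" using V(3) by blast
    then have "Idl\<^bsub>arc_algebra k R\<^esub> (arc_der k R ` I) \<subseteq> V (Suc n)" by (rule I.genideal_minimal[OF V(2)])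
    with sub show ?case by blast
  qed
  then have "I \<subseteq> {\<zero>\<^bsub>arc_algebra k R\<^esub>}" using V(4) by blast
  then show ?thesis by (rule subset_antisym) (simp add: I.zero_closed)
qed

section \<open>Extensions by quasi-ideals\<close>

text \<open>A quasi-ideal in the sense of Drinfeld: a module \<open>Q\<close> with a linear map \<open>\<delta>\<close> to the ring \<open>A\<close> which satisfies
the identity \<open>\<delta> u \<cdot> v = \<delta> v \<cdot> u\<close> that holds automatically for the inclusion of an ideal. The identity is
exactly what makes the associative product \<open>u * v = \<delta> u \<cdot> v\<close> on \<open>Q\<close> commutative.\<close>

locale quasi_ideal = module A Q
  for A :: "('a, 'm) ring_scheme" and Q :: "('a, 'u) module" +
  fixes \<delta> :: "'u \<Rightarrow> 'a"
  assumes boundary_hom: "\<delta> \<in> mod_hom A Q (self_module A)"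
    and boundary_comm: "u \<in> carrier Q \<Longrightarrow> v \<in> carrier Q \<Longrightarrow> \<delta> u \<odot>\<^bsub>Q\<^esub> v = \<delta> v \<odot>\<^bsub>Q\<^esub> u"
begin

text \<open>The split extension of \<open>A\<close> by the non-unital algebra \<open>Q\<close> with the product \<open>u * v = \<delta> u \<cdot> v\<close>. Besides the
projection that kills \<open>Q\<close> it has a second ring homomorphism \<open>proj\<close> to \<open>A\<close>, which restricts to \<open>\<delta>\<close> on \<open>Q\<close>.\<close>

definition ext :: "('a \<times> 'u) ring" where
  "ext =
    \<lparr>carrier = carrier A \<times> carrier Q,
     mult = (\<lambda>(a, u) (b, v). (a \<otimes>\<^bsub>A\<^esub> b, a \<odot>\<^bsub>Q\<^esub> v \<oplus>\<^bsub>Q\<^esub> (b \<odot>\<^bsub>Q\<^esub> u \<oplus>\<^bsub>Q\<^esub> \<delta> u \<odot>\<^bsub>Q\<^esub> v))),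
     one = (\<one>\<^bsub>A\<^esub>, \<zero>\<^bsub>Q\<^esub>), zero = (\<zero>\<^bsub>A\<^esub>, \<zero>\<^bsub>Q\<^esub>),
     add = (\<lambda>(a, u) (b, v). (a \<oplus>\<^bsub>A\<^esub> b, u \<oplus>\<^bsub>Q\<^esub> v))\<rparr>"

definition proj :: "'a \<times> 'u \<Rightarrow> 'a" where
  "proj x = fst x \<oplus>\<^bsub>A\<^esub> \<delta> (snd x)"

lemma ext_simps [simp]:
  "carrier ext = carrier A \<times> carrier Q"
  "(a, u) \<otimes>\<^bsub>ext\<^esub> (b, v) =
    (a \<otimes>\<^bsub>A\<^esub> b, a \<odot>\<^bsub>Q\<^esub> v \<oplus>\<^bsub>Q\<^esub> (b \<odot>\<^bsub>Q\<^esub> u \<oplus>\<^bsub>Q\<^esub> \<delta> u \<odot>\<^bsub>Q\<^esub> v))"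
  "\<one>\<^bsub>ext\<^esub> = (\<one>\<^bsub>A\<^esub>, \<zero>\<^bsub>Q\<^esub>)" "\<zero>\<^bsub>ext\<^esub> = (\<zero>\<^bsub>A\<^esub>, \<zero>\<^bsub>Q\<^esub>)"
  "(a, u) \<oplus>\<^bsub>ext\<^esub> (b, v) = (a \<oplus>\<^bsub>A\<^esub> b, u \<oplus>\<^bsub>Q\<^esub> v)"
  by (simp_all add: ext_def)

lemma boundary_simps [simp]:
  "u \<in> carrier Q \<Longrightarrow> \<delta> u \<in> carrier A"
  "u \<in> carrier Q \<Longrightarrow> v \<in> carrier Q \<Longrightarrow> \<delta> (u \<oplus>\<^bsub>Q\<^esub> v) = \<delta> u \<oplus>\<^bsub>A\<^esub> \<delta> v"
  "a \<in> carrier A \<Longrightarrow> u \<in> carrier Q \<Longrightarrow> \<delta> (a \<odot>\<^bsub>Q\<^esub> u) = a \<otimes>\<^bsub>A\<^esub> \<delta> u"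
  using mod_homD[OF boundary_hom] by (simp_all add: self_module_def)

lemma boundary_zero [simp]: "\<delta> \<zero>\<^bsub>Q\<^esub> = \<zero>\<^bsub>A\<^esub>"
  using boundary_simps(3)[of "\<zero>\<^bsub>A\<^esub>" "\<zero>\<^bsub>Q\<^esub>"] by simp

lemma cring_ext: "cring ext"
proof (rule cringI)
  show "abelian_group ext"
  proof (rule abelian_groupI)
    fix x assume "x \<in> carrier ext"
    then show "\<exists>y\<in>carrier ext. y \<oplus>\<^bsub>ext\<^esub> x = \<zero>\<^bsub>ext\<^esub>"
      by (cases x) (auto intro!: bexI[of _ "(\<ominus>\<^bsub>A\<^esub> fst x, \<ominus>\<^bsub>Q\<^esub> snd x)"] simp: R.l_neg M.l_neg)
  next
    fix x y assume "x \<in> carrier ext" "y \<in> carrier ext"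
    then show "x \<oplus>\<^bsub>ext\<^esub> y = y \<oplus>\<^bsub>ext\<^esub> x" by (auto simp: R.a_comm M.a_comm)
  qed (auto simp: R.a_assoc M.a_assoc)
  show "comm_monoid ext"
  proof (rule comm_monoidI)
    fix x y assume xy: "x \<in> carrier ext" "y \<in> carrier ext"
    obtain a u b v where e: "x = (a, u)" "y = (b, v)" by (cases x, cases y) blast
    with xy have c: "a \<in> carrier A" "u \<in> carrier Q" "b \<in> carrier A" "v \<in> carrier Q" by auto
    have "\<delta> u \<odot>\<^bsub>Q\<^esub> v = \<delta> v \<odot>\<^bsub>Q\<^esub> u" using c by (intro boundary_comm)
    then show "x \<otimes>\<^bsub>ext\<^esub> y = y \<otimes>\<^bsub>ext\<^esub> x" using c by (simp add: e R.m_comm M.a_ac)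
    fix z assume z: "z \<in> carrier ext"
    obtain c' w where z': "z = (c', w)" "c' \<in> carrier A" "w \<in> carrier Q" using z by (cases z) auto
    \<comment> \<open>both bracketings produce the same terms, up to the order of the scalars\<close>
    have "c' \<odot>\<^bsub>Q\<^esub> (a \<odot>\<^bsub>Q\<^esub> v) = (a \<otimes>\<^bsub>A\<^esub> c') \<odot>\<^bsub>Q\<^esub> v" "c' \<odot>\<^bsub>Q\<^esub> (b \<odot>\<^bsub>Q\<^esub> u) = (b \<otimes>\<^bsub>A\<^esub> c') \<odot>\<^bsub>Q\<^esub> u"
      "c' \<odot>\<^bsub>Q\<^esub> (\<delta> u \<odot>\<^bsub>Q\<^esub> v) = \<delta> u \<odot>\<^bsub>Q\<^esub> (c' \<odot>\<^bsub>Q\<^esub> v)" "(b \<otimes>\<^bsub>A\<^esub> \<delta> u) \<odot>\<^bsub>Q\<^esub> w = (\<delta> u \<otimes>\<^bsub>A\<^esub> b) \<odot>\<^bsub>Q\<^esub> w"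
      using c z' by (simp_all add: R.m_comm flip: smult_assoc1)
    then show "(x \<otimes>\<^bsub>ext\<^esub> y) \<otimes>\<^bsub>ext\<^esub> z = x \<otimes>\<^bsub>ext\<^esub> (y \<otimes>\<^bsub>ext\<^esub> z)"
      using c z' by (simp add: e R.m_assoc smult_l_distr smult_r_distr smult_assoc1 M.a_ac)
  qed auto
  fix x y z assume xyz: "x \<in> carrier ext" "y \<in> carrier ext" "z \<in> carrier ext"
  then show "(x \<oplus>\<^bsub>ext\<^esub> y) \<otimes>\<^bsub>ext\<^esub> z = x \<otimes>\<^bsub>ext\<^esub> z \<oplus>\<^bsub>ext\<^esub> y \<otimes>\<^bsub>ext\<^esub> z"
    by (auto simp: R.l_distr smult_l_distr smult_r_distr M.a_ac)
qed

lemma proj_hom: "proj \<in> ring_hom ext A"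
proof (rule ring_hom_memI)
  fix x y assume xy: "x \<in> carrier ext" "y \<in> carrier ext"
  obtain a u b v where e: "x = (a, u)" "y = (b, v)" by (cases x, cases y) blast
  with xy have c: "a \<in> carrier A" "u \<in> carrier Q" "b \<in> carrier A" "v \<in> carrier Q" by auto
  then show "proj (x \<oplus>\<^bsub>ext\<^esub> y) = proj x \<oplus>\<^bsub>A\<^esub> proj y"
    by (simp add: e proj_def R.a_ac)
  have "\<delta> u \<otimes>\<^bsub>A\<^esub> b = b \<otimes>\<^bsub>A\<^esub> \<delta> u" using c by (simp add: R.m_comm)
  then show "proj (x \<otimes>\<^bsub>ext\<^esub> y) = proj x \<otimes>\<^bsub>A\<^esub> proj y"
    using c by (simp add: e proj_def R.l_distr R.r_distr R.a_ac)
qed (auto simp: proj_def)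

text \<open>The ideal \<open>Q\<close> of the extension is a module over it through \<open>proj\<close>, not through the first projection.\<close>

lemma ext_mult_ideal:
  assumes "x \<in> carrier ext" "w \<in> carrier Q"
  shows "x \<otimes>\<^bsub>ext\<^esub> (\<zero>\<^bsub>A\<^esub>, w) = (\<zero>\<^bsub>A\<^esub>, proj x \<odot>\<^bsub>Q\<^esub> w)"
  using assms by (auto simp: proj_def smult_l_distr)

lemma incl_hom: "(\<lambda>a. (a, \<zero>\<^bsub>Q\<^esub>)) \<in> ring_hom A ext"
  by (rule ring_hom_memI) auto

end

text \<open>If \<open>d\<close> is a derivation from \<open>A\<close> to \<open>Q\<close>, then \<open>x \<mapsto> (0, d (proj x))\<close> is a derivation of the extension:
the extension acts on \<open>Q\<close> through \<open>proj\<close>, so composing \<open>d\<close> with \<open>proj\<close> keeps the Leibniz rule.\<close>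

lemma quasi_ideal_diff_algebra:
  fixes A :: "('k, 'a) module"
  assumes dA: "diff_algebra k A T" and qi: "quasi_ideal A Q \<delta>"
    and d: "d \<in> carrier A \<rightarrow> carrier Q"
    and add: "\<And>x y. x \<in> carrier A \<Longrightarrow> y \<in> carrier A \<Longrightarrow> d (x \<oplus>\<^bsub>A\<^esub> y) = d x \<oplus>\<^bsub>Q\<^esub> d y"
    and smult: "\<And>c x. c \<in> carrier k \<Longrightarrow> x \<in> carrier A \<Longrightarrow>
      d (c \<odot>\<^bsub>A\<^esub> x) = (c \<odot>\<^bsub>A\<^esub> \<one>\<^bsub>A\<^esub>) \<odot>\<^bsub>Q\<^esub> d x"
    and leib: "\<And>x y. x \<in> carrier A \<Longrightarrow> y \<in> carrier A \<Longrightarrow>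
      d (x \<otimes>\<^bsub>A\<^esub> y) = y \<odot>\<^bsub>Q\<^esub> d x \<oplus>\<^bsub>Q\<^esub> x \<odot>\<^bsub>Q\<^esub> d y"
  shows "diff_algebra k (algebra_via (\<lambda>c. (c \<odot>\<^bsub>A\<^esub> \<one>\<^bsub>A\<^esub>, \<zero>\<^bsub>Q\<^esub>)) (quasi_ideal.ext A Q \<delta>))
    (\<lambda>x. (\<zero>\<^bsub>A\<^esub>, d (quasi_ideal.proj A \<delta> x)))"
proof -
  interpret quasi_ideal A Q \<delta> by (rule qi)
  interpret E: cring ext by (rule cring_ext)
  have alg: "algebra k A" using dA by (simp add: diff_algebra_def)
  interpret A: algebra k A by (rule alg)
  have dc: "d x \<in> carrier Q" if "x \<in> carrier A" for x using d that by auto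
  have pc: "proj x \<in> carrier A" if "x \<in> carrier ext" for x
    using ring_hom_closed[OF proj_hom that] .
  have d1: "d \<one>\<^bsub>A\<^esub> = \<zero>\<^bsub>Q\<^esub>"
  proof -
    have "d \<one>\<^bsub>A\<^esub> \<oplus>\<^bsub>Q\<^esub> d \<one>\<^bsub>A\<^esub> = d \<one>\<^bsub>A\<^esub>" using leib[of "\<one>\<^bsub>A\<^esub>" "\<one>\<^bsub>A\<^esub>"] dc by simp
    then show ?thesis using dc by (simp add: M.add.l_cancel_one')
  qed
  show ?thesis
  proof (rule diff_algebra_via[OF A.R_cring cring_ext])
    show "(\<lambda>c. (c \<odot>\<^bsub>A\<^esub> \<one>\<^bsub>A\<^esub>, \<zero>\<^bsub>Q\<^esub>)) \<in> ring_hom k ext"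
      using ring_hom_trans[OF algebra_unit_hom[OF alg] incl_hom] by (simp add: comp_def)
    show "(\<zero>\<^bsub>A\<^esub>, d (proj x)) \<in> carrier ext" if "x \<in> carrier ext" for x
      using dc[OF pc[OF that]] by simp
    show "(\<zero>\<^bsub>A\<^esub>, d (proj (c \<odot>\<^bsub>A\<^esub> \<one>\<^bsub>A\<^esub>, \<zero>\<^bsub>Q\<^esub>))) = \<zero>\<^bsub>ext\<^esub>" if "c \<in> carrier k" for c
      using that by (simp add: proj_def smult d1)
    fix x y assume xy: "x \<in> carrier ext" "y \<in> carrier ext"
    note c = pc[OF xy(1)] pc[OF xy(2)] dc[OF pc[OF xy(1)]] dc[OF pc[OF xy(2)]]
    show "(\<zero>\<^bsub>A\<^esub>, d (proj (x \<oplus>\<^bsub>ext\<^esub> y))) = (\<zero>\<^bsub>A\<^esub>, d (proj x)) \<oplus>\<^bsub>ext\<^esub> (\<zero>\<^bsub>A\<^esub>, d (proj y))"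
      using c by (simp add: ring_hom_add[OF proj_hom xy] add)
    have "(\<zero>\<^bsub>A\<^esub>, d (proj x)) \<otimes>\<^bsub>ext\<^esub> y = y \<otimes>\<^bsub>ext\<^esub> (\<zero>\<^bsub>A\<^esub>, d (proj x))"
      using xy c by (intro E.m_comm) simp_all
    then show "(\<zero>\<^bsub>A\<^esub>, d (proj (x \<otimes>\<^bsub>ext\<^esub> y))) =
        (\<zero>\<^bsub>A\<^esub>, d (proj x)) \<otimes>\<^bsub>ext\<^esub> y \<oplus>\<^bsub>ext\<^esub> x \<otimes>\<^bsub>ext\<^esub> (\<zero>\<^bsub>A\<^esub>, d (proj y))"
      using xy c by (simp add: ext_mult_ideal leib ring_hom_mult[OF proj_hom xy] del: ext_simps(2))
  qed
qed

text \<open>If moreover \<open>\<delta> \<circ> d = T\<close>, then \<open>proj\<close> is a homomorphism of differential algebras to \<open>(A, T)\<close>, and the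
universal property of the arc algebra lifts \<open>\<pi>\<close> along it. The lift sends \<open>D x\<close> to the class
\<open>d (\<pi> x)\<close> in \<open>Q\<close>, and so transports relations among derivatives in the arc algebra to relations in \<open>Q\<close>.\<close>

lemma arc_lift_quasi_ideal:
  fixes A :: "('k, 'a) module" and R :: "('k, 'r) module"
  assumes algR: "algebra k R" and f: "f \<in> alg_hom k R A"
    and dA: "diff_algebra k A T" and qi: "quasi_ideal A Q \<delta>"
    and d: "d \<in> carrier A \<rightarrow> carrier Q"
    and add: "\<And>x y. x \<in> carrier A \<Longrightarrow> y \<in> carrier A \<Longrightarrow> d (x \<oplus>\<^bsub>A\<^esub> y) = d x \<oplus>\<^bsub>Q\<^esub> d y"
    and smult: "\<And>c x. c \<in> carrier k \<Longrightarrow> x \<in> carrier A \<Longrightarrow>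
      d (c \<odot>\<^bsub>A\<^esub> x) = (c \<odot>\<^bsub>A\<^esub> \<one>\<^bsub>A\<^esub>) \<odot>\<^bsub>Q\<^esub> d x"
    and leib: "\<And>x y. x \<in> carrier A \<Longrightarrow> y \<in> carrier A \<Longrightarrow>
      d (x \<otimes>\<^bsub>A\<^esub> y) = y \<odot>\<^bsub>Q\<^esub> d x \<oplus>\<^bsub>Q\<^esub> x \<odot>\<^bsub>Q\<^esub> d y"
    and factor: "\<And>x. x \<in> carrier A \<Longrightarrow> \<delta> (d x) = T x"
  defines "J \<equiv> arc_algebra k R" and "D \<equiv> arc_der k R" and "\<pi> \<equiv> arc_ext k R A T f"
  obtains \<psi> where "\<psi> \<in> ring_hom J (quasi_ideal.ext A Q \<delta>)"
    "\<And>x. x \<in> carrier J \<Longrightarrow> quasi_ideal.proj A \<delta> (\<psi> x) = \<pi> x"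
    "\<And>x. x \<in> carrier J \<Longrightarrow> \<psi> (D x) = (\<zero>\<^bsub>A\<^esub>, d (\<pi> x))"
proof -
  interpret quasi_ideal A Q \<delta> by (rule qi)
  interpret R': algebra k R by (rule algR)
  have alg: "algebra k A" using dA by (simp add: diff_algebra_def)
  interpret A: algebra k A by (rule alg)
  have dc: "d x \<in> carrier Q" if "x \<in> carrier A" for x using d that by auto
  define B where "B = algebra_via (\<lambda>c. (c \<odot>\<^bsub>A\<^esub> \<one>\<^bsub>A\<^esub>, \<zero>\<^bsub>Q\<^esub>)) ext"
  define S where "S x = (\<zero>\<^bsub>A\<^esub>, d (proj x))" for x
  have dB: "diff_algebra k B S"
    unfolding B_def S_def by (rule quasi_ideal_diff_algebra[OF dA qi d add smult leib])
  define g where "g a = (f a, \<zero>\<^bsub>Q\<^esub>)" for a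
  have f': "f \<in> ring_hom R A" "c \<in> carrier k \<Longrightarrow> x \<in> carrier R \<Longrightarrow> f (c \<odot>\<^bsub>R\<^esub> x) = c \<odot>\<^bsub>A\<^esub> f x" for c x
    using f by (auto simp: alg_hom_def)
  have "g \<in> ring_hom R ext"
    using ring_hom_trans[OF f'(1) incl_hom] by (simp add: comp_def g_def[abs_def])
  then have g: "g \<in> alg_hom k R B"
    using ring_hom_closed[OF f'(1)]
    by (auto simp: alg_hom_def B_def ring_hom_def g_def f'(2) A.smult_assoc2)
  define \<psi> where "\<psi> = arc_ext k R B S g"
  note \<psi>' = diff_homD[OF arc_ext_hom[OF algR dB g], folded \<psi>_def J_def D_def, unfolded B_def algebra_via_simps]
  note \<pi>' = diff_homD[OF arc_ext_hom[OF algR dA f], folded \<pi>_def J_def D_def]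
  have \<psi>hom: "\<psi> \<in> ring_hom J ext" using \<psi>'(1) by (simp add: ring_hom_def)
  note p = ring_hom_add[OF proj_hom] ring_hom_mult[OF proj_hom] ring_hom_closed[OF proj_hom]
  have pr: "proj (\<psi> x) = \<pi> x" if "x \<in> carrier J" for x
    using algR that[unfolded J_def]
  proof (induction rule: arc_induct)
    case (gen a)
    have "\<psi> (arc_in k R a) = g a" using arc_ext_in[OF algR dB g gen] by (simp add: \<psi>_def)
    moreover have "\<pi> (arc_in k R a) = f a" using arc_ext_in[OF algR dA f gen] by (simp add: \<pi>_def)
    ultimately show ?case using ring_hom_closed[OF f'(1) gen] by (simp add: g_def proj_def)
  next
    case (add x y)
    then show ?case using \<psi>'(2)[of x] \<psi>'(2)[of y] by (simp add: \<psi>' \<pi>' p flip: J_def del: ext_simps)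
  next
    case (mult x y)
    then show ?case using \<psi>'(2)[of x] \<psi>'(2)[of y] by (simp add: \<psi>' \<pi>' p flip: J_def del: ext_simps)
  next
    case (der x)
    then have x: "x \<in> carrier J" and IH: "proj (\<psi> x) = \<pi> x" by (simp_all add: J_def)
    from x have \<pi>x: "\<pi> x \<in> carrier A" by (rule \<pi>'(2))
    have "T (\<pi> x) \<in> carrier A"
      using boundary_simps(1)[OF dc[OF \<pi>x]] by (simp add: factor \<pi>x)
    with \<pi>x have "proj (\<psi> (D x)) = T (\<pi> x)"
      using dc by (simp add: \<psi>'(5)[OF x] S_def IH) (simp add: proj_def factor)
    then show ?case by (simp add: \<pi>'(5)[OF x] flip: D_def)
  qed
  show ?thesis
    by (rule that[OF \<psi>hom pr]) (simp_all add: \<psi>'(5) S_def pr)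
qed

section \<open>The Koszul complex in degree one\<close>

lemma set_quotient_lift:
  assumes "\<And>x y. x \<in> X \<Longrightarrow> y \<in> X \<Longrightarrow> q x = q y \<Longrightarrow> f x = f y"
  obtains g where "\<And>x. x \<in> X \<Longrightarrow> g (q x) = f x"
proof (rule that)
  fix x assume x: "x \<in> X"
  have "inv_into X q (q x) \<in> X" "q (inv_into X q (q x)) = q x"
    using x by (auto intro: inv_into_into f_inv_into_f)
  then show "(\<lambda>c. f (inv_into X q c)) (q x) = f x" using assms x by blast
qed

definition koszul_boundaries :: "('k, 'm) ring_scheme \<Rightarrow> ('k, 'a) module \<Rightarrow> ('a \<Rightarrow> 'a) \<Rightarrow> ('a \<Rightarrow> 'a) set set" where
  "koszul_boundaries k A T = koszul_d2 k A T ` carrier (ext2 A (kaehler k A))"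

lemma koszul_d1_simps:
  assumes dA: "diff_algebra k A T"
  shows "u \<in> carrier (kaehler k A) \<Longrightarrow> koszul_d1 k A T u \<in> carrier A"
    and "u \<in> carrier (kaehler k A) \<Longrightarrow> v \<in> carrier (kaehler k A) \<Longrightarrow>
      koszul_d1 k A T (u \<oplus>\<^bsub>kaehler k A\<^esub> v) = koszul_d1 k A T u \<oplus>\<^bsub>A\<^esub> koszul_d1 k A T v"
    and "a \<in> carrier A \<Longrightarrow> u \<in> carrier (kaehler k A) \<Longrightarrow>
      koszul_d1 k A T (a \<odot>\<^bsub>kaehler k A\<^esub> u) = a \<otimes>\<^bsub>A\<^esub> koszul_d1 k A T u"
  using mod_homD[OF koszul_d1_hom[OF dA]] by (simp_all add: self_module_def)

lemma koszul_boundaries_submodule: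
  assumes dA: "diff_algebra k A T"
  shows "submodule (koszul_boundaries k A T) A (kaehler k A)"
proof -
  have om: "module A (kaehler k A)" using dA by (intro module_kaehler) (simp add: diff_algebra_def)
  show ?thesis
    unfolding koszul_boundaries_def
    by (rule mod_hom_image[OF module_ext2[OF om] om koszul_d2_hom[OF dA]])
qed

text \<open>Modulo the image of \<open>d\<^sub>2\<close> the Kaehler differentials become a quasi-ideal over \<open>A\<close>, with \<open>d\<^sub>1\<close> as the map to
\<open>A\<close>: the value \<open>d\<^sub>1 u \<cdot> v - d\<^sub>1 v \<cdot> u\<close> of \<open>d\<^sub>2\<close> at \<open>u \<and> v\<close> is precisely what the quasi-ideal
identity asks to vanish.\<close>

lemma koszul_quasi_ideal:
  fixes k :: "('k, 'm) ring_scheme" and A :: "('k, 'a) module"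
  assumes dA: "diff_algebra k A T"
  defines "\<Omega> \<equiv> kaehler k A" and "N \<equiv> koszul_boundaries k A T"
  obtains \<delta> where "quasi_ideal A (quot_module \<Omega> N) \<delta>"
    "\<And>u. u \<in> carrier \<Omega> \<Longrightarrow> \<delta> (N +>\<^bsub>\<Omega>\<^esub> u) = koszul_d1 k A T u"
proof -
  have alg: "algebra k A" using dA by (simp add: diff_algebra_def)
  have om: "module A \<Omega>" unfolding \<Omega>_def by (rule module_kaehler[OF alg])
  interpret O: module A \<Omega> by (rule om)
  let ?d1 = "koszul_d1 k A T" and ?d2 = "koszul_d2 k A T"
  note d1 = koszul_d1_simps[OF dA, folded \<Omega>_def]
  have N: "submodule N A \<Omega>"
    unfolding N_def \<Omega>_def by (rule koszul_boundaries_submodule[OF dA])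
  note q = quot_module_simps[OF om N]
  let ?Q = "quot_module \<Omega> N"
  have "?d1 u = ?d1 v" if uv: "u \<in> carrier \<Omega>" "v \<in> carrier \<Omega>" and e: "N +>\<^bsub>\<Omega>\<^esub> u = N +>\<^bsub>\<Omega>\<^esub> v" for u v
  proof -
    have "u \<ominus>\<^bsub>\<Omega>\<^esub> v \<in> N" using q(5)[OF uv] e by simp
    then have "?d1 (u \<ominus>\<^bsub>\<Omega>\<^esub> v) = \<zero>\<^bsub>A\<^esub>"
      using koszul_d1_d2[OF dA] by (auto simp: N_def koszul_boundaries_def)
    then have "?d1 ((u \<ominus>\<^bsub>\<Omega>\<^esub> v) \<oplus>\<^bsub>\<Omega>\<^esub> v) = ?d1 v" using uv d1 by simp
    then show ?thesis using uv by (simp add: a_minus_def O.M.a_assoc O.M.l_neg)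
  qed
  then obtain \<delta> where \<delta>: "\<And>u. u \<in> carrier \<Omega> \<Longrightarrow> \<delta> (N +>\<^bsub>\<Omega>\<^esub> u) = ?d1 u"
    using set_quotient_lift[of "carrier \<Omega>" "\<lambda>u. N +>\<^bsub>\<Omega>\<^esub> u" ?d1] by blast
  have "quasi_ideal A ?Q \<delta>"
  proof (intro quasi_ideal.intro q(6) quasi_ideal_axioms.intro)
    show "\<delta> \<in> mod_hom A ?Q (self_module A)"
      by (auto simp: mod_hom_def q \<delta> d1 self_module_def)
    fix x y assume "x \<in> carrier ?Q" "y \<in> carrier ?Q"
    then obtain u v where uv: "u \<in> carrier \<Omega>" "v \<in> carrier \<Omega>" "x = N +>\<^bsub>\<Omega>\<^esub> u" "y = N +>\<^bsub>\<Omega>\<^esub> v"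
      by (auto simp: q)
    have "?d2 (wedge A \<Omega> u v) \<in> N"
      unfolding N_def koszul_boundaries_def using wedge_closed[OF om uv(1,2)] by (simp add: \<Omega>_def)
    then have "?d1 u \<odot>\<^bsub>\<Omega>\<^esub> v \<ominus>\<^bsub>\<Omega>\<^esub> ?d1 v \<odot>\<^bsub>\<Omega>\<^esub> u \<in> N"
      using koszul_d2_wedge[OF dA, folded \<Omega>_def, OF uv(1,2)] by simp
    then show "\<delta> x \<odot>\<^bsub>?Q\<^esub> y = \<delta> y \<odot>\<^bsub>?Q\<^esub> x"
      using uv by (simp add: \<delta> q d1)
  qed
  then show ?thesis using \<delta> that by blast
qed

section \<open>Modules over a quotient\<close>

lemma ideal_submodule:
  assumes J: "cring J" and K: "ideal K J" and H: "ideal H J" and KH: "K \<subseteq> H"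
  defines "M \<equiv> (self_module J)\<lparr>carrier := H\<rparr>"
  shows ideal_module: "module J M"
    and ideal_sub_submodule: "submodule K J M"
proof -
  interpret cring J by fact
  interpret S: module J "self_module J" by (rule module_self[OF J])
  have sub: "submodule L J (self_module J)" if "ideal L J" for L
  proof -
    interpret L: ideal L J by fact
    have m: "\<ominus>\<^bsub>self_module J\<^esub> x = \<ominus>\<^bsub>J\<^esub> x" for x
      by (simp add: a_inv_def m_inv_def self_module_def)
    show ?thesis
      by (rule S.submoduleI)
        (unfold m, use L.a_subset L.zero_closed L.a_inv_closed L.a_closed L.I_l_closed in \<open>auto simp: self_module_def\<close>)
  qed
  show M: "module J M"
    unfolding M_def by (rule submodule.submodule_is_module[OF sub[OF H] S.module_axioms])
  have "M\<lparr>carrier := K\<rparr> = (self_module J)\<lparr>carrier := K\<rparr>" by (simp add: M_def)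
  then have "module J (M\<lparr>carrier := K\<rparr>)"
    using submodule.submodule_is_module[OF sub[OF K] S.module_axioms] by simp
  with KH show "submodule K J M"
    by (intro module.module_incl_imp_submodule[OF M]) (simp_all add: M_def)
qed

lemma self_module_update_simps [simp]:
  "add ((self_module J)\<lparr>carrier := H\<rparr>) = add J"
  "smult ((self_module J)\<lparr>carrier := H\<rparr>) = mult J"
  "zero ((self_module J)\<lparr>carrier := H\<rparr>) = zero J"
  by (simp_all add: self_module_def)

lemma a_r_coset_self_module [simp]:
  "K +>\<^bsub>(self_module J)\<lparr>carrier := H\<rparr>\<^esub> x = K +>\<^bsub>J\<^esub> x"
  by (simp add: a_r_coset_def r_coset_def self_module_def)

text \<open>A module over \<open>J\<close> that is killed by the kernel of a surjection \<open>\<pi>\<close> from \<open>J\<close> to \<open>A\<close> is a module over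
\<open>A\<close>. A scalar of \<open>A\<close> acts through an arbitrary preimage, and the result does not depend on its choice.\<close>

definition descend_scalars :: "('b, 'm) ring_scheme \<Rightarrow> ('b \<Rightarrow> 'a) \<Rightarrow> ('b, 'u) module \<Rightarrow> ('a, 'u) module" where
  "descend_scalars J \<pi> M =
    \<lparr>carrier = carrier M, mult = mult M, one = one M, zero = zero M, add = add M,
     smult = (\<lambda>a x. inv_into (carrier J) \<pi> a \<odot>\<^bsub>M\<^esub> x)\<rparr>"

lemma descend_scalars:
  assumes M: "module J M" and A: "cring A" and \<pi>: "\<pi> \<in> ring_hom J A"
    and surj: "\<pi> ` carrier J = carrier A"
    and kill: "\<And>b x. b \<in> carrier J \<Longrightarrow> \<pi> b = \<zero>\<^bsub>A\<^esub> \<Longrightarrow> x \<in> carrier M \<Longrightarrow> b \<odot>\<^bsub>M\<^esub> x = \<zero>\<^bsub>M\<^esub>"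
  shows descend_scalars_smult: "b \<in> carrier J \<Longrightarrow> x \<in> carrier M \<Longrightarrow>
      \<pi> b \<odot>\<^bsub>descend_scalars J \<pi> M\<^esub> x = b \<odot>\<^bsub>M\<^esub> x"
    and module_descend_scalars: "module A (descend_scalars J \<pi> M)"
proof -
  interpret M: module J M by (rule M)
  interpret A: cring A by (rule A)
  interpret \<pi>: ring_hom_cring J A \<pi>
    by (intro ring_hom_cringI M.R.is_cring A \<pi>)
  let ?D = "descend_scalars J \<pi> M"
  have s: "\<pi> b \<odot>\<^bsub>?D\<^esub> x = b \<odot>\<^bsub>M\<^esub> x" if b: "b \<in> carrier J" and x: "x \<in> carrier M" for b x
  proof -
    let ?c = "inv_into (carrier J) \<pi> (\<pi> b)"
    have c: "?c \<in> carrier J" "\<pi> ?c = \<pi> b" using b by (auto intro: inv_into_into f_inv_into_f)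
    have "(?c \<ominus>\<^bsub>J\<^esub> b) \<odot>\<^bsub>M\<^esub> x = \<zero>\<^bsub>M\<^esub>"
      using b c x by (intro kill) (simp_all add: a_minus_def A.r_neg)
    then have "((?c \<ominus>\<^bsub>J\<^esub> b) \<oplus>\<^bsub>J\<^esub> b) \<odot>\<^bsub>M\<^esub> x = b \<odot>\<^bsub>M\<^esub> x"
      using b c x by (simp add: M.smult_l_distr)
    then show ?thesis
      using b c by (simp add: descend_scalars_def a_minus_def M.R.a_assoc M.R.l_neg)
  qed
  show "b \<in> carrier J \<Longrightarrow> x \<in> carrier M \<Longrightarrow> \<pi> b \<odot>\<^bsub>?D\<^esub> x = b \<odot>\<^bsub>M\<^esub> x" by (rule s)
  have D: "carrier ?D = carrier M" "add ?D = add M" "zero ?D = zero M"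
    by (simp_all add: descend_scalars_def)
  have ex: "\<exists>b\<in>carrier J. a = \<pi> b" if "a \<in> carrier A" for a using that surj by auto
  show "module A ?D"
  proof (rule moduleI[OF A])
    show "abelian_group ?D"
      by (rule abelian_groupI)
        (auto simp: D M.M.a_assoc intro: M.M.a_comm M.M.add.l_inv_ex[simplified])
    show "\<one>\<^bsub>A\<^esub> \<odot>\<^bsub>?D\<^esub> x = x" if "x \<in> carrier ?D" for x
      using that s[of "\<one>\<^bsub>J\<^esub>" x] by (simp add: D)
  next
    fix a x assume "a \<in> carrier A" "x \<in> carrier ?D"
    then obtain b where b: "b \<in> carrier J" "a = \<pi> b" and x: "x \<in> carrier M" using ex by (auto simp: D)
    show "a \<odot>\<^bsub>?D\<^esub> x \<in> carrier ?D" using b x by (simp add: s D)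
    show "a \<odot>\<^bsub>?D\<^esub> (x \<oplus>\<^bsub>?D\<^esub> y) = a \<odot>\<^bsub>?D\<^esub> x \<oplus>\<^bsub>?D\<^esub> a \<odot>\<^bsub>?D\<^esub> y" if "y \<in> carrier ?D" for y
      using that b x by (simp add: s D M.smult_r_distr)
    fix a' assume "a' \<in> carrier A"
    then obtain b' where b': "b' \<in> carrier J" "a' = \<pi> b'" using ex by auto
    show "(a \<oplus>\<^bsub>A\<^esub> a') \<odot>\<^bsub>?D\<^esub> x = a \<odot>\<^bsub>?D\<^esub> x \<oplus>\<^bsub>?D\<^esub> a' \<odot>\<^bsub>?D\<^esub> x"
      using b b' x s[of "b \<oplus>\<^bsub>J\<^esub> b'" x] by (simp add: s D M.smult_l_distr)
    show "(a \<otimes>\<^bsub>A\<^esub> a') \<odot>\<^bsub>?D\<^esub> x = a \<odot>\<^bsub>?D\<^esub> (a' \<odot>\<^bsub>?D\<^esub> x)"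
      using b b' x s[of "b \<otimes>\<^bsub>J\<^esub> b'" x] by (simp add: s D M.smult_assoc1)
  qed
qed

section \<open>Surjections of differential algebras\<close>

locale diff_surjection =
  fixes k :: "('k, 'm) ring_scheme" and J :: "('k, 'j) module" and D :: "'j \<Rightarrow> 'j"
    and A :: "('k, 'a) module" and T :: "'a \<Rightarrow> 'a" and \<pi> :: "'j \<Rightarrow> 'a"
  assumes dJ: "diff_algebra k J D" and dA: "diff_algebra k A T"
    and hom: "\<pi> \<in> diff_hom k J D A T" and surj: "\<pi> ` carrier J = carrier A"
begin

sublocale J: algebra k J using dJ by (simp add: diff_algebra_def)
sublocale A: algebra k A using dA by (simp add: diff_algebra_def)
sublocale \<pi>: ring_hom_cring J A \<pi>
  by (intro ring_hom_cringI J.M_cring A.M_cring diff_homD(1)[OF hom])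

text \<open>In the notation \<open>I = ker \<pi>\<close>, the ideal \<open>der_ideal\<close> is \<open>J \<cdot> D J\<close>, and \<open>ker_der_ideal\<close> is \<open>J \<cdot> D I\<close>.\<close>

definition ker :: "'j set" where "ker = a_kernel J A \<pi>"
definition der_ideal :: "'j set" where "der_ideal = Idl\<^bsub>J\<^esub> (D ` carrier J)"
definition ker_der_ideal :: "'j set" where "ker_der_ideal = Idl\<^bsub>J\<^esub> (D ` ker)"

lemma D_simps [simp]:
  "x \<in> carrier J \<Longrightarrow> D x \<in> carrier J"
  "x \<in> carrier J \<Longrightarrow> y \<in> carrier J \<Longrightarrow> D (x \<oplus>\<^bsub>J\<^esub> y) = D x \<oplus>\<^bsub>J\<^esub> D y"
  "c \<in> carrier k \<Longrightarrow> x \<in> carrier J \<Longrightarrow> D (c \<odot>\<^bsub>J\<^esub> x) = c \<odot>\<^bsub>J\<^esub> D x"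
  "x \<in> carrier J \<Longrightarrow> y \<in> carrier J \<Longrightarrow> D (x \<otimes>\<^bsub>J\<^esub> y) = D x \<otimes>\<^bsub>J\<^esub> y \<oplus>\<^bsub>J\<^esub> x \<otimes>\<^bsub>J\<^esub> D y"
  using dJ derivationD[of k J D] by (auto simp: diff_algebra_def)

lemma hom_simps [simp]:
  "x \<in> carrier J \<Longrightarrow> \<pi> (D x) = T (\<pi> x)"
  "c \<in> carrier k \<Longrightarrow> x \<in> carrier J \<Longrightarrow> \<pi> (c \<odot>\<^bsub>J\<^esub> x) = c \<odot>\<^bsub>A\<^esub> \<pi> x"
  using diff_homD[OF hom] by auto

lemma mem_ker: "x \<in> ker \<longleftrightarrow> x \<in> carrier J \<and> \<pi> x = \<zero>\<^bsub>A\<^esub>"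
  unfolding ker_def a_kernel_def' by blast

lemma liftE:
  assumes "a \<in> carrier A" obtains x where "x \<in> carrier J" "a = \<pi> x"
  using assms surj by auto

lemma ker_ideal: "ideal ker J"
  unfolding ker_def by (rule ring_hom_ring.kernel_is_ideal) unfold_locales

lemma D_ker: "D ` ker \<subseteq> ker"
  using derivation_zero[OF dA] by (auto simp: mem_ker)

lemma der_ideal: "ideal der_ideal J"
  unfolding der_ideal_def by (rule J.genideal_ideal) auto

lemma D_der_ideal: "x \<in> carrier J \<Longrightarrow> D x \<in> der_ideal"
proof -
  have "D ` carrier J \<subseteq> der_ideal" unfolding der_ideal_def by (rule J.genideal_self) auto
  then show "x \<in> carrier J \<Longrightarrow> D x \<in> der_ideal" by blast
qed

lemma ker_der_ideal: "ideal ker_der_ideal J"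
  unfolding ker_der_ideal_def by (rule J.genideal_ideal) (auto simp: mem_ker)

lemma D_ker_der_ideal: "x \<in> ker \<Longrightarrow> D x \<in> ker_der_ideal"
proof -
  have "D ` ker \<subseteq> ker_der_ideal"
    unfolding ker_der_ideal_def by (rule J.genideal_self) (auto simp: mem_ker)
  then show "x \<in> ker \<Longrightarrow> D x \<in> ker_der_ideal" by blast
qed

lemma ker_der_ideal_least: "ideal H J \<Longrightarrow> D ` ker \<subseteq> H \<Longrightarrow> ker_der_ideal \<subseteq> H"
  unfolding ker_der_ideal_def by (rule J.genideal_minimal)

lemma der_ideal_induct [consumes 1, case_names D add mult]:
  assumes y: "y \<in> der_ideal"
    and D: "\<And>x. x \<in> carrier J \<Longrightarrow> P (D x)"
    and add: "\<And>x y. x \<in> der_ideal \<Longrightarrow> y \<in> der_ideal \<Longrightarrow> P x \<Longrightarrow> P y \<Longrightarrow> P (x \<oplus>\<^bsub>J\<^esub> y)"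
    and mult: "\<And>a y. a \<in> carrier J \<Longrightarrow> y \<in> der_ideal \<Longrightarrow> P y \<Longrightarrow> P (a \<otimes>\<^bsub>J\<^esub> y)"
  shows "P y"
proof -
  interpret H: ideal der_ideal J by (rule der_ideal)
  let ?H = "{y \<in> der_ideal. P y}"
  have Hc: "y \<in> carrier J" if "y \<in> der_ideal" for y using that by (rule H.Icarr)
  have z: "P \<zero>\<^bsub>J\<^esub>" using mult[of "\<zero>\<^bsub>J\<^esub>" "D \<zero>\<^bsub>J\<^esub>"] D[of "\<zero>\<^bsub>J\<^esub>"] D_der_ideal by simp
  have m: "P (\<ominus>\<^bsub>J\<^esub> x)" if "x \<in> der_ideal" "P x" for x
    using mult[of "\<ominus>\<^bsub>J\<^esub> \<one>\<^bsub>J\<^esub>" x] that Hc by (simp add: J.l_minus)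
  have "ideal ?H J"
  proof (rule idealI)
    show "ring J" by (rule cring.axioms(1)[OF J.M_cring])
    show "subgroup ?H (add_monoid J)"
      by (rule J.add.subgroupI)
        (use Hc H.zero_closed H.a_inv_closed H.a_closed z m add in \<open>auto simp flip: a_inv_def intro!: exI[of _ "\<zero>\<^bsub>J\<^esub>"]\<close>)
    fix y a assume ya: "y \<in> ?H" "a \<in> carrier J"
    then show "a \<otimes>\<^bsub>J\<^esub> y \<in> ?H" using mult H.I_l_closed by auto
    then show "y \<otimes>\<^bsub>J\<^esub> a \<in> ?H" using ya Hc by (simp add: J.m_comm)
  qed
  moreover have "D ` carrier J \<subseteq> ?H" using D D_der_ideal by auto
  ultimately have "der_ideal \<subseteq> ?H" using J.genideal_minimal unfolding der_ideal_def by metis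
  with y show ?thesis by auto
qed

lemma ker_der_ideal_sub: "ker_der_ideal \<subseteq> ker" "ker_der_ideal \<subseteq> der_ideal"
proof -
  show "ker_der_ideal \<subseteq> ker" by (rule ker_der_ideal_least[OF ker_ideal D_ker])
  show "ker_der_ideal \<subseteq> der_ideal"
    by (rule ker_der_ideal_least[OF der_ideal]) (use D_der_ideal in \<open>auto simp: mem_ker\<close>)
qed

text \<open>For \<open>b\<close> in the kernel, \<open>b \<cdot> D x = D (b x) - D b \<cdot> x\<close>. This is the reason why \<open>(J \<cdot> D J) / (J \<cdot> D I)\<close> is
a module over \<open>A = J / I\<close>, although \<open>J / (J \<cdot> D I)\<close> in general is not.\<close>

lemma ker_mult_der_ideal:
  assumes "b \<in> ker" "y \<in> der_ideal" shows "b \<otimes>\<^bsub>J\<^esub> y \<in> ker_der_ideal"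
  using assms(2)
proof (induction rule: der_ideal_induct)
  interpret I: ideal ker J by (rule ker_ideal)
  interpret K: ideal ker_der_ideal J by (rule ker_der_ideal)
  interpret H: ideal der_ideal J by (rule der_ideal)
  have b: "b \<in> carrier J" using assms by (simp add: mem_ker)
  {
    case (D x)
    have e: "b \<otimes>\<^bsub>J\<^esub> D x = D (b \<otimes>\<^bsub>J\<^esub> x) \<ominus>\<^bsub>J\<^esub> D b \<otimes>\<^bsub>J\<^esub> x"
      using b D by (simp add: a_minus_def J.a_ac J.r_neg J.r_neg1 J.r_neg2)
    have "D (b \<otimes>\<^bsub>J\<^esub> x) \<in> ker_der_ideal" "D b \<otimes>\<^bsub>J\<^esub> x \<in> ker_der_ideal"
      using D_ker_der_ideal[OF I.I_r_closed[OF assms(1) D]] D_ker_der_ideal[OF assms(1)] D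
      by (auto intro: K.I_r_closed simp del: D_simps)
    then show ?case unfolding e a_minus_def by (intro K.a_closed K.a_inv_closed)
  next
    case (add x y)
    then show ?case using b H.Icarr by (simp add: J.r_distr K.a_closed)
  next
    case (mult a y)
    then have "a \<otimes>\<^bsub>J\<^esub> (b \<otimes>\<^bsub>J\<^esub> y) \<in> ker_der_ideal" by (simp add: K.I_l_closed)
    then show ?case using b H.Icarr mult by (simp add: J.m_lcomm)
  }
qed

definition der_quot :: "('j, 'j set) module" where
  "der_quot = quot_module ((self_module J)\<lparr>carrier := der_ideal\<rparr>) ker_der_ideal"

lemma coset_eq_iff:
  assumes H: "ideal H J" and KH: "ker_der_ideal \<subseteq> H" and x: "x \<in> H" and y: "y \<in> H"
  shows "ker_der_ideal +>\<^bsub>J\<^esub> x = ker_der_ideal +>\<^bsub>J\<^esub> y \<longleftrightarrow> x \<ominus>\<^bsub>J\<^esub> y \<in> ker_der_ideal"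
proof -
  let ?M = "(self_module J)\<lparr>carrier := H\<rparr>"
  interpret M: module J ?M by (rule ideal_module[OF J.M_cring ker_der_ideal H KH])
  interpret H: ideal H J by (rule H)
  have c: "x \<in> carrier J" "y \<in> carrier J" using x y H.Icarr by auto
  have "\<ominus>\<^bsub>?M\<^esub> y = \<ominus>\<^bsub>J\<^esub> y"
  proof (rule M.M.minus_equality)
    show "\<ominus>\<^bsub>J\<^esub> y \<oplus>\<^bsub>?M\<^esub> y = \<zero>\<^bsub>?M\<^esub>" using c by (simp add: J.l_neg)
  qed (use y in simp_all)
  then have "x \<ominus>\<^bsub>?M\<^esub> y = x \<ominus>\<^bsub>J\<^esub> y" by (simp add: a_minus_def)
  then show ?thesis
    using quot_eq_iff[OF ideal_module ideal_sub_submodule, OF J.M_cring ker_der_ideal H KH J.M_cring ker_der_ideal H KH, of x y] x y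
    by simp
qed

lemma coset_eq_zero_iff:
  assumes y: "y \<in> der_ideal"
  shows "ker_der_ideal +>\<^bsub>J\<^esub> y = ker_der_ideal \<longleftrightarrow> y \<in> ker_der_ideal"
proof -
  interpret K: ideal ker_der_ideal J by (rule ker_der_ideal)
  interpret H: ideal der_ideal J by (rule der_ideal)
  have c: "y \<in> carrier J" using y by (rule H.Icarr)
  have z: "ker_der_ideal +>\<^bsub>J\<^esub> \<zero>\<^bsub>J\<^esub> = ker_der_ideal"
    using K.a_subset by simp
  show ?thesis
    using coset_eq_iff[OF der_ideal ker_der_ideal_sub(2) y H.zero_closed] c
    unfolding z by (simp add: a_minus_def)
qed

lemma der_quot_simps:
  shows carrier_der_quot: "carrier der_quot = (\<lambda>y. ker_der_ideal +>\<^bsub>J\<^esub> y) ` der_ideal"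
    and zero_der_quot: "\<zero>\<^bsub>der_quot\<^esub> = ker_der_ideal"
    and add_der_quot: "x \<in> der_ideal \<Longrightarrow> y \<in> der_ideal \<Longrightarrow>
      (ker_der_ideal +>\<^bsub>J\<^esub> x) \<oplus>\<^bsub>der_quot\<^esub> (ker_der_ideal +>\<^bsub>J\<^esub> y) = ker_der_ideal +>\<^bsub>J\<^esub> (x \<oplus>\<^bsub>J\<^esub> y)"
    and smult_der_quot: "b \<in> carrier J \<Longrightarrow> x \<in> der_ideal \<Longrightarrow>
      b \<odot>\<^bsub>der_quot\<^esub> (ker_der_ideal +>\<^bsub>J\<^esub> x) = ker_der_ideal +>\<^bsub>J\<^esub> (b \<otimes>\<^bsub>J\<^esub> x)"
    and module_der_quot: "module J der_quot"
proof -
  note q = quot_module_simps[OF ideal_module ideal_sub_submodule,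
      OF J.M_cring ker_der_ideal der_ideal ker_der_ideal_sub(2) J.M_cring ker_der_ideal der_ideal ker_der_ideal_sub(2),
      folded der_quot_def]
  show "carrier der_quot = (\<lambda>y. ker_der_ideal +>\<^bsub>J\<^esub> y) ` der_ideal" using q(1) by simp
  show "\<zero>\<^bsub>der_quot\<^esub> = ker_der_ideal" by (simp add: der_quot_def quot_module_def)
  show "x \<in> der_ideal \<Longrightarrow> y \<in> der_ideal \<Longrightarrow>
      (ker_der_ideal +>\<^bsub>J\<^esub> x) \<oplus>\<^bsub>der_quot\<^esub> (ker_der_ideal +>\<^bsub>J\<^esub> y) = ker_der_ideal +>\<^bsub>J\<^esub> (x \<oplus>\<^bsub>J\<^esub> y)"
    using q(3)[of x y] by simp
  show "b \<in> carrier J \<Longrightarrow> x \<in> der_ideal \<Longrightarrow>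
      b \<odot>\<^bsub>der_quot\<^esub> (ker_der_ideal +>\<^bsub>J\<^esub> x) = ker_der_ideal +>\<^bsub>J\<^esub> (b \<otimes>\<^bsub>J\<^esub> x)"
    using q(4)[of b x] by simp
  show "module J der_quot" by (rule q(6))
qed

text \<open>Since \<open>D\<close> maps \<open>I\<close> into \<open>J \<cdot> D I\<close>, it induces a derivation from \<open>A\<close> to the \<open>A\<close>-module
\<open>(J \<cdot> D J) / (J \<cdot> D I)\<close>. The map \<open>\<theta>\<close> is the linear map on differentials that belongs to it.\<close>

lemma kaehler_lift:
  obtains \<theta> where "\<theta> \<zero>\<^bsub>kaehler k A\<^esub> = ker_der_ideal"
    "\<And>u v. u \<in> carrier (kaehler k A) \<Longrightarrow> v \<in> carrier (kaehler k A) \<Longrightarrow>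
      \<theta> (u \<oplus>\<^bsub>kaehler k A\<^esub> v) = \<theta> u \<oplus>\<^bsub>der_quot\<^esub> \<theta> v"
    "\<And>b u. b \<in> carrier J \<Longrightarrow> u \<in> carrier (kaehler k A) \<Longrightarrow>
      \<theta> (\<pi> b \<odot>\<^bsub>kaehler k A\<^esub> u) = b \<odot>\<^bsub>der_quot\<^esub> \<theta> u"
    "\<And>x. x \<in> carrier J \<Longrightarrow> \<theta> (kaehler_d k A (\<pi> x)) = ker_der_ideal +>\<^bsub>J\<^esub> D x"
proof -
  let ?N = "descend_scalars J \<pi> der_quot"
  interpret H: ideal der_ideal J by (rule der_ideal)
  have kill: "b \<odot>\<^bsub>der_quot\<^esub> m = \<zero>\<^bsub>der_quot\<^esub>"
    if b: "b \<in> carrier J" "\<pi> b = \<zero>\<^bsub>A\<^esub>" and m: "m \<in> carrier der_quot" for b m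
  proof -
    obtain y where y: "y \<in> der_ideal" "m = ker_der_ideal +>\<^bsub>J\<^esub> y"
      using m unfolding carrier_der_quot by blast
    then have "b \<otimes>\<^bsub>J\<^esub> y \<in> ker_der_ideal" using b by (intro ker_mult_der_ideal) (simp_all add: mem_ker)
    then show ?thesis
      using y b H.I_l_closed[OF y(1) b(1)]
      by (simp add: smult_der_quot zero_der_quot coset_eq_zero_iff)
  qed
  note ds = descend_scalars[OF module_der_quot A.M_cring diff_homD(1)[OF hom] surj kill]
  have N: "carrier ?N = carrier der_quot" "add ?N = add der_quot"
    by (simp_all add: descend_scalars_def)
  \<comment> \<open>the induced derivation, computed on an arbitrary preimage\<close>
  define \<delta> where "\<delta> a = ker_der_ideal +>\<^bsub>J\<^esub> D (inv_into (carrier J) \<pi> a)" for a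
  have \<delta>: "\<delta> (\<pi> x) = ker_der_ideal +>\<^bsub>J\<^esub> D x" if x: "x \<in> carrier J" for x
  proof -
    let ?y = "inv_into (carrier J) \<pi> (\<pi> x)"
    have y: "?y \<in> carrier J" "\<pi> ?y = \<pi> x" using x by (auto intro: inv_into_into f_inv_into_f)
    have "?y \<ominus>\<^bsub>J\<^esub> x \<in> ker" using x y by (simp add: mem_ker a_minus_def A.r_neg)
    then have "D (?y \<ominus>\<^bsub>J\<^esub> x) \<in> ker_der_ideal" by (rule D_ker_der_ideal)
    moreover have "D (?y \<ominus>\<^bsub>J\<^esub> x) = D ?y \<ominus>\<^bsub>J\<^esub> D x"
    proof -
      have "D (?y \<ominus>\<^bsub>J\<^esub> x) \<oplus>\<^bsub>J\<^esub> D x = D ?y"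
        using x y by (simp add: a_minus_def J.a_assoc J.l_neg flip: D_simps(2))
      then show ?thesis using x y by (metis D_simps(1) J.M.minus_closed J.M.add.inv_solve_right' a_minus_def a_inv_def)
    qed
    ultimately show ?thesis
      unfolding \<delta>_def
      using x y by (simp add: coset_eq_iff[OF der_ideal ker_der_ideal_sub(2)] D_der_ideal)
  qed
  have \<delta>c: "\<delta> (\<pi> x) \<in> carrier der_quot" if "x \<in> carrier J" for x
    using that by (auto simp: \<delta> carrier_der_quot D_der_ideal)
  have "\<exists>!\<psi>. \<psi> \<in> mod_hom A (kaehler k A) ?N \<inter> extensional (carrier (kaehler k A)) \<and>
     (\<forall>x\<in>carrier A. \<psi> (kaehler_d k A x) = \<delta> x)"
  proof (rule kaehler_universal[OF A.algebra_axioms ds(2)])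
    show "\<delta> \<in> carrier A \<rightarrow> carrier ?N" using \<delta>c by (auto simp: N elim: liftE)
  next
    fix a b assume "a \<in> carrier A" "b \<in> carrier A"
    then obtain x y where xy: "x \<in> carrier J" "y \<in> carrier J" "a = \<pi> x" "b = \<pi> y" by (auto elim!: liftE)
    show "\<delta> (a \<oplus>\<^bsub>A\<^esub> b) = \<delta> a \<oplus>\<^bsub>?N\<^esub> \<delta> b"
      using xy \<delta>[of "x \<oplus>\<^bsub>J\<^esub> y"] by (simp add: \<delta> N add_der_quot D_der_ideal)
    show "\<delta> (a \<otimes>\<^bsub>A\<^esub> b) = b \<odot>\<^bsub>?N\<^esub> \<delta> a \<oplus>\<^bsub>?N\<^esub> a \<odot>\<^bsub>?N\<^esub> \<delta> b"
      using xy \<delta>[of "x \<otimes>\<^bsub>J\<^esub> y"] \<delta>c[of x] \<delta>c[of y]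
      by (simp add: ds(1) N) (simp add: \<delta> add_der_quot smult_der_quot D_der_ideal H.I_l_closed J.m_comm)
  next
    fix c a assume c: "c \<in> carrier k" and "a \<in> carrier A"
    then obtain x where x: "x \<in> carrier J" "a = \<pi> x" by (auto elim!: liftE)
    have "(c \<odot>\<^bsub>A\<^esub> \<one>\<^bsub>A\<^esub>) = \<pi> (c \<odot>\<^bsub>J\<^esub> \<one>\<^bsub>J\<^esub>)" using c by simp
    then have "(c \<odot>\<^bsub>A\<^esub> \<one>\<^bsub>A\<^esub>) \<odot>\<^bsub>?N\<^esub> \<delta> a = (c \<odot>\<^bsub>J\<^esub> \<one>\<^bsub>J\<^esub>) \<odot>\<^bsub>der_quot\<^esub> \<delta> a"
      using c x \<delta>c by (simp add: ds(1) del: hom_simps)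
    also have "\<dots> = \<delta> (c \<odot>\<^bsub>A\<^esub> a)"
      using c x \<delta>[of "c \<odot>\<^bsub>J\<^esub> x"] by (simp add: \<delta> smult_der_quot D_der_ideal J.smult_assoc2)
    finally show "\<delta> (c \<odot>\<^bsub>A\<^esub> a) = (c \<odot>\<^bsub>A\<^esub> \<one>\<^bsub>A\<^esub>) \<odot>\<^bsub>?N\<^esub> \<delta> a" ..
  qed
  then obtain \<theta> where \<theta>: "\<theta> \<in> mod_hom A (kaehler k A) ?N" "\<And>x. x \<in> carrier A \<Longrightarrow> \<theta> (kaehler_d k A x) = \<delta> x"
    by blast
  note \<theta>' = mod_homD[OF \<theta>(1), unfolded N]
  show ?thesis
  proof (rule that[of \<theta>])
    show "\<theta> \<zero>\<^bsub>kaehler k A\<^esub> = ker_der_ideal"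
      using mod_hom_zero[OF module_kaehler[OF A.algebra_axioms] ds(2) \<theta>(1)]
      by (simp add: descend_scalars_def zero_der_quot)
    show "\<theta> (\<pi> b \<odot>\<^bsub>kaehler k A\<^esub> u) = b \<odot>\<^bsub>der_quot\<^esub> \<theta> u"
      if "b \<in> carrier J" "u \<in> carrier (kaehler k A)" for b u
      using that \<theta>'(1) by (simp add: \<theta>'(3) ds(1))
    show "\<theta> (kaehler_d k A (\<pi> x)) = ker_der_ideal +>\<^bsub>J\<^esub> D x" if "x \<in> carrier J" for x
      using that by (simp add: \<theta>(2) \<delta>)
  qed (rule \<theta>', assumption+)
qed

end

section \<open>The first Koszul homology group\<close>

lemma quot_coset_zero_iff:
  fixes M :: "('a, 'u) module"
  assumes M: "module R M" and N: "submodule N R M" and x: "x \<in> carrier M"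
  shows "N +>\<^bsub>M\<^esub> x = N \<longleftrightarrow> x \<in> N"
proof -
  interpret module R M by (rule M)
  have "N +>\<^bsub>M\<^esub> \<zero>\<^bsub>M\<^esub> = N"
    using zero_quot[OF M N] by (simp add: quot_module_def)
  moreover have m0: "\<ominus>\<^bsub>M\<^esub> \<zero>\<^bsub>M\<^esub> = \<zero>\<^bsub>M\<^esub>" by (rule M.minus_equality) simp_all
  have "x \<ominus>\<^bsub>M\<^esub> \<zero>\<^bsub>M\<^esub> = x"
    unfolding a_minus_def m0 using x by simp
  ultimately show ?thesis
    using quot_eq_iff[OF M N x, of "\<zero>\<^bsub>M\<^esub>"] by simp
qed

definition koszul_cycles :: "('k, 'm) ring_scheme \<Rightarrow> ('k, 'a) module \<Rightarrow> ('a \<Rightarrow> 'a) \<Rightarrow> ('a \<Rightarrow> 'a) set set" where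
  "koszul_cycles k A T = {u \<in> carrier (kaehler k A). koszul_d1 k A T u = \<zero>\<^bsub>A\<^esub>}"

lemma HK1_simps:
  fixes k :: "('k, 'm) ring_scheme" and A :: "('k, 'a) module"
  assumes dA: "diff_algebra k A T"
  defines "\<Omega> \<equiv> kaehler k A" and "N \<equiv> koszul_boundaries k A T" and "Z \<equiv> koszul_cycles k A T"
  shows carrier_HK1: "carrier (HK1 k A T) = (\<lambda>u. N +>\<^bsub>\<Omega>\<^esub> u) ` Z"
    and zero_HK1: "\<zero>\<^bsub>HK1 k A T\<^esub> = N"
    and add_HK1: "u \<in> Z \<Longrightarrow> v \<in> Z \<Longrightarrow>
      (N +>\<^bsub>\<Omega>\<^esub> u) \<oplus>\<^bsub>HK1 k A T\<^esub> (N +>\<^bsub>\<Omega>\<^esub> v) = N +>\<^bsub>\<Omega>\<^esub> (u \<oplus>\<^bsub>\<Omega>\<^esub> v)"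
    and smult_HK1: "a \<in> carrier A \<Longrightarrow> u \<in> Z \<Longrightarrow>
      a \<odot>\<^bsub>HK1 k A T\<^esub> (N +>\<^bsub>\<Omega>\<^esub> u) = N +>\<^bsub>\<Omega>\<^esub> (a \<odot>\<^bsub>\<Omega>\<^esub> u)"
proof -
  have alg: "algebra k A" using dA by (simp add: diff_algebra_def)
  interpret A: algebra k A by (rule alg)
  have om: "module A \<Omega>" unfolding \<Omega>_def by (rule module_kaehler[OF alg])
  have S: "module A (self_module A)" by (rule module_self[OF A.M_cring])
  have Z: "submodule Z A \<Omega>"
    using mod_hom_ker[OF om S, of "koszul_d1 k A T"] koszul_d1_hom[OF dA]
    by (simp add: \<Omega>_def Z_def koszul_cycles_def a_kernel_def' self_module_def)
  have N: "submodule N A \<Omega>" unfolding N_def \<Omega>_def by (rule koszul_boundaries_submodule[OF dA])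
  let ?M = "\<Omega>\<lparr>carrier := Z\<rparr>"
  have M: "module A ?M" by (rule submodule.submodule_is_module[OF Z om])
  have NZ: "N \<subseteq> Z"
    using koszul_d1_d2[OF dA] mod_homD(1)[OF koszul_d2_hom[OF dA]]
    by (auto simp: N_def Z_def koszul_boundaries_def koszul_cycles_def)
  have "submodule N A ?M"
    using NZ submodule.submodule_is_module[OF N om]
    by (intro module.module_incl_imp_submodule[OF M]) simp_all
  note q = quot_module_simps[OF M this]
  have H: "HK1 k A T = quot_module ?M N"
    by (simp add: HK1_def \<Omega>_def N_def koszul_boundaries_def Z_def koszul_cycles_def a_kernel_def' self_module_def)
  have c: "N +>\<^bsub>?M\<^esub> u = N +>\<^bsub>\<Omega>\<^esub> u" for u by (simp add: a_r_coset_def r_coset_def)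
  show "carrier (HK1 k A T) = (\<lambda>u. N +>\<^bsub>\<Omega>\<^esub> u) ` Z" using q(1) by (simp add: H c)
  show "\<zero>\<^bsub>HK1 k A T\<^esub> = N" by (simp add: H quot_module_def)
  show "u \<in> Z \<Longrightarrow> v \<in> Z \<Longrightarrow>
      (N +>\<^bsub>\<Omega>\<^esub> u) \<oplus>\<^bsub>HK1 k A T\<^esub> (N +>\<^bsub>\<Omega>\<^esub> v) = N +>\<^bsub>\<Omega>\<^esub> (u \<oplus>\<^bsub>\<Omega>\<^esub> v)"
    using q(3)[of u v] by (simp add: H c)
  show "a \<in> carrier A \<Longrightarrow> u \<in> Z \<Longrightarrow>
      a \<odot>\<^bsub>HK1 k A T\<^esub> (N +>\<^bsub>\<Omega>\<^esub> u) = N +>\<^bsub>\<Omega>\<^esub> (a \<odot>\<^bsub>\<Omega>\<^esub> u)"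
    using q(4)[of a u] by (simp add: H c)
qed

section \<open>Comparison of differentials with the kernel\<close>

text \<open>The setting for the comparison of \<open>HK\<^sub>1\<close> with \<open>I / (J \<cdot> D I)\<close>: a surjection \<open>\<pi>\<close> together with the linear
map \<open>\<theta>\<close> that sends the differential of \<open>\<pi> x\<close> to the class of \<open>D x\<close>.\<close>

locale kaehler_comparison = diff_surjection k J D A T \<pi>
  for k :: "('k, 'm) ring_scheme" and J :: "('k, 'j) module" and D
    and A :: "('k, 'a) module" and T and \<pi> +
  fixes \<theta> :: "('a \<Rightarrow> 'a) set \<Rightarrow> 'j set"
  assumes \<theta>_zero: "\<theta> \<zero>\<^bsub>kaehler k A\<^esub> = ker_der_ideal"
    and \<theta>_add: "u \<in> carrier (kaehler k A) \<Longrightarrow> v \<in> carrier (kaehler k A) \<Longrightarrow>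
      \<theta> (u \<oplus>\<^bsub>kaehler k A\<^esub> v) = \<theta> u \<oplus>\<^bsub>der_quot\<^esub> \<theta> v"
    and \<theta>_smult: "b \<in> carrier J \<Longrightarrow> u \<in> carrier (kaehler k A) \<Longrightarrow>
      \<theta> (\<pi> b \<odot>\<^bsub>kaehler k A\<^esub> u) = b \<odot>\<^bsub>der_quot\<^esub> \<theta> u"
    and \<theta>_d: "x \<in> carrier J \<Longrightarrow> \<theta> (kaehler_d k A (\<pi> x)) = ker_der_ideal +>\<^bsub>J\<^esub> D x"
begin

abbreviation \<Omega> :: "('a, ('a \<Rightarrow> 'a) set) module" where "\<Omega> \<equiv> kaehler k A"
abbreviation d1 :: "('a \<Rightarrow> 'a) set \<Rightarrow> 'a" where "d1 \<equiv> koszul_d1 k A T"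
abbreviation boundaries :: "('a \<Rightarrow> 'a) set set" where "boundaries \<equiv> koszul_boundaries k A T"

sublocale O: module A \<Omega> by (rule module_kaehler[OF A.algebra_axioms])

text \<open>If \<open>u\<close> is the sum of terms \<open>\<pi> b\<^sub>i \<cdot> d (\<pi> x\<^sub>i)\<close>, then the sum of the \<open>b\<^sub>i \<cdot> D x\<^sub>i\<close> represents \<open>u\<close>. Such an element
carries both \<open>\<theta> u\<close>, as its class, and \<open>d\<^sub>1 u\<close>, as its image under \<open>\<pi>\<close>; a Koszul cycle is thus represented
by elements of the kernel.\<close>

definition represents :: "'j \<Rightarrow> ('a \<Rightarrow> 'a) set \<Rightarrow> bool" where
  "represents y u \<longleftrightarrow> y \<in> der_ideal \<and> \<theta> u = ker_der_ideal +>\<^bsub>J\<^esub> y \<and> d1 u = \<pi> y"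

lemma d1_simps [simp]:
  "u \<in> carrier \<Omega> \<Longrightarrow> d1 u \<in> carrier A"
  "u \<in> carrier \<Omega> \<Longrightarrow> v \<in> carrier \<Omega> \<Longrightarrow> d1 (u \<oplus>\<^bsub>\<Omega>\<^esub> v) = d1 u \<oplus>\<^bsub>A\<^esub> d1 v"
  "a \<in> carrier A \<Longrightarrow> u \<in> carrier \<Omega> \<Longrightarrow> d1 (a \<odot>\<^bsub>\<Omega>\<^esub> u) = a \<otimes>\<^bsub>A\<^esub> d1 u"
  by (rule koszul_d1_simps[OF dA], assumption+)+

lemma d_closed [simp]: "x \<in> carrier A \<Longrightarrow> kaehler_d k A x \<in> carrier \<Omega>"
  by (rule kaehler_d_closed[OF A.algebra_axioms])

lemma der_ideal_carrier: "y \<in> der_ideal \<Longrightarrow> y \<in> carrier J"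
  using ideal.Icarr[OF der_ideal] .

lemma representsD: "represents y u \<Longrightarrow> y \<in> der_ideal" "represents y u \<Longrightarrow> y \<in> carrier J"
  "represents y u \<Longrightarrow> \<theta> u = ker_der_ideal +>\<^bsub>J\<^esub> y" "represents y u \<Longrightarrow> d1 u = \<pi> y"
  by (auto simp: represents_def der_ideal_carrier)

lemma represents_d: "x \<in> carrier J \<Longrightarrow> represents (D x) (kaehler_d k A (\<pi> x))"
  by (simp add: represents_def D_der_ideal \<theta>_d koszul_d1_d[OF dA])

lemma represents_add:
  assumes "represents y u" "represents z v" "u \<in> carrier \<Omega>" "v \<in> carrier \<Omega>"
  shows "represents (y \<oplus>\<^bsub>J\<^esub> z) (u \<oplus>\<^bsub>\<Omega>\<^esub> v)"
proof -
  interpret H: ideal der_ideal J by (rule der_ideal)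
  show ?thesis
    using assms by (simp add: represents_def \<theta>_add add_der_quot H.a_closed der_ideal_carrier)
qed

lemma represents_smult:
  assumes "represents y u" "b \<in> carrier J" "u \<in> carrier \<Omega>"
  shows "represents (b \<otimes>\<^bsub>J\<^esub> y) (\<pi> b \<odot>\<^bsub>\<Omega>\<^esub> u)"
proof -
  interpret H: ideal der_ideal J by (rule der_ideal)
  show ?thesis
    using assms by (simp add: represents_def \<theta>_smult smult_der_quot H.I_l_closed der_ideal_carrier)
qed

lemma kaehler_induct [consumes 1, case_names zero add]:
  assumes u: "u \<in> carrier \<Omega>" and z: "P \<zero>\<^bsub>\<Omega>\<^esub>"
    and a: "\<And>b x v. b \<in> carrier J \<Longrightarrow> x \<in> carrier J \<Longrightarrow> v \<in> carrier \<Omega> \<Longrightarrow> P v \<Longrightarrow>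
      P (\<pi> b \<odot>\<^bsub>\<Omega>\<^esub> kaehler_d k A (\<pi> x) \<oplus>\<^bsub>\<Omega>\<^esub> v)"
  shows "P u"
  using A.M_cring kaehler_rel_subset[OF A.algebra_axioms] u[unfolded kaehler_def]
proof (induction rule: pres_induct)
  case zero
  then show ?case using z by (simp add: kaehler_def)
next
  case (add a x v)
  obtain b y where "b \<in> carrier J" "y \<in> carrier J" "a = \<pi> b" "x = \<pi> y"
    using add(1,2) by (metis liftE)
  then show ?case using a[of b y v] add by (simp add: kaehler_def kaehler_d_def)
qed

lemma represents_zero: "represents \<zero>\<^bsub>J\<^esub> \<zero>\<^bsub>\<Omega>\<^esub>"
proof -
  interpret H: ideal der_ideal J by (rule der_ideal)
  interpret K: ideal ker_der_ideal J by (rule ker_der_ideal)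
  have "d1 \<zero>\<^bsub>\<Omega>\<^esub> = \<zero>\<^bsub>A\<^esub>" using d1_simps(3)[of "\<zero>\<^bsub>A\<^esub>" "\<zero>\<^bsub>\<Omega>\<^esub>"] by simp
  moreover have "ker_der_ideal +>\<^bsub>J\<^esub> \<zero>\<^bsub>J\<^esub> = ker_der_ideal"
    using coset_eq_zero_iff[OF H.zero_closed] K.zero_closed by simp
  ultimately show ?thesis by (simp add: represents_def \<theta>_zero H.zero_closed)
qed

lemma represents_ex:
  assumes "u \<in> carrier \<Omega>" shows "\<exists>y. represents y u"
  using assms
proof (induction rule: kaehler_induct)
  case zero
  show ?case using represents_zero by blast
next
  case (add b x v)
  then show ?case
    by (meson represents_add represents_smult represents_d O.smult_closed d_closed \<pi>.hom_closed)
qed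

lemma represents_surj:
  assumes "y \<in> der_ideal" shows "\<exists>u\<in>carrier \<Omega>. represents y u"
  using assms
proof (induction rule: der_ideal_induct)
  case (D x)
  then show ?case using represents_d by (intro bexI[of _ "kaehler_d k A (\<pi> x)"]) simp_all
next
  case (add x y)
  then show ?case using represents_add O.M.a_closed by meson
next
  case (mult a y)
  then show ?case using represents_smult O.smult_closed \<pi>.hom_closed by meson
qed

text \<open>If \<open>s\<close> and \<open>t\<close> represent \<open>x\<close> and \<open>y\<close>, then \<open>s t\<close> represents both \<open>d\<^sub>1 x \<cdot> y\<close> and \<open>d\<^sub>1 y \<cdot> x\<close>, so \<open>\<theta>\<close> does
not see their difference \<open>d\<^sub>2 (x \<and> y)\<close>.\<close>

lemma \<theta>_boundary:
  assumes "u \<in> boundaries" shows "\<theta> u = ker_der_ideal"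
proof -
  interpret C: module J der_quot by (rule module_der_quot)
  let ?W = "ext2 A \<Omega>" and ?d2 = "koszul_d2 k A T"
  have W: "module A ?W" by (rule module_ext2[OF O.module_axioms])
  note d2 = mod_homD[OF koszul_d2_hom[OF dA]]
  note Wc = module.smult_closed[OF W] wedge_closed[OF O.module_axioms]
  obtain w where w: "w \<in> carrier ?W" "u = ?d2 w" using assms by (auto simp: koszul_boundaries_def)
  have wedge: "\<theta> (?d2 (wedge A \<Omega> x y)) = ker_der_ideal" if x: "x \<in> carrier \<Omega>" and y: "y \<in> carrier \<Omega>" for x y
  proof -
    obtain s t where s: "represents s x" and t: "represents t y"
      using represents_ex x y by blast
    let ?v = "?d2 (wedge A \<Omega> x y)" and ?z = "d1 y \<odot>\<^bsub>\<Omega>\<^esub> x"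
    have c: "?v \<in> carrier \<Omega>" "?z \<in> carrier \<Omega>" using x y Wc(2) d2(1) by auto
    have eq: "?v \<oplus>\<^bsub>\<Omega>\<^esub> ?z = d1 x \<odot>\<^bsub>\<Omega>\<^esub> y"
      using x y koszul_d2_wedge[OF dA x y] by (simp add: a_minus_def O.M.a_assoc O.M.l_neg)
    have "represents (s \<otimes>\<^bsub>J\<^esub> t) (d1 x \<odot>\<^bsub>\<Omega>\<^esub> y)"
      using represents_smult[OF t representsD(2)[OF s] y] by (simp add: representsD(4)[OF s])
    moreover have "represents (t \<otimes>\<^bsub>J\<^esub> s) ?z"
      using represents_smult[OF s representsD(2)[OF t] x] by (simp add: representsD(4)[OF t])
    ultimately have "\<theta> (?v \<oplus>\<^bsub>\<Omega>\<^esub> ?z) = \<theta> ?z"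
      using representsD(2)[OF s] representsD(2)[OF t] by (simp add: eq representsD(3) J.m_comm)
    moreover obtain r where "represents r ?v" using represents_ex c by blast
    moreover obtain q where "represents q ?z" using represents_ex c by blast
    ultimately have "\<theta> ?v \<oplus>\<^bsub>der_quot\<^esub> \<theta> ?z = \<theta> ?z" "\<theta> ?v \<in> carrier der_quot" "\<theta> ?z \<in> carrier der_quot"
      using c by (auto simp: \<theta>_add represents_def carrier_der_quot)
    then show ?thesis by (simp add: C.M.add.l_cancel_one' zero_der_quot)
  qed
  have "\<theta> (?d2 w) = ker_der_ideal"
    using A.M_cring ext2_rel_subset[OF O.module_axioms] w(1)[unfolded ext2_def]
  proof (induction rule: pres_induct)
    case zero
    show ?case
      using mod_hom_zero[OF W O.module_axioms koszul_d2_hom[OF dA]] by (simp add: \<theta>_zero flip: ext2_def)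
  next
    case (add a b v)
    obtain x y where b: "b = (x, y)" "x \<in> carrier \<Omega>" "y \<in> carrier \<Omega>" using add(2) by auto
    obtain r where r: "r \<in> carrier J" "a = \<pi> r" using add(1) by (rule liftE)
    have v: "v \<in> carrier ?W" using add(3) by (simp add: ext2_def)
    have v': "\<theta> (?d2 v) = ker_der_ideal" using add(4) .
    have ww: "wedge A \<Omega> x y \<in> carrier ?W" using b by (intro Wc)
    have "\<theta> (?d2 (a \<odot>\<^bsub>?W\<^esub> wedge A \<Omega> x y \<oplus>\<^bsub>?W\<^esub> v)) =
        r \<odot>\<^bsub>der_quot\<^esub> \<zero>\<^bsub>der_quot\<^esub> \<oplus>\<^bsub>der_quot\<^esub> \<zero>\<^bsub>der_quot\<^esub>"
      using add(1) r b v ww wedge[of x y] v' d2(1)[OF ww] d2(1)[OF v]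
      by (simp add: d2(2)[OF Wc(1)] d2(3) \<theta>_add \<theta>_smult zero_der_quot)
    also have "\<dots> = ker_der_ideal" using r(1) by simp (simp add: zero_der_quot)
    finally show ?case using b by (simp add: wedge_def ext2_def)
  qed
  then show ?thesis using w by simp
qed

text \<open>The converse needs a homomorphism \<open>\<psi>\<close> into the extension of \<open>A\<close> by the quasi-ideal
\<open>Q = \<Omega> / im d\<^sub>2\<close>, as the universal property of an arc algebra provides it. It vanishes on
\<open>J \<cdot> D I\<close>, because \<open>\<psi> (D x)\<close> depends on \<open>\<pi> x\<close> only, and it sends a representative of \<open>u\<close> to the class of \<open>u\<close>
in \<open>Q\<close>. So \<open>\<psi>\<close> recovers this class from \<open>\<theta> u\<close>.\<close>

lemma \<theta>_eq_zero_imp_boundary: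
  assumes qi: "quasi_ideal A (quot_module \<Omega> boundaries) \<delta>"
  defines "B \<equiv> quasi_ideal.ext A (quot_module \<Omega> boundaries) \<delta>"
  assumes \<psi>: "\<psi> \<in> ring_hom J B"
    and pr: "\<And>x. x \<in> carrier J \<Longrightarrow> quasi_ideal.proj A \<delta> (\<psi> x) = \<pi> x"
    and \<psi>D: "\<And>x. x \<in> carrier J \<Longrightarrow> \<psi> (D x) = (\<zero>\<^bsub>A\<^esub>, boundaries +>\<^bsub>\<Omega>\<^esub> kaehler_d k A (\<pi> x))"
    and u: "u \<in> carrier \<Omega>" and \<theta>u: "\<theta> u = ker_der_ideal"
  shows "u \<in> boundaries"
proof -
  let ?Q = "quot_module \<Omega> boundaries"
  interpret Q: quasi_ideal A ?Q \<delta> by (rule qi)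
  interpret B: cring B unfolding B_def by (rule Q.cring_ext)
  note N = koszul_boundaries_submodule[OF dA]
  note q = quot_module_simps[OF O.module_axioms N]
  note \<psi>' = ring_hom_closed[OF \<psi>] ring_hom_add[OF \<psi>] ring_hom_mult[OF \<psi>]
  have \<psi>hom: "ring_hom_cring J B \<psi>" by (intro ring_hom_cringI J.M_cring B.is_cring \<psi>)
  have q0: "\<zero>\<^bsub>?Q\<^esub> = boundaries" by (simp add: quot_module_def)
  have "\<exists>y. represents y v \<and> \<psi> y = (\<zero>\<^bsub>A\<^esub>, boundaries +>\<^bsub>\<Omega>\<^esub> v)" if "v \<in> carrier \<Omega>" for v
    using that
  proof (induction rule: kaehler_induct)
    case zero
    have "\<psi> \<zero>\<^bsub>J\<^esub> = \<zero>\<^bsub>B\<^esub>" using ring_hom_cring.hom_zero[OF \<psi>hom] .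
    then show ?case using represents_zero by (auto simp: B_def q)
  next
    case (add b x v)
    then obtain y where y: "represents y v" "\<psi> y = (\<zero>\<^bsub>A\<^esub>, boundaries +>\<^bsub>\<Omega>\<^esub> v)" by blast
    let ?w = "\<pi> b \<odot>\<^bsub>\<Omega>\<^esub> kaehler_d k A (\<pi> x)"
    have r: "represents (b \<otimes>\<^bsub>J\<^esub> D x) ?w"
      using add by (intro represents_smult represents_d) simp_all
    have dx: "boundaries +>\<^bsub>\<Omega>\<^esub> kaehler_d k A (\<pi> x) \<in> carrier ?Q" using add by (simp add: q)
    have "\<psi> b \<in> carrier Q.ext" using \<psi>'(1)[OF add(1)] by (simp only: B_def)
    then have "\<psi> (b \<otimes>\<^bsub>J\<^esub> D x) = (\<zero>\<^bsub>A\<^esub>, boundaries +>\<^bsub>\<Omega>\<^esub> ?w)"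
      using add dx Q.ext_mult_ideal[of "\<psi> b", OF _ dx] by (simp add: \<psi>' \<psi>D pr q B_def del: Q.ext_simps)
    then have "\<psi> (b \<otimes>\<^bsub>J\<^esub> D x \<oplus>\<^bsub>J\<^esub> y) = (\<zero>\<^bsub>A\<^esub>, boundaries +>\<^bsub>\<Omega>\<^esub> (?w \<oplus>\<^bsub>\<Omega>\<^esub> v))"
      using add y representsD(2)[OF y(1)] by (simp add: \<psi>'(2) q) (simp add: B_def q)
    moreover have "represents (b \<otimes>\<^bsub>J\<^esub> D x \<oplus>\<^bsub>J\<^esub> y) (?w \<oplus>\<^bsub>\<Omega>\<^esub> v)"
      using r y add by (intro represents_add) simp_all
    ultimately show ?case by blast
  qed
  then obtain y where y: "represents y u" "\<psi> y = (\<zero>\<^bsub>A\<^esub>, boundaries +>\<^bsub>\<Omega>\<^esub> u)" using u by blast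
  have "y \<in> ker_der_ideal"
    using \<theta>u coset_eq_zero_iff[OF representsD(1)[OF y(1)]] representsD(3)[OF y(1)] by simp
  moreover have "ker_der_ideal \<subseteq> a_kernel J B \<psi>"
  proof (rule ker_der_ideal_least)
    interpret \<psi>: ring_hom_cring J B \<psi> by (rule \<psi>hom)
    show "ideal (a_kernel J B \<psi>) J" by (rule ring_hom_ring.kernel_is_ideal) unfold_locales
    have d0: "kaehler_d k A \<zero>\<^bsub>A\<^esub> = \<zero>\<^bsub>\<Omega>\<^esub>"
      by (rule additive_zero[OF A.M.abelian_group_axioms O.M.abelian_group_axioms])
        (simp_all add: kaehler_d_add[OF A.algebra_axioms])
    show "D ` ker \<subseteq> a_kernel J B \<psi>"
    proof
      fix z assume "z \<in> D ` ker"
      then obtain x where x: "x \<in> carrier J" "\<pi> x = \<zero>\<^bsub>A\<^esub>" "z = D x" by (auto simp: mem_ker)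
      have "\<psi> z = \<zero>\<^bsub>B\<^esub>" unfolding x(3) \<psi>D[OF x(1)] x(2) d0 by (simp add: B_def q)
      then show "z \<in> a_kernel J B \<psi>" using x unfolding a_kernel_def' by simp
    qed
  qed
  ultimately have "\<psi> y = \<zero>\<^bsub>B\<^esub>" unfolding a_kernel_def' by blast
  then have "boundaries +>\<^bsub>\<Omega>\<^esub> u = boundaries" using y by (simp add: B_def q0)
  then show ?thesis using quot_coset_zero_iff[OF O.module_axioms N u] by simp
qed

text \<open>Every element of \<open>J \<cdot> D J\<close> represents some differential, and for an element of the kernel this is a cycle.
If all cycles are boundaries, then \<open>\<theta>\<close> kills this cycle, so the element that represents it is zero modulo
\<open>J \<cdot> D I\<close>.\<close>

lemma HK1_trivial_imp:
  assumes "carrier (HK1 k A T) = {\<zero>\<^bsub>HK1 k A T\<^esub>}"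
  shows "ker \<inter> der_ideal \<subseteq> ker_der_ideal"
proof
  fix y assume y: "y \<in> ker \<inter> der_ideal"
  then obtain u where u: "u \<in> carrier \<Omega>" "represents y u" using represents_surj by blast
  have "u \<in> koszul_cycles k A T" using u y by (simp add: koszul_cycles_def representsD(4) mem_ker)
  then have "boundaries +>\<^bsub>\<Omega>\<^esub> u = boundaries"
    using assms unfolding HK1_simps[OF dA] by blast
  then have "u \<in> boundaries"
    using quot_coset_zero_iff[OF O.module_axioms koszul_boundaries_submodule[OF dA] u(1)] by simp
  then have "\<theta> u = ker_der_ideal" by (rule \<theta>_boundary)
  then show "y \<in> ker_der_ideal"
    using coset_eq_zero_iff y representsD(3)[OF u(2)] by simp
qed

text \<open>On cycles \<open>\<theta>\<close> takes values in \<open>I / (J \<cdot> D I)\<close>, and it descends to homology by the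
vanishing on boundaries. The hypothesis, that it vanishes nowhere else, makes the result injective.\<close>

lemma HK1_embedding:
  assumes inj: "\<And>u. u \<in> carrier \<Omega> \<Longrightarrow> \<theta> u = ker_der_ideal \<Longrightarrow> u \<in> boundaries"
  shows "\<exists>\<phi> \<in> mod_hom J (restrict_scalars \<pi> (HK1 k A T))
      (quot_module ((self_module J)\<lparr>carrier := ker\<rparr>) ker_der_ideal).
    inj_on \<phi> (carrier (HK1 k A T))"
proof -
  interpret C: module J der_quot by (rule module_der_quot)
  let ?Z = "koszul_cycles k A T" and ?H = "HK1 k A T"
  let ?R = "quot_module ((self_module J)\<lparr>carrier := ker\<rparr>) ker_der_ideal"
  note h = HK1_simps[OF dA]
  note r = quot_module_simps[OF ideal_module ideal_sub_submodule,
      OF J.M_cring ker_der_ideal ker_ideal ker_der_ideal_sub(1) J.M_cring ker_der_ideal ker_ideal ker_der_ideal_sub(1)]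
  note q5 = quot_eq_iff[OF O.module_axioms koszul_boundaries_submodule[OF dA]]
  have Zc: "u \<in> carrier \<Omega>" if "u \<in> ?Z" for u using that by (simp add: koszul_cycles_def)
  have \<theta>c: "\<theta> u \<in> carrier der_quot" if "u \<in> carrier \<Omega>" for u
    using represents_ex[OF that] by (auto simp: represents_def carrier_der_quot)
  have diff: "\<theta> u = \<theta> v \<longleftrightarrow> \<theta> (u \<ominus>\<^bsub>\<Omega>\<^esub> v) = ker_der_ideal"
    if "u \<in> carrier \<Omega>" "v \<in> carrier \<Omega>" for u v
  proof -
    have "\<theta> ((u \<ominus>\<^bsub>\<Omega>\<^esub> v) \<oplus>\<^bsub>\<Omega>\<^esub> v) = \<theta> (u \<ominus>\<^bsub>\<Omega>\<^esub> v) \<oplus>\<^bsub>der_quot\<^esub> \<theta> v" using that by (simp add: \<theta>_add)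
    then have "\<theta> u = \<theta> (u \<ominus>\<^bsub>\<Omega>\<^esub> v) \<oplus>\<^bsub>der_quot\<^esub> \<theta> v"
      using that by (simp add: a_minus_def O.M.a_assoc O.M.l_neg)
    then show ?thesis
      using that \<theta>c[of v] \<theta>c[of "u \<ominus>\<^bsub>\<Omega>\<^esub> v"]
      by (simp add: C.M.add.l_cancel_one' flip: zero_der_quot)
  qed
  have "\<theta> u = \<theta> v" if uv: "u \<in> ?Z" "v \<in> ?Z" and e: "boundaries +>\<^bsub>\<Omega>\<^esub> u = boundaries +>\<^bsub>\<Omega>\<^esub> v" for u v
    using e uv by (simp add: diff q5 Zc \<theta>_boundary)
  then obtain \<phi> where \<phi>: "\<And>u. u \<in> ?Z \<Longrightarrow> \<phi> (boundaries +>\<^bsub>\<Omega>\<^esub> u) = \<theta> u"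
    using set_quotient_lift[of ?Z "\<lambda>u. boundaries +>\<^bsub>\<Omega>\<^esub> u" \<theta>] by blast
  have rep: "\<exists>y. represents y u \<and> y \<in> ker" if "u \<in> ?Z" for u
    using represents_ex[OF Zc[OF that]] that by (auto simp: mem_ker koszul_cycles_def representsD)
  have Za: "u \<oplus>\<^bsub>\<Omega>\<^esub> v \<in> ?Z" if "u \<in> ?Z" "v \<in> ?Z" for u v
    using that by (simp add: koszul_cycles_def)
  have Zs: "\<pi> b \<odot>\<^bsub>\<Omega>\<^esub> u \<in> ?Z" if "b \<in> carrier J" "u \<in> ?Z" for b u
    using that by (simp add: koszul_cycles_def)
  have "\<phi> \<in> mod_hom J (restrict_scalars \<pi> ?H) ?R"
    unfolding mod_hom_def
  proof (intro CollectI conjI ballI Pi_I)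
    fix C assume "C \<in> carrier (restrict_scalars \<pi> ?H)"
    then obtain u where u: "u \<in> ?Z" "C = boundaries +>\<^bsub>\<Omega>\<^esub> u" by (auto simp: restrict_scalars_def h)
    obtain y where y: "represents y u" "y \<in> ker" using rep u by blast
    have \<phi>C: "\<phi> C = ker_der_ideal +>\<^bsub>J\<^esub> y" using u y by (simp add: \<phi> representsD)
    show "\<phi> C \<in> carrier ?R" using y \<phi>C by (simp add: r)
    {
      fix C' assume "C' \<in> carrier (restrict_scalars \<pi> ?H)"
      then obtain v where v: "v \<in> ?Z" "C' = boundaries +>\<^bsub>\<Omega>\<^esub> v" by (auto simp: restrict_scalars_def h)
      obtain z where z: "represents z v" "z \<in> ker" using rep v by blast
      have "represents (y \<oplus>\<^bsub>J\<^esub> z) (u \<oplus>\<^bsub>\<Omega>\<^esub> v)"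
        using y z u v by (intro represents_add Zc)
      then show "\<phi> (C \<oplus>\<^bsub>restrict_scalars \<pi> ?H\<^esub> C') = \<phi> C \<oplus>\<^bsub>?R\<^esub> \<phi> C'"
        using u v y z r(3)[of y z] by (simp add: restrict_scalars_def h \<phi> Za representsD)
    }
    fix b assume b: "b \<in> carrier J"
    have "represents (b \<otimes>\<^bsub>J\<^esub> y) (\<pi> b \<odot>\<^bsub>\<Omega>\<^esub> u)" using y u b by (intro represents_smult Zc)
    then show "\<phi> (b \<odot>\<^bsub>restrict_scalars \<pi> ?H\<^esub> C) = b \<odot>\<^bsub>?R\<^esub> \<phi> C"
      using u y b r(4)[of b y] by (simp add: restrict_scalars_def h \<phi> Zs representsD)
  qed
  moreover have "inj_on \<phi> (carrier ?H)"
  proof (rule inj_onI)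
    fix C C' assume C: "C \<in> carrier ?H" "C' \<in> carrier ?H" "\<phi> C = \<phi> C'"
    then obtain u v where uv: "u \<in> ?Z" "v \<in> ?Z" "C = boundaries +>\<^bsub>\<Omega>\<^esub> u" "C' = boundaries +>\<^bsub>\<Omega>\<^esub> v"
      by (auto simp: h)
    then have "\<theta> u = \<theta> v" using C by (simp add: \<phi>)
    then have "u \<ominus>\<^bsub>\<Omega>\<^esub> v \<in> boundaries" using uv by (intro inj) (simp_all add: diff Zc)
    then show "C = C'" using uv by (simp add: q5 Zc)
  qed
  ultimately show ?thesis by blast
qed

end

section \<open>The positive part of a graded differential algebra\<close>

context graded_diff_algebra
begin

sublocale alg: algebra k A using diff_algebra by (simp add: diff_algebra_def)

lemma homogeneous_carrier: "x \<in> Agr n \<Longrightarrow> x \<in> carrier A"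
  using module.submoduleE(1)[OF alg.module homogeneous_submodule] by blast

lemma homogeneous_closed:
  "\<zero>\<^bsub>A\<^esub> \<in> Agr n"
  "x \<in> Agr n \<Longrightarrow> y \<in> Agr n \<Longrightarrow> x \<oplus>\<^bsub>A\<^esub> y \<in> Agr n"
  "x \<in> Agr n \<Longrightarrow> \<ominus>\<^bsub>A\<^esub> x \<in> Agr n"
  using module.submoduleE(3,5)[OF alg.module homogeneous_submodule]
    subgroup.one_closed[OF submodule.axioms(1)[OF homogeneous_submodule]] by simp_all

text \<open>The finite set \<open>F\<close> may be larger than the support of \<open>f\<close>, so that two decompositions can be added over a
common index set.\<close>

definition graded_sum :: "(nat \<Rightarrow> 'a) \<Rightarrow> nat set \<Rightarrow> bool" where
  "graded_sum f F \<longleftrightarrow> finite F \<and> (\<forall>n. f n \<in> Agr n) \<and> (\<forall>n. n \<notin> F \<longrightarrow> f n = \<zero>\<^bsub>A\<^esub>)"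

lemma graded_sum_carrier: "graded_sum f F \<Longrightarrow> f n \<in> carrier A"
  using homogeneous_carrier[of "f n" n] by (simp add: graded_sum_def)

lemma graded_sum_mono:
  assumes "graded_sum f F" "finite G" "F \<subseteq> G"
  shows "(\<Oplus>\<^bsub>A\<^esub>n\<in>F. f n) = (\<Oplus>\<^bsub>A\<^esub>n\<in>G. f n)"
  by (rule alg.M.add.finprod_mono_neutral_cong_left)
    (use assms graded_sum_carrier[OF assms(1)] in \<open>auto simp: graded_sum_def\<close>)

definition positive :: "'a set" where
  "positive = {x. \<exists>f F. graded_sum f F \<and> 0 \<notin> F \<and> x = (\<Oplus>\<^bsub>A\<^esub>n\<in>F. f n)}"

lemma positive_carrier: "x \<in> positive \<Longrightarrow> x \<in> carrier A"
  unfolding positive_def using graded_sum_carrier by (auto intro!: alg.M.finsum_closed)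

lemma positive_add:
  assumes "x \<in> positive" "y \<in> positive" shows "x \<oplus>\<^bsub>A\<^esub> y \<in> positive"
proof -
  obtain f F where f: "graded_sum f F" "0 \<notin> F" "x = (\<Oplus>\<^bsub>A\<^esub>n\<in>F. f n)"
    using assms(1) by (auto simp: positive_def)
  obtain g G where g: "graded_sum g G" "0 \<notin> G" "y = (\<Oplus>\<^bsub>A\<^esub>n\<in>G. g n)"
    using assms(2) by (auto simp: positive_def)
  have fin: "finite (F \<union> G)" using f g by (simp add: graded_sum_def)
  have fc: "f n \<in> carrier A" "g n \<in> carrier A" for n
    using graded_sum_carrier f(1) g(1) by blast+
  have "x \<oplus>\<^bsub>A\<^esub> y = (\<Oplus>\<^bsub>A\<^esub>n\<in>F \<union> G. f n) \<oplus>\<^bsub>A\<^esub> (\<Oplus>\<^bsub>A\<^esub>n\<in>F \<union> G. g n)"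
    using graded_sum_mono[OF f(1) fin] graded_sum_mono[OF g(1) fin] f(3) g(3) by simp
  also have "\<dots> = (\<Oplus>\<^bsub>A\<^esub>n\<in>F \<union> G. f n \<oplus>\<^bsub>A\<^esub> g n)"
    by (rule alg.M.finsum_addf[symmetric]) (use fc in auto)
  finally have "x \<oplus>\<^bsub>A\<^esub> y = (\<Oplus>\<^bsub>A\<^esub>n\<in>F \<union> G. f n \<oplus>\<^bsub>A\<^esub> g n)" .
  moreover have "graded_sum (\<lambda>n. f n \<oplus>\<^bsub>A\<^esub> g n) (F \<union> G)"
    using f(1) g(1) by (auto simp: graded_sum_def homogeneous_closed)
  ultimately show ?thesis using f(2) g(2) unfolding positive_def by blast
qed

lemma homogeneous_positive:
  assumes "a \<in> Agr n" "n > 0" shows "a \<in> positive"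
proof -
  have "graded_sum (\<lambda>m. if m = n then a else \<zero>\<^bsub>A\<^esub>) {n}"
    using assms by (auto simp: graded_sum_def homogeneous_closed)
  moreover have "a = (\<Oplus>\<^bsub>A\<^esub>m\<in>{n}. if m = n then a else \<zero>\<^bsub>A\<^esub>)"
    using homogeneous_carrier[OF assms(1)] by simp
  ultimately show ?thesis using assms(2) unfolding positive_def by blast
qed

lemma finsum_induct:
  assumes "finite F" "\<And>n. n \<in> F \<Longrightarrow> f n \<in> carrier A" "P \<zero>\<^bsub>A\<^esub>" "\<And>n. n \<in> F \<Longrightarrow> P (f n)"
    and "\<And>x y. x \<in> carrier A \<Longrightarrow> y \<in> carrier A \<Longrightarrow> P x \<Longrightarrow> P y \<Longrightarrow> P (x \<oplus>\<^bsub>A\<^esub> y)"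
  shows "P (\<Oplus>\<^bsub>A\<^esub>n\<in>F. f n)"
  using assms
proof (induction F rule: finite_induct)
  case (insert n F)
  have "(\<Oplus>\<^bsub>A\<^esub>m\<in>F. f m) \<in> carrier A" using insert.prems by (intro alg.M.finsum_closed) auto
  then show ?case using insert by (simp add: alg.M.finsum_insert Pi_def)
qed simp

lemma homogeneous_induct [consumes 1, case_names homogeneous add]:
  assumes x: "x \<in> carrier A" and h: "\<And>n a. a \<in> Agr n \<Longrightarrow> P a"
    and add: "\<And>x y. x \<in> carrier A \<Longrightarrow> y \<in> carrier A \<Longrightarrow> P x \<Longrightarrow> P y \<Longrightarrow> P (x \<oplus>\<^bsub>A\<^esub> y)"
  shows "P x"
proof -
  obtain f where f: "\<And>n. f n \<in> Agr n" "finite {n. f n \<noteq> \<zero>\<^bsub>A\<^esub>}"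
    "x = (\<Oplus>\<^bsub>A\<^esub>n\<in>{n. f n \<noteq> \<zero>\<^bsub>A\<^esub>}. f n)"
    using decomposition[OF x] by metis
  have "P (\<Oplus>\<^bsub>A\<^esub>n\<in>{n. f n \<noteq> \<zero>\<^bsub>A\<^esub>}. f n)"
  proof (rule finsum_induct)
    show "f n \<in> carrier A" "P (f n)" for n
      using homogeneous_carrier[OF f(1)] h[OF f(1)] by auto
    show "P \<zero>\<^bsub>A\<^esub>" using h[OF homogeneous_closed(1)] .
  qed (use f(2) add in auto)
  then show ?thesis by (simp flip: f(3))
qed

lemma positive_induct [consumes 1, case_names zero homogeneous add]:
  assumes x: "x \<in> positive" and z: "P \<zero>\<^bsub>A\<^esub>" and h: "\<And>n a. n > 0 \<Longrightarrow> a \<in> Agr n \<Longrightarrow> P a"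
    and add: "\<And>x y. x \<in> carrier A \<Longrightarrow> y \<in> carrier A \<Longrightarrow> P x \<Longrightarrow> P y \<Longrightarrow> P (x \<oplus>\<^bsub>A\<^esub> y)"
  shows "P x"
proof -
  obtain f F where f: "graded_sum f F" "0 \<notin> F" "x = (\<Oplus>\<^bsub>A\<^esub>n\<in>F. f n)"
    using x by (auto simp: positive_def)
  have "P (f n)" if "n \<in> F" for n
    using f(1) f(2) that by (intro h[of n]) (auto simp: graded_sum_def intro: gr0I)
  moreover have "finite F" using f(1) by (simp add: graded_sum_def)
  ultimately have "P (\<Oplus>\<^bsub>A\<^esub>n\<in>F. f n)"
    using graded_sum_carrier[OF f(1)] z add by (intro finsum_induct[of F f P]) auto
  then show ?thesis by (simp add: f(3))
qed

lemma T_positive: "x \<in> carrier A \<Longrightarrow> T x \<in> positive"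
proof (induction rule: homogeneous_induct)
  case (homogeneous n a)
  then show ?case using T_degree by (intro homogeneous_positive[of _ "Suc n"]) auto
next
  case (add x y)
  then show ?case
    using positive_add derivationD(2)[of k A T] diff_algebra by (simp add: diff_algebra_def)
qed

lemma positive_zero: "\<zero>\<^bsub>A\<^esub> \<in> positive"
  by (rule homogeneous_positive[of _ 1]) (simp_all add: homogeneous_closed)

text \<open>Together with \<open>T_positive\<close>, this shows that the ideal generated by the image of \<open>T\<close> has no part of degree zero.\<close>

lemma positive_mult:
  assumes a: "a \<in> carrier A" and y: "y \<in> positive" shows "a \<otimes>\<^bsub>A\<^esub> y \<in> positive"
  using a
proof (induction rule: homogeneous_induct)
  case (homogeneous m a)
  have ac: "a \<in> carrier A" by (rule homogeneous_carrier[OF homogeneous])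
  show ?case using y
  proof (induction rule: positive_induct)
    case (homogeneous n b)
    then show ?case
      using mult_degree[OF \<open>a \<in> Agr m\<close>, of b n] by (intro homogeneous_positive[of _ "m + n"]) auto
  qed (use ac positive_add positive_zero in \<open>simp_all add: alg.r_distr\<close>)
next
  case (add a b)
  then show ?case using positive_carrier[OF y] by (simp add: alg.l_distr positive_add)
qed

lemma degree_zero_positive:
  assumes a: "a \<in> Agr 0" and p: "a \<in> positive" shows "a = \<zero>\<^bsub>A\<^esub>"
proof -
  obtain f F where f: "graded_sum f F" "0 \<notin> F" "a = (\<Oplus>\<^bsub>A\<^esub>n\<in>F. f n)"
    using p by (auto simp: positive_def)
  let ?g = "\<lambda>n. if n = 0 then a else \<zero>\<^bsub>A\<^esub>"
  define dec where "dec f \<longleftrightarrow> (\<forall>n. f n \<in> Agr n) \<and> finite {n. f n \<noteq> \<zero>\<^bsub>A\<^esub>} \<and> a = (\<Oplus>\<^bsub>A\<^esub>n\<in>{n. f n \<noteq> \<zero>\<^bsub>A\<^esub>}. f n)" for f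
  have sup: "dec h" if h: "graded_sum h H" "a = (\<Oplus>\<^bsub>A\<^esub>n\<in>H. h n)" for h H
  proof -
    let ?S = "{n. h n \<noteq> \<zero>\<^bsub>A\<^esub>}"
    have S: "?S \<subseteq> H" "finite H" using h(1) by (auto simp: graded_sum_def)
    then have "finite ?S" by (rule finite_subset)
    moreover from this have "graded_sum h ?S" using h(1) by (auto simp: graded_sum_def)
    ultimately show ?thesis
      using graded_sum_mono[of h ?S H] S h by (auto simp: graded_sum_def dec_def)
  qed
  have ac: "a \<in> carrier A" by (rule homogeneous_carrier[OF a])
  have "dec f" by (rule sup[OF f(1,3)])
  moreover have "dec ?g"
    by (rule sup[of _ "{0}"]) (use a ac in \<open>auto simp: graded_sum_def homogeneous_closed\<close>)
  moreover have "\<exists>!f. dec f" unfolding dec_def by (rule decomposition[OF ac])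
  ultimately have "f = ?g" by blast
  then have "f 0 = a" by simp
  moreover have "f 0 = \<zero>\<^bsub>A\<^esub>" using f by (simp add: graded_sum_def)
  ultimately show ?thesis by simp
qed

lemma degree_zero_algebra: "algebra k (A\<lparr>carrier := Agr 0\<rparr>)"
proof -
  let ?R = "A\<lparr>carrier := Agr 0\<rparr>"
  note c = homogeneous_carrier[of _ 0]
  have m: "x \<otimes>\<^bsub>A\<^esub> y \<in> Agr 0" if "x \<in> Agr 0" "y \<in> Agr 0" for x y
    using mult_degree[OF that] by simp
  have R: "cring ?R"
  proof (intro cringI abelian_groupI comm_monoidI)
    show "\<exists>y\<in>carrier ?R. y \<oplus>\<^bsub>?R\<^esub> x = \<zero>\<^bsub>?R\<^esub>" if "x \<in> carrier ?R" for x
      using that c by (auto intro!: bexI[of _ "\<ominus>\<^bsub>A\<^esub> x"] simp: alg.M.l_neg homogeneous_closed)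
  next
    show "x \<oplus>\<^bsub>?R\<^esub> y = y \<oplus>\<^bsub>?R\<^esub> x" if "x \<in> carrier ?R" "y \<in> carrier ?R" for x y
      using that c by (simp add: alg.M.a_comm)
    show "x \<otimes>\<^bsub>?R\<^esub> y = y \<otimes>\<^bsub>?R\<^esub> x" if "x \<in> carrier ?R" "y \<in> carrier ?R" for x y
      using that c by (simp add: alg.m_comm)
  qed (use c in \<open>simp_all add: homogeneous_closed m one_degree alg.M.a_assoc alg.m_assoc alg.l_distr\<close>)
  have s: "a \<odot>\<^bsub>A\<^esub> x \<in> Agr 0" if "a \<in> carrier k" "x \<in> Agr 0" for a x
    using module.submoduleE(4)[OF alg.module homogeneous_submodule] that by blast
  show ?thesis
    by (rule algebraI[OF alg.R_cring R])
      (use c s in \<open>simp_all add: alg.smult_l_distr alg.smult_r_distr alg.smult_assoc1 alg.smult_assoc2\<close>)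
qed

lemma degree_zero_incl: "(\<lambda>x. x) \<in> alg_hom k (A\<lparr>carrier := Agr 0\<rparr>) A"
  using homogeneous_carrier by (auto simp: alg_hom_def ring_hom_def)

end

section \<open>Koszul homology and the kernel of the arc algebra\<close>

text \<open>\<open>J = R + J \<cdot> D J\<close>: the right hand side contains the generators and is closed under the derivation and the ring
operations.\<close>

lemma arc_decomposition:
  assumes alg: "algebra k R" and x: "x \<in> carrier (arc_algebra k R)"
  defines "H \<equiv> Idl\<^bsub>arc_algebra k R\<^esub> (arc_der k R ` carrier (arc_algebra k R))"
  obtains a y where "a \<in> carrier R" "y \<in> H" "x = arc_in k R a \<oplus>\<^bsub>arc_algebra k R\<^esub> y"
proof -
  define J where "J = arc_algebra k R"
  interpret R: algebra k R by (rule alg)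
  have dJ: "diff_algebra k J (arc_der k R)" unfolding J_def by (rule arc_diff_algebra[OF alg])
  interpret J: algebra k J using dJ by (simp add: diff_algebra_def)
  have D: "arc_der k R z \<in> carrier J" if "z \<in> carrier J" for z
    using derivationD(1)[OF _ that, of k "arc_der k R"] dJ by (simp add: diff_algebra_def)
  have Dsub: "arc_der k R ` carrier J \<subseteq> carrier J" using D by blast
  have "ideal H J" unfolding H_def using J.genideal_ideal[OF Dsub] by (simp add: J_def)
  then interpret H: ideal H J .
  have DH: "arc_der k R z \<in> H" if "z \<in> carrier J" for z
    using J.genideal_self[OF Dsub] that unfolding H_def J_def by blast
  have i: "arc_in k R \<in> ring_hom R J" using arc_in_hom[OF alg] by (simp add: alg_hom_def J_def)
  note ic = ring_hom_closed[OF i] and ia = ring_hom_add[OF i] and im = ring_hom_mult[OF i]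
  have "\<exists>a\<in>carrier R. \<exists>y\<in>H. x = arc_in k R a \<oplus>\<^bsub>J\<^esub> y"
    using alg x
  proof (induction rule: arc_induct)
    case (gen a)
    then show ?case using ic H.zero_closed by (intro bexI[of _ a] bexI[of _ "\<zero>\<^bsub>J\<^esub>"]) auto
  next
    case (add x x')
    then obtain a y a' y' where e: "a \<in> carrier R" "y \<in> H" "x = arc_in k R a \<oplus>\<^bsub>J\<^esub> y"
      "a' \<in> carrier R" "y' \<in> H" "x' = arc_in k R a' \<oplus>\<^bsub>J\<^esub> y'" by blast
    then have "x \<oplus>\<^bsub>J\<^esub> x' = arc_in k R (a \<oplus>\<^bsub>R\<^esub> a') \<oplus>\<^bsub>J\<^esub> (y \<oplus>\<^bsub>J\<^esub> y')"
      using ic H.Icarr by (simp add: ia J.a_ac)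
    then show ?case using e H.a_closed unfolding J_def[symmetric] by blast
  next
    case (mult x x')
    then obtain a y a' y' where e: "a \<in> carrier R" "y \<in> H" "x = arc_in k R a \<oplus>\<^bsub>J\<^esub> y"
      "a' \<in> carrier R" "y' \<in> H" "x' = arc_in k R a' \<oplus>\<^bsub>J\<^esub> y'" by blast
    have c: "x' \<in> carrier J" using mult by (simp add: J_def)
    have "x \<otimes>\<^bsub>J\<^esub> x' = arc_in k R (a \<otimes>\<^bsub>R\<^esub> a') \<oplus>\<^bsub>J\<^esub> (arc_in k R a \<otimes>\<^bsub>J\<^esub> y' \<oplus>\<^bsub>J\<^esub> y \<otimes>\<^bsub>J\<^esub> x')"
      using e ic H.Icarr c by (simp add: im J.l_distr J.r_distr J.a_ac)
    moreover have "arc_in k R a \<otimes>\<^bsub>J\<^esub> y' \<oplus>\<^bsub>J\<^esub> y \<otimes>\<^bsub>J\<^esub> x' \<in> H"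
      using e ic c by (intro H.a_closed H.I_l_closed H.I_r_closed)
    ultimately show ?case using e unfolding J_def[symmetric] by blast
  next
    case (der x)
    have z: "arc_in k R \<zero>\<^bsub>R\<^esub> = \<zero>\<^bsub>J\<^esub>" by (simp add: J_def arc_algebra_def)
    have "x \<in> carrier J" using der by (simp add: J_def)
    then have "arc_der k R x = arc_in k R \<zero>\<^bsub>R\<^esub> \<oplus>\<^bsub>J\<^esub> arc_der k R x" "arc_der k R x \<in> H"
      using D DH by (simp_all add: z)
    then show ?case by blast
  qed
  then show ?thesis using that by (auto simp: J_def)
qed

theorem proposition3p3:
  fixes k :: "('k, 'm) ring_scheme" and A :: "('k, 'a) module"
    and T :: "'a \<Rightarrow> 'a" and Agr :: "nat \<Rightarrow> 'a set"
    and A0 :: "('k, 'a) module" and J :: "('k, 'a dterm set) module"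
    and D :: "'a dterm set \<Rightarrow> 'a dterm set" and \<pi> :: "'a dterm set \<Rightarrow> 'a" and I :: "'a dterm set set"
  assumes graded: "graded_diff_algebra k A T Agr"
    and A0: "A0 = A\<lparr>carrier := Agr 0\<rparr>"
    and finite_type: "finite_type k A0"
    and generated: "diff_generated_by k A T (Agr 0)"
    and J: "J = arc_algebra k A0"
    and D: "D = arc_der k A0"
    and \<pi>: "\<pi> = arc_ext k A0 A T (\<lambda>x. x)"
    and I: "I = a_kernel J A \<pi>"
  shows "\<pi> ` carrier J = carrier A \<and> ideal I J \<and> D ` I \<subseteq> I \<and>
    (carrier (HK1 k A T) = {\<zero>\<^bsub>HK1 k A T\<^esub>} \<longleftrightarrow> \<pi> \<in> diff_iso k J D A T) \<and>
    (\<exists>\<phi> \<in> mod_hom J (restrict_scalars \<pi> (HK1 k A T))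
             (quot_module ((self_module J)\<lparr>carrier := I\<rparr>) (Idl\<^bsub>J\<^esub> (D ` I))).
       inj_on \<phi> (carrier (HK1 k A T)))"
proof -
  interpret graded_diff_algebra k A T Agr by (rule graded)
  have algA: "algebra k A" by (rule alg.algebra_axioms)
  have dA: "diff_algebra k A T" by (rule diff_algebra)
  have alg0: "algebra k A0" unfolding A0 by (rule degree_zero_algebra)
  have incl: "(\<lambda>x. x) \<in> alg_hom k A0 A" unfolding A0 by (rule degree_zero_incl)
  have dJ: "diff_algebra k J D" unfolding J D by (rule arc_diff_algebra[OF alg0])
  have hom: "\<pi> \<in> diff_hom k J D A T"
    unfolding \<pi> J D by (rule arc_ext_hom[OF alg0 dA incl])
  have \<pi>_in: "\<pi> (arc_in k A0 a) = a" if "a \<in> Agr 0" for a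
    using arc_ext_in[OF alg0 dA incl, of a] that by (simp add: \<pi> A0)
  have in_c: "arc_in k A0 a \<in> carrier J" if "a \<in> Agr 0" for a
    using arc_in_hom[OF alg0] that by (auto simp: alg_hom_def ring_hom_def J A0)
  interpret J: algebra k J using dJ by (simp add: diff_algebra_def)
  note hom' = diff_homD[OF hom]
  interpret \<pi>: ring_hom_cring J A \<pi>
    by (intro ring_hom_cringI J.M_cring alg.M_cring hom'(1))
  \<comment> \<open>the image of \<open>\<pi>\<close> is a differential subalgebra that contains \<open>A\<^sup>0\<close>\<close>
  have surj: "\<pi> ` carrier J = carrier A"
  proof -
    have "submodule (\<pi> ` carrier J) k A"
    proof (rule module.submoduleI[OF alg.module])
      show "a \<odot>\<^bsub>A\<^esub> x \<in> \<pi> ` carrier J" if "a \<in> carrier k" "x \<in> \<pi> ` carrier J" for a x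
        using that by (auto simp flip: hom'(6))
      show "x \<oplus>\<^bsub>A\<^esub> y \<in> \<pi> ` carrier J" if "x \<in> \<pi> ` carrier J" "y \<in> \<pi> ` carrier J" for x y
        using that by (auto simp flip: hom'(3))
      show "\<ominus>\<^bsub>A\<^esub> x \<in> \<pi> ` carrier J" if "x \<in> \<pi> ` carrier J" for x
        using that by (auto simp flip: \<pi>.hom_a_inv)
      show "\<zero>\<^bsub>A\<^esub> \<in> \<pi> ` carrier J" using \<pi>.hom_zero J.zero_closed by (metis imageI)
    qed auto
    moreover have "subring (\<pi> ` carrier J) A"
      by (rule ring_hom_ring.img_is_subring[OF _ J.carrier_is_subring]) unfold_locales
    moreover have "T ` \<pi> ` carrier J \<subseteq> \<pi> ` carrier J"
      using derivationD(1)[of k J D] dJ by (auto simp: diff_algebra_def simp flip: hom'(5))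
    moreover have "Agr 0 \<subseteq> \<pi> ` carrier J" using \<pi>_in in_c by (metis imageI subsetI)
    ultimately show ?thesis using generated by (simp add: diff_generated_by_def is_subalgebra_def)
  qed
  interpret S: diff_surjection k J D A T \<pi>
    by (intro diff_surjection.intro dJ dA hom surj)
  have ker: "S.ker = I" unfolding S.ker_def I ..
  have K: "S.ker_der_ideal = Idl\<^bsub>J\<^esub> (D ` I)" unfolding S.ker_der_ideal_def ker ..
  obtain \<theta> where \<theta>: "kaehler_comparison k J D A T \<pi> \<theta>"
    using S.kaehler_lift
    by (metis (no_types, lifting) kaehler_comparison.intro kaehler_comparison_axioms.intro S.diff_surjection_axioms)
  interpret S: kaehler_comparison k J D A T \<pi> \<theta> by (rule \<theta>)
  obtain \<delta> where \<delta>: "quasi_ideal A (quot_module S.\<Omega> S.boundaries) \<delta>"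
    "\<And>u. u \<in> carrier S.\<Omega> \<Longrightarrow> \<delta> (S.boundaries +>\<^bsub>S.\<Omega>\<^esub> u) = S.d1 u"
    using koszul_quasi_ideal[OF dA] by blast
  define d where "d a = S.boundaries +>\<^bsub>S.\<Omega>\<^esub> kaehler_d k A a" for a
  note q = quot_module_simps[OF S.O.module_axioms koszul_boundaries_submodule[OF dA]]
  note dk = kaehler_d_add[OF algA] kaehler_d_smult[OF algA] kaehler_d_mult[OF algA]
  obtain \<psi> where \<psi>: "\<psi> \<in> ring_hom J (quasi_ideal.ext A (quot_module S.\<Omega> S.boundaries) \<delta>)"
    "\<And>x. x \<in> carrier J \<Longrightarrow> quasi_ideal.proj A \<delta> (\<psi> x) = \<pi> x"
    "\<And>x. x \<in> carrier J \<Longrightarrow> \<psi> (D x) = (\<zero>\<^bsub>A\<^esub>, d (\<pi> x))"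
  proof (rule arc_lift_quasi_ideal[OF alg0 incl dA \<delta>(1), folded J D \<pi>, of d])
    show "d \<in> carrier A \<rightarrow> carrier (quot_module S.\<Omega> S.boundaries)" by (auto simp: d_def q)
  qed (simp_all add: d_def q dk \<delta>(2) koszul_d1_d[OF dA])
  have inj: "u \<in> S.boundaries" if "u \<in> carrier S.\<Omega>" "\<theta> u = S.ker_der_ideal" for u
    using S.\<theta>_eq_zero_imp_boundary[OF \<delta>(1) \<psi>[unfolded d_def] that] .
  obtain \<phi> where \<phi>: "\<phi> \<in> mod_hom J (restrict_scalars \<pi> (HK1 k A T))
             (quot_module ((self_module J)\<lparr>carrier := I\<rparr>) (Idl\<^bsub>J\<^esub> (D ` I)))"
    "inj_on \<phi> (carrier (HK1 k A T))"
    using S.HK1_embedding[OF inj] unfolding ker K by blast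
  \<comment> \<open>write \<open>x = a + y\<close> with \<open>a\<close> in \<open>A\<^sup>0\<close> and \<open>y\<close> in \<open>J \<cdot> D J\<close>; then \<open>a = - \<pi> y\<close> has both degree zero and positive degree\<close>
  have I_sub: "I \<subseteq> S.der_ideal"
  proof
    fix x assume x: "x \<in> I"
    then have xc: "x \<in> carrier J" "\<pi> x = \<zero>\<^bsub>A\<^esub>" using S.mem_ker ker by auto
    obtain a y where ay: "a \<in> carrier A0" "y \<in> S.der_ideal" "x = arc_in k A0 a \<oplus>\<^bsub>J\<^esub> y"
      using arc_decomposition[OF alg0, of x, folded J D] xc(1) unfolding S.der_ideal_def by blast
    have a: "a \<in> Agr 0" using ay(1) by (simp add: A0)
    have "\<pi> z \<in> positive" if "z \<in> S.der_ideal" for z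
      using that
    proof (induction rule: S.der_ideal_induct)
      case (D x)
      then show ?case using T_positive by simp
    next
      case (add x y)
      then show ?case using S.der_ideal_carrier by (simp add: positive_add)
    next
      case (mult b y)
      then show ?case using S.der_ideal_carrier by (simp add: positive_mult)
    qed
    then have py: "\<pi> y \<in> positive" using ay by blast
    have "a \<oplus>\<^bsub>A\<^esub> \<pi> y = \<zero>\<^bsub>A\<^esub>"
      using xc(2) ay a in_c[OF a] S.der_ideal_carrier by (simp add: \<pi>_in)
    then have "a = (\<ominus>\<^bsub>A\<^esub> \<one>\<^bsub>A\<^esub>) \<otimes>\<^bsub>A\<^esub> \<pi> y"
      using homogeneous_carrier[OF a] positive_carrier[OF py]
      by (simp add: alg.l_minus alg.M.minus_equality)
    then have "a \<in> positive" using positive_mult[OF _ py] by simp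
    then have "a = \<zero>\<^bsub>A\<^esub>" by (rule degree_zero_positive[OF a])
    then have "arc_in k A0 a = \<zero>\<^bsub>J\<^esub>" by (simp add: J arc_algebra_def A0)
    then show "x \<in> S.der_ideal" using ay S.der_ideal_carrier by simp
  qed
  have "carrier (HK1 k A T) = {\<zero>\<^bsub>HK1 k A T\<^esub>} \<longleftrightarrow> \<pi> \<in> diff_iso k J D A T"
  proof
    assume "carrier (HK1 k A T) = {\<zero>\<^bsub>HK1 k A T\<^esub>}"
    then have "I \<inter> S.der_ideal \<subseteq> Idl\<^bsub>J\<^esub> (D ` I)" using S.HK1_trivial_imp[unfolded ker K] by simp
    with I_sub have "I \<subseteq> Idl\<^bsub>J\<^esub> (D ` I)" by (simp add: Int_absorb2)
    then have I0: "I = {\<zero>\<^bsub>J\<^esub>}"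
      using S.ker_ideal[unfolded ker] unfolding J D by (intro arc_nakayama[OF alg0])
    have "inj_on \<pi> (carrier J)"
    proof (rule inj_onI)
      fix x y assume xy: "x \<in> carrier J" "y \<in> carrier J" "\<pi> x = \<pi> y"
      then have "x \<ominus>\<^bsub>J\<^esub> y \<in> I" unfolding ker[symmetric] S.mem_ker by (simp add: a_minus_def alg.r_neg)
      then have "x \<ominus>\<^bsub>J\<^esub> y = \<zero>\<^bsub>J\<^esub>" unfolding I0 by simp
      then show "x = y" by (rule diff_zeroD[OF J.M.abelian_group_axioms xy(1,2)])
    qed
    then show "\<pi> \<in> diff_iso k J D A T" using hom surj by (simp add: diff_iso_def bij_betw_def)
  next
    assume "\<pi> \<in> diff_iso k J D A T"
    then have "inj_on \<pi> (carrier J)" by (simp add: diff_iso_def bij_betw_def)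
    then have I0: "I \<subseteq> {\<zero>\<^bsub>J\<^esub>}"
      unfolding ker[symmetric] by (auto simp: S.mem_ker dest: inj_onD[of _ _ _ "\<zero>\<^bsub>J\<^esub>"])
    let ?Z = "\<zero>\<^bsub>HK1 k A T\<^esub>"
    have Z: "?Z \<in> carrier (HK1 k A T)"
      by (rule abelian_monoid.zero_closed[OF abelian_group.axioms(1)[OF module.axioms(2)[OF module_HK1[OF dA]]]])
    have car: "carrier (quot_module ((self_module J)\<lparr>carrier := I\<rparr>) (Idl\<^bsub>J\<^esub> (D ` I))) \<subseteq> {Idl\<^bsub>J\<^esub> (D ` I) +>\<^bsub>J\<^esub> \<zero>\<^bsub>J\<^esub>}"
      using I0 by (auto simp: quot_module_def A_RCOSETS_def')
    have const: "\<phi> C = Idl\<^bsub>J\<^esub> (D ` I) +>\<^bsub>J\<^esub> \<zero>\<^bsub>J\<^esub>" if "C \<in> carrier (HK1 k A T)" for C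
      using mod_homD(1)[OF \<phi>(1), of C] that
      by (intro singletonD[OF subsetD[OF car]]) (simp add: restrict_scalars_def)
    have "C = ?Z" if C: "C \<in> carrier (HK1 k A T)" for C
      by (rule inj_onD[OF \<phi>(2) _ C Z]) (simp only: const[OF C] const[OF Z])
    then show "carrier (HK1 k A T) = {?Z}" using Z by blast
  qed
  moreover have "ideal I J" "D ` I \<subseteq> I" using S.ker_ideal S.D_ker unfolding ker by auto
  ultimately show ?thesis using surj \<phi> by blast
qed

end
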